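(* Let $U=\mathbb{D}$ or $U=\mathbb{D}^*=\mathbb{D}\setminus\{0\}$, $1<p<\infty$, $q=p/(p-1)$, and $\eta_q(\zeta)=(q-1)|\zeta|^{2q-4}$. Then the dual space of $A^p(U)$ is identified with $A^q(U,\eta_q)$ via the pairing $\{f,g\}_p=\int_U f\cdot\overline{g\circ\chi_p}\,dV$, $f\in A^p(U)$, $g\in A^q(U,\eta_q)$; that is, the map $g\mapsto\{\cdot,g\}_p$ is a conjugate-linear isomorphism of Banach spaces from $A^q(U,\eta_q)$ onto $A^p(U)'$.
   Context: $\mathbb{D}$ is the unit disc in $\mathbb{C}$, $dV$ Lebesgue measure, $\chi_p(\zeta)=\zeta|\zeta|^{p-2}$. For a weight $\lambda$, $A^r(U,\lambda)$ is the space of holomorphic $f$ on $U$ with $\int_U|f|^r\lambda\,dV<\infty$, normed by the $r$-th root of this integral; $A^p(U)=A^p(U,1)$. *)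

theory Defs
  imports "HOL-Analysis.Analysis"
begin

text \<open>The map chi_p(z) = z |z|^(p-2) (with chi_p(0) = 0).\<close>
definition chi :: "real \<Rightarrow> complex \<Rightarrow> complex" where
  "chi p z = z * complex_of_real (cmod z powr (p - 2))"

definition eta :: "real \<Rightarrow> complex \<Rightarrow> real" where
  "eta q z = (q - 1) * cmod z powr (2 * q - 4)"

definition Aspace :: "real \<Rightarrow> complex set \<Rightarrow> (complex \<Rightarrow> real) \<Rightarrow> (complex \<Rightarrow> complex) set" where
  "Aspace r U lam = {f. f holomorphic_on U \<and>
      (\<integral>\<^sup>+ z. ennreal (cmod (f z) powr r * lam z) * indicator U z \<partial>lborel) < \<infinity>}"

definition Anorm :: "real \<Rightarrow> complex set \<Rightarrow> (complex \<Rightarrow> real) \<Rightarrow> (complex \<Rightarrow> complex) \<Rightarrow> real" where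
  "Anorm r U lam f = (\<integral>z\<in>U. cmod (f z) powr r * lam z \<partial>lborel) powr (1 / r)"

definition pairing :: "real \<Rightarrow> complex set \<Rightarrow> (complex \<Rightarrow> complex) \<Rightarrow> (complex \<Rightarrow> complex) \<Rightarrow> complex" where
  "pairing p U f g = (\<integral>z\<in>U. f z * cnj (g (chi p z)) \<partial>lborel)"

end

theory Submission
  imports Defs "HOL-Complex_Analysis.Complex_Analysis"
begin

text \<open>
  The substitution \<open>v = chi p z\<close> has Jacobian \<open>eta q\<close>, so \<open>g \<mapsto> g \<circ> chi p\<close> is an isometry from
  \<open>A\<^sup>q(U, eta q)\<close> into \<open>L\<^sup>q(U)\<close> and Hoelder's inequality bounds the pairing.
  On the disc, \<open>{z\<^sup>n, z\<^sup>m}\<^sub>p\<close> vanishes for \<open>n \<noteq> m\<close> and equals \<open>2\<pi>/(np + 2)\<close> for \<open>n = m\<close>. A bounded functional \<open>L\<close>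
  can therefore only be represented by \<open>g(w) = \<Sum> b\<^sub>n w\<^sup>n\<close>, where \<open>b\<^sub>n\<close> is the conjugate of \<open>(np + 2)/(2\<pi>) L(z\<^sup>n)\<close>.
  With \<open>G = g \<circ> chi p\<close> and \<open>h = G |G|\<^sup>q\<^sup>-\<^sup>2\<close> cut off to a smaller disc, \<open>\<integral> |G|\<^sup>q\<close> over that disc is \<open>L(Ph)\<close>, where
  \<open>P\<close> is the operator with kernel \<open>\<Sum> (np + 2)/(2\<pi>) t\<^sup>n\<close> at \<open>t = z\<close> times the conjugate of \<open>chi p w\<close>.
  This kernel is \<open>O(1/|1 - t|\<^sup>2)\<close>, so \<open>P\<close> is bounded on \<open>L\<^sup>p\<close> by the Schur test, which bounds the norm of \<open>g\<close>
  by a multiple of the norm of \<open>L\<close>. Neither the Hahn-Banach theorem nor the duality of \<open>L\<^sup>p\<close> spaces is needed.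
  On the punctured disc both spaces gain at most the function \<open>1/z\<close>, and they gain it simultaneously.
\<close>

section \<open>Rotation invariance of Lebesgue measure on the plane\<close>

text \<open>The kernel is \<open>O(1/|1 - t|^2)\<close> because
  \<open>np + 2 = p (n + 1) + (2 - p)\<close>: it is a combination of the geometric series and its
  derivative. Since \<open>chi p\<close> is not holomorphic, the kernel is not symmetric in
  \<open>z\<close> and \<open>w\<close>, so the Schur test needs an estimate in each variable. Both
  rest on an exact identity: averaging \<open>1/|1 - x|^2\<close> over rotations of \<open>x\<close>
  gives \<open>1/(1 - |x|^2)\<close>. The cut-off in the test function \<open>h\<close> is
  essential. Nothing is known beforehand about the integrability of \<open>G\<close>; with the
  cut-off every interchange of sum and integral converges absolutely, \<open>L\<close> is applied to
  power series only, and the resulting inequality \<open>A \<le> c A^(1/p)\<close> has a finite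
  \<open>A\<close>, so it can be divided by \<open>A^(1/p)\<close>. The bound does not depend on the
  radius. As \<open>g\<close> is built from the values \<open>L(z^n)\<close> alone, monomials must
  determine a bounded functional; this is shown by approximating \<open>f\<close> by its dilates. At
  the puncture a pole is at most simple because the weight exponents \<open>0\<close> and
  \<open>2q - 4\<close> lie below \<open>2(p - 1)\<close> and \<open>2(q - 1)\<close>. All bounds
  are linear in the bound of \<open>L\<close>, which yields the bounded inverse without the open
  mapping theorem.\<close>

lemma nn_integral_complex_iterated:
  fixes F :: "complex \<Rightarrow> ennreal"
  assumes [measurable]: "F \<in> borel_measurable borel"
  shows "(\<integral>\<^sup>+z. F z \<partial>lborel) = (\<integral>\<^sup>+x. \<integral>\<^sup>+y. F (Complex x y) \<partial>lborel \<partial>lborel)"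
proof -
  let ?C = "\<lambda>(x, y). Complex x y"
  have [measurable]: "?C \<in> borel_measurable (lborel \<Otimes>\<^sub>M lborel)"
    unfolding Complex_eq by measurable
  have "(lborel :: complex measure) = distr (lborel \<Otimes>\<^sub>M lborel) borel ?C"
  proof (rule lborel_eqI)
    fix l u :: complex
    assume le: "\<And>b. b \<in> Basis \<Longrightarrow> l \<bullet> b \<le> u \<bullet> b"
    have *: "Re l \<le> Re u" "Im l \<le> Im u"
      using le[of 1] le[of \<i>] by (auto simp: Basis_complex_def)
    have "?C -` box l u \<inter> space (lborel \<Otimes>\<^sub>M lborel) = {Re l<..<Re u} \<times> {Im l<..<Im u}"
      by (auto simp: box_def Basis_complex_def space_pair_measure)
    with * show "emeasure (distr (lborel \<Otimes>\<^sub>M lborel) borel ?C) (box l u) = ennreal (\<Prod>b\<in>Basis. (u - l) \<bullet> b)"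
      by (simp add: emeasure_distr lborel.emeasure_pair_measure_Times Basis_complex_def ennreal_mult)
  qed simp
  then have "(\<integral>\<^sup>+z. F z \<partial>lborel) = (\<integral>\<^sup>+z. F z \<partial>distr (lborel \<Otimes>\<^sub>M lborel) borel ?C)"
    by simp
  also have "\<dots> = (\<integral>\<^sup>+xy. F (?C xy) \<partial>(lborel \<Otimes>\<^sub>M lborel))"
    by (subst nn_integral_distr) simp_all
  also have "\<dots> = (\<integral>\<^sup>+x. \<integral>\<^sup>+y. F (Complex x y) \<partial>lborel \<partial>lborel)"
    by (subst lborel.nn_integral_fst[symmetric]) auto
  finally show ?thesis .
qed

lemma borel_measurable_Complex [measurable]:
  assumes [measurable]: "f \<in> borel_measurable M" "g \<in> borel_measurable M"
  shows "(\<lambda>x. Complex (f x) (g x)) \<in> borel_measurable M"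
  unfolding Complex_eq by measurable

text \<open>For a fixed real part the shear is only a translation of the imaginary part.\<close>

lemma nn_integral_shear_Im:
  fixes F :: "complex \<Rightarrow> ennreal"
  assumes [measurable]: "F \<in> borel_measurable borel"
  shows "(\<integral>\<^sup>+z. F (Complex (Re z) (Im z + t * Re z)) \<partial>lborel) = (\<integral>\<^sup>+z. F z \<partial>lborel)"
proof -
  have "(\<integral>\<^sup>+y. F (Complex x (y + t * x)) \<partial>lborel) = (\<integral>\<^sup>+y. F (Complex x y) \<partial>lborel)" for x
    using nn_integral_real_affine[of "\<lambda>y. F (Complex x y)" 1 "t * x"] by (simp add: add.commute)
  then show ?thesis
    by (simp add: nn_integral_complex_iterated)
qed

lemma nn_integral_shear_Re:
  fixes F :: "complex \<Rightarrow> ennreal"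
  assumes [measurable]: "F \<in> borel_measurable borel"
  shows "(\<integral>\<^sup>+z. F (Complex (Re z + t * Im z) (Im z)) \<partial>lborel) = (\<integral>\<^sup>+z. F z \<partial>lborel)"
proof -
  have *: "(\<integral>\<^sup>+z. G z \<partial>lborel) = (\<integral>\<^sup>+y. \<integral>\<^sup>+x. G (Complex x y) \<partial>lborel \<partial>lborel)"
    if [measurable]: "G \<in> borel_measurable borel" for G :: "complex \<Rightarrow> ennreal"
    by (subst nn_integral_complex_iterated, simp) (rule lborel_pair.Fubini'; simp)
  have "(\<integral>\<^sup>+x. F (Complex (x + t * y) y) \<partial>lborel) = (\<integral>\<^sup>+x. F (Complex x y) \<partial>lborel)" for y
    using nn_integral_real_affine[of "\<lambda>x. F (Complex x y)" 1 "t * y"] by (simp add: add.commute)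
  then show ?thesis
    by (simp add: *)
qed

lemma nn_integral_rotate:
  fixes F :: "complex \<Rightarrow> ennreal"
  assumes [measurable]: "F \<in> borel_measurable borel" and w: "cmod w = 1"
  shows "(\<integral>\<^sup>+z. F (w * z) \<partial>lborel) = (\<integral>\<^sup>+z. F z \<partial>lborel)"
proof -
  \<comment> \<open>A rotation by an angle other than a multiple of pi is a product of three shears.\<close>
  have shears: "(\<integral>\<^sup>+z. F (w * z) \<partial>lborel) = (\<integral>\<^sup>+z. F z \<partial>lborel)"
    if w: "cmod w = 1" "Im w \<noteq> 0" and [measurable]: "F \<in> borel_measurable borel"
    for w and F :: "complex \<Rightarrow> ennreal"
  proof -
    \<comment> \<open>\<open>s\<close> is the sine of the rotation angle and \<open>t\<close> is
      minus the tangent of half the angle, which is finite because \<open>Im w\<close> is not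
      0.\<close>
    define s t where "s = Im w" and "t = - (1 - Re w) / Im w"
    have cs: "(Re w)\<^sup>2 + (Im w)\<^sup>2 = 1"
      using w(1) by (simp add: cmod_def)
    let ?A = "\<lambda>z. Complex (Re z + t * Im z) (Im z)" and ?B = "\<lambda>z. Complex (Re z) (Im z + s * Re z)"
    have "w * z = ?A (?B (?A z))" for z
    proof (rule complex_eqI)
      have t1: "1 + t * s = Re w"
        using w(2) by (simp add: s_def t_def)
      have "t * (1 + Re w) = - s"
        using w(2) cs by (simp add: s_def t_def field_simps power2_eq_square)
      then have t2: "t * (1 + (1 + t * s)) = - s"
        using t1 by simp
      have "Re (w * z) = (1 + t * s) * Re z - s * Im z"
        by (simp add: t1) (simp add: s_def)
      also have "\<dots> = (1 + t * s) * Re z + t * (1 + (1 + t * s)) * Im z"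
        using t2 by simp
      also have "\<dots> = Re (?A (?B (?A z)))"
        by (simp add: algebra_simps)
      finally show "Re (w * z) = Re (?A (?B (?A z)))" .
      have "Im (w * z) = (1 + t * s) * Im z + s * Re z"
        by (simp add: t1) (simp add: s_def)
      also have "\<dots> = Im (?A (?B (?A z)))"
        by (simp add: algebra_simps)
      finally show "Im (w * z) = Im (?A (?B (?A z)))" .
    qed
    then have "(\<integral>\<^sup>+z. F (w * z) \<partial>lborel) = (\<integral>\<^sup>+z. F (?A (?B (?A z))) \<partial>lborel)"
      by presburger
    also have "\<dots> = (\<integral>\<^sup>+z. F (?A (?B z)) \<partial>lborel)"
      by (rule nn_integral_shear_Re[of "\<lambda>z. F (?A (?B z))" t]) simp
    also have "\<dots> = (\<integral>\<^sup>+z. F (?A z) \<partial>lborel)"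
      by (rule nn_integral_shear_Im[of "\<lambda>z. F (?A z)" s]) simp
    also have "\<dots> = (\<integral>\<^sup>+z. F z \<partial>lborel)"
      by (rule nn_integral_shear_Re) simp
    finally show ?thesis .
  qed
  show ?thesis
  proof (cases "Im w = 0")
    case True
    \<comment> \<open>For \<open>w = 1\<close> or \<open>w = -1\<close> the rotation is split into
      two, by \<open>\<i>\<close> and by \<open>w * - \<i>\<close>, both with nonzero imaginary
      part.\<close>
    have "(\<integral>\<^sup>+z. F (w * z) \<partial>lborel) = (\<integral>\<^sup>+z. F (\<i> * ((w * - \<i>) * z)) \<partial>lborel)"
      by (intro nn_integral_cong arg_cong[of _ _ F]) (simp add: complex_eq_iff)
    also have "\<dots> = (\<integral>\<^sup>+z. F (\<i> * z) \<partial>lborel)"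
      using w True by (intro shears[of "w * - \<i>" "\<lambda>z. F (\<i> * z)"]) (auto simp: norm_mult cmod_def)
    also have "\<dots> = (\<integral>\<^sup>+z. F z \<partial>lborel)"
      by (intro shears) auto
    finally show ?thesis .
  qed (use shears w in simp)
qed

lemma distr_lborel_rotate:
  assumes "cmod w = 1"
  shows "distr lborel borel ((*) w) = lborel"
proof (rule measure_eqI)
  fix A :: "complex set" assume "A \<in> sets (distr lborel borel ((*) w))"
  then have [measurable]: "A \<in> sets borel" by simp
  have "emeasure (distr lborel borel ((*) w)) A = (\<integral>\<^sup>+z. indicator A z \<partial>distr lborel borel ((*) w))"
    by simp
  also have "\<dots> = (\<integral>\<^sup>+z. indicator A (w * z) \<partial>lborel)"
    by (subst nn_integral_distr) simp_all
  also have "\<dots> = (\<integral>\<^sup>+z. indicator A z \<partial>lborel)"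
    using assms by (intro nn_integral_rotate) simp_all
  finally show "emeasure (distr lborel borel ((*) w)) A = emeasure lborel A"
    by simp
qed simp

lemma lborel_integral_rotate:
  fixes F :: "complex \<Rightarrow> complex"
  assumes [measurable]: "F \<in> borel_measurable borel" and w: "cmod w = 1"
  shows "(\<integral>z. F (w * z) \<partial>lborel) = (\<integral>z. F z \<partial>lborel)"
  using integral_distr[of "(*) w" lborel borel F] distr_lborel_rotate[OF w] by simp

text \<open>The rotation leaves the integral unchanged and also multiplies it by \<open>c\<close>.
  For a non-integrable \<open>F\<close> the default value 0 of the integral agrees with the
  conclusion.\<close>

lemma lborel_integral_equivariant_eq_0:
  fixes F :: "complex \<Rightarrow> complex"
  assumes [measurable]: "F \<in> borel_measurable borel" and w: "cmod w = 1" "c \<noteq> 1"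
    and eq: "\<And>z. F (w * z) = c * F z"
  shows "(\<integral>z. F z \<partial>lborel) = 0"
proof -
  have "(\<integral>z. F z \<partial>lborel) = (\<integral>z. F (w * z) \<partial>lborel)"
    using w by (simp add: lborel_integral_rotate)
  also have "\<dots> = c * (\<integral>z. F z \<partial>lborel)"
    by (simp add: eq)
  finally show ?thesis
    using w(2) by (metis mult_cancel_right1)
qed

section \<open>Radial integrals and the change of variables along chi\<close>

lemma sets_borel_ball [measurable]: "ball (a :: 'a :: metric_space) r \<in> sets borel"
  by simp

lemma emeasure_disc: "0 \<le> r \<Longrightarrow> emeasure lborel (ball (0::complex) r) = ennreal (pi * r\<^sup>2)"
  by (simp add: emeasure_ball unit_ball_vol_2)

text \<open>The image of area on the disc under \<open>|z|^k\<close> is identified by its masses on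
  half-lines, \<open>pi - pi * x^(2/k)\<close> for \<open>x\<close> in \<open>[0, 1]\<close>. The
  exponent \<open>k = 1\<close> gives the usual radial formula and \<open>k = p - 1\<close> the
  modulus of \<open>chi p\<close>, so both sides of the substitution are covered.\<close>

lemma nn_integral_disc_powr:
  fixes u :: "real \<Rightarrow> ennreal"
  assumes [measurable]: "u \<in> borel_measurable borel" and k: "0 < k"
  shows "(\<integral>\<^sup>+z. u (cmod z powr k) * indicator (ball 0 1) z \<partial>lborel) =
    (\<integral>\<^sup>+t. u t * ennreal (2 * pi / k * t powr (2 / k - 1)) * indicator {0<..<1} t \<partial>lborel)"
proof -
  let ?d = "\<lambda>t. ennreal (2 * pi / k * t powr (2 / k - 1)) * indicator {0<..<1} t"
  define M where "M = distr (density lborel (indicator (ball 0 1 :: complex set))) borel (\<lambda>z. cmod z powr k)"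
  define N where "N = density lborel ?d"
  have M: "emeasure M {x<..} = emeasure lborel ({z. x < cmod z powr k} \<inter> ball 0 1)" for x
    unfolding M_def
    by (subst emeasure_distr) (auto simp: emeasure_restricted vimage_def Int_commute)
  have N0: "(\<integral>\<^sup>+t. ennreal (2 * pi / k * t powr (2 / k - 1)) * indicator {y..1} t \<partial>lborel)
      = ennreal (pi - pi * y powr (2 / k))" if y: "0 \<le> y" "y \<le> 1" for y
  proof (rule nn_integral_has_integral_lebesgue')
    have "((\<lambda>t. 2 * pi / k * t powr (2 / k - 1)) has_integral pi * 1 powr (2 / k) - pi * y powr (2 / k)) {y..1}"
    proof (rule fundamental_theorem_of_calculus_interior[OF y(2)])
      show "continuous_on {y..1} (\<lambda>x. pi * x powr (2 / k))"
        using k y by (intro continuous_intros continuous_on_powr') auto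
      fix x assume "x \<in> {y<..<1}"
      then have "0 < x" using y by simp
      then show "((\<lambda>x. pi * x powr (2 / k)) has_vector_derivative 2 * pi / k * x powr (2 / k - 1)) (at x)"
        unfolding has_real_derivative_iff_has_vector_derivative[symmetric]
        by (auto intro!: derivative_eq_intros simp: powr_diff)
    qed
    then show "((\<lambda>t. 2 * pi / k * t powr (2 / k - 1)) has_integral pi - pi * y powr (2 / k)) {y..1}"
      by simp
  qed (use k in simp)
  have N: "emeasure N {x<..} = ennreal (pi - pi * (max 0 x) powr (2 / k))" if "x \<le> 1" for x
  proof -
    have "emeasure N {x<..} = (\<integral>\<^sup>+t. ennreal (2 * pi / k * t powr (2 / k - 1)) * indicator {max 0 x..1} t \<partial>lborel)"
      unfolding N_def
      by (subst emeasure_density, simp, simp, rule nn_integral_cong_AE)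
        (use AE_lborel_singleton[of x] AE_lborel_singleton[of 0] AE_lborel_singleton[of 1] in
          \<open>eventually_elim; auto simp: indicator_def\<close>)
    then show ?thesis
      using N0[of "max 0 x"] that by simp
  qed
  have MN: "emeasure M {x<..} = emeasure N {x<..}" for x
  proof -
    consider "x < 0" | "0 \<le> x" "x \<le> 1" | "1 < x" by linarith
    then show ?thesis
    proof cases
      case 1
      then have *: "{z::complex. x < cmod z powr k} = UNIV"
        by (auto intro: less_le_trans)
      show ?thesis
        using 1 by (simp add: M * N emeasure_disc)
    next
      case 2
      define y where "y = x powr (1 / k)"
      have y: "0 \<le> y" "y \<le> 1" "y\<^sup>2 = x powr (2 / k)"
        using 2 k by (auto simp: y_def powr_le1 power2_eq_square powr_add[symmetric])
      have "{z::complex. x < cmod z powr k} = - cball 0 y"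
      proof -
        have "x < cmod z powr k \<longleftrightarrow> y < cmod z" for z :: complex
        proof -
          have "x = y powr k"
            using 2 k by (simp add: y_def powr_powr)
          then show ?thesis
            using y k powr_less_mono2[of k y "cmod z"] powr_mono2[of k "cmod z" y] by (meson norm_ge_zero not_le less_imp_le)
        qed
        then show ?thesis
          by (intro set_eqI) (simp add: not_le)
      qed
      then have "emeasure M {x<..} = emeasure lborel (ball 0 1 - cball (0::complex) y)"
        by (simp add: M Diff_eq Int_commute)
      also have "\<dots> = emeasure lborel (ball 0 1 - ball (0::complex) y)"
      proof (rule emeasure_eq_AE)
        have "sphere (0::complex) y \<in> null_sets lborel"
          using negligible_sphere[of 0 y] by (auto simp: null_sets_completion_iff negligible_iff_null_sets)
        then have "AE z in lborel. z \<notin> sphere (0::complex) y"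
          by (rule AE_not_in)
        then show "AE z in lborel. z \<in> ball 0 1 - cball (0::complex) y \<longleftrightarrow> z \<in> ball 0 1 - ball 0 y"
          by eventually_elim auto
      qed auto
      also have "\<dots> = ennreal (pi * 1\<^sup>2) - ennreal (pi * y\<^sup>2)"
        using y by (subst emeasure_Diff) (auto simp: emeasure_disc)
      also have "\<dots> = ennreal (pi - pi * x powr (2 / k))"
        using y by (subst ennreal_minus) auto
      finally show ?thesis
        using 2 by (simp add: N)
    next
      case 3
      have "cmod z powr k \<le> 1" if "z \<in> ball 0 1" for z
        using that k by (simp add: powr_le1)
      then have *: "{z::complex. x < cmod z powr k} \<inter> ball 0 1 = {}"
        using 3 by force
      have "emeasure N {x<..} = (\<integral>\<^sup>+t. 0 \<partial>(lborel :: real measure))"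
        unfolding N_def using 3
        by (subst emeasure_density, simp, simp, intro nn_integral_cong) (simp add: indicator_def)
      then show ?thesis
        by (simp add: M *)
    qed
  qed
  have "M = N"
  proof (rule measure_eqI_lessThan)
    show "emeasure M {x<..} < \<infinity>" for x
    proof -
      have "emeasure M {x<..} \<le> emeasure lborel (ball (0::complex) 1)"
        unfolding M by (rule emeasure_mono) auto
      then show ?thesis
        by (simp add: emeasure_disc order_le_less_trans)
    qed
  qed (auto simp: MN, auto simp: M_def N_def)
  have "(\<integral>\<^sup>+z. u (cmod z powr k) * indicator (ball 0 1) z \<partial>lborel) = (\<integral>\<^sup>+t. u t \<partial>M)"
    by (simp add: M_def nn_integral_distr nn_integral_density mult.commute)
  also have "\<dots> = (\<integral>\<^sup>+t. u t * ?d t \<partial>lborel)"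
    by (simp add: \<open>M = N\<close> N_def nn_integral_density mult.commute)
  finally show ?thesis
    by (simp add: mult.assoc)
qed

lemma nn_integral_disc_radial:
  fixes u :: "real \<Rightarrow> ennreal"
  assumes "u \<in> borel_measurable borel"
  shows "(\<integral>\<^sup>+z. u (cmod z) * indicator (ball 0 1) z \<partial>lborel) =
    (\<integral>\<^sup>+t. u t * ennreal (2 * pi * t) * indicator {0<..<1} t \<partial>lborel)"
proof -
  have "(\<integral>\<^sup>+z. u (cmod z) * indicator (ball 0 1) z \<partial>lborel) =
      (\<integral>\<^sup>+t. u t * ennreal (2 * pi * \<bar>t\<bar>) * indicator {0<..<1} t \<partial>lborel)"
    using nn_integral_disc_powr[OF assms, of 1] by simp
  also have "\<dots> = (\<integral>\<^sup>+t. u t * ennreal (2 * pi * t) * indicator {0<..<1} t \<partial>lborel)"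
    by (rule nn_integral_cong) (auto simp: indicator_def)
  finally show ?thesis .
qed

lemma borel_measurable_sgn_complex [measurable]: "(sgn :: complex \<Rightarrow> complex) \<in> borel_measurable borel"
  unfolding sgn_div_norm by measurable

lemma borel_measurable_chi [measurable]: "chi p \<in> borel_measurable borel"
  unfolding chi_def by measurable

lemma borel_measurable_eta [measurable]: "eta q \<in> borel_measurable borel"
  unfolding eta_def by measurable

lemma chi_rotate: "cmod w = 1 \<Longrightarrow> chi p (w * z) = w * chi p z"
  by (simp add: chi_def norm_mult)

lemma norm_chi: "cmod (chi p z) = cmod z powr (p - 1)"
proof (cases "z = 0")
  case False
  then show ?thesis
    using powr_add[of "cmod z" 1 "p - 2"] by (simp add: chi_def norm_mult)
qed (simp add: chi_def)

text \<open>This replaces integration over the angle: for \<open>y\<close> in the disc,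
  \<open>sgn y\<close> is a uniformly distributed direction of total mass \<open>pi\<close>.
  Rotating \<open>z\<close> by \<open>sgn y\<close> does not change the integral, and after Tonelli
  the inner integral depends only on \<open>cmod (T z)\<close>.\<close>

lemma nn_integral_rotation_average:
  fixes F K :: "complex \<Rightarrow> ennreal" and T :: "complex \<Rightarrow> complex"
  assumes [measurable]: "F \<in> borel_measurable borel" "K \<in> borel_measurable borel" "T \<in> borel_measurable borel"
    and K: "\<And>w z. cmod w = 1 \<Longrightarrow> K (w * z) = K z"
    and T: "\<And>w z. cmod w = 1 \<Longrightarrow> T (w * z) = w * T z"
  shows "ennreal pi * (\<integral>\<^sup>+z. F (T z) * K z \<partial>lborel) =
    (\<integral>\<^sup>+z. (\<integral>\<^sup>+y. F (sgn y * complex_of_real (cmod (T z))) * indicator (ball 0 1) y \<partial>lborel) * K z \<partial>lborel)"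
proof -
  define I where "I = (\<integral>\<^sup>+z. F (T z) * K z \<partial>lborel)"
  have rot: "(\<integral>\<^sup>+z. F (sgn y * T z) * K z \<partial>lborel) = I" if "y \<noteq> 0" for y
  proof -
    have "cmod (sgn y) = 1" using that by (simp add: norm_sgn)
    then have "(\<integral>\<^sup>+z. F (sgn y * T z) * K z \<partial>lborel) = (\<integral>\<^sup>+z. F (T (sgn y * z)) * K (sgn y * z) \<partial>lborel)"
      by (simp add: K T)
    also have "\<dots> = I"
      unfolding I_def using \<open>cmod (sgn y) = 1\<close> by (intro nn_integral_rotate) auto
    finally show ?thesis .
  qed
  \<comment> \<open>A second rotation, now of \<open>y\<close>, absorbs the argument of
    \<open>v\<close>.\<close>
  have avg: "(\<integral>\<^sup>+y. F (sgn y * v) * indicator (ball 0 1) y \<partial>lborel) =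
      (\<integral>\<^sup>+y. F (sgn y * complex_of_real (cmod v)) * indicator (ball 0 1) y \<partial>lborel)" for v
  proof (cases "v = 0")
    case False
    then have 1: "cmod (sgn v) = 1" by (simp add: norm_sgn)
    have v: "v = sgn v * complex_of_real (cmod v)" using False by (simp add: sgn_div_norm scaleR_conv_of_real)
    have "(\<integral>\<^sup>+y. F (sgn y * v) * indicator (ball 0 1) y \<partial>lborel) =
        (\<integral>\<^sup>+y. F (sgn (sgn v * y) * complex_of_real (cmod v)) * indicator (ball 0 1) (sgn v * y) \<partial>lborel)"
    proof (rule nn_integral_cong)
      fix y
      have "sgn y * v = sgn (sgn v * y) * complex_of_real (cmod v)"
        by (subst (1) v) (simp add: sgn_mult)
      then show "F (sgn y * v) * indicator (ball 0 1) y = F (sgn (sgn v * y) * complex_of_real (cmod v)) * indicator (ball 0 1) (sgn v * y)"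
        using 1 by (simp add: indicator_def norm_mult)
    qed
    also have "\<dots> = (\<integral>\<^sup>+y. F (sgn y * complex_of_real (cmod v)) * indicator (ball 0 1) y \<partial>lborel)"
      using 1 by (intro nn_integral_rotate) auto
    finally show ?thesis .
  qed simp
  have "ennreal pi * I = I * (\<integral>\<^sup>+y. indicator (ball (0::complex) 1) y \<partial>lborel)"
    by (simp add: emeasure_disc mult.commute)
  also have "\<dots> = (\<integral>\<^sup>+y. I * indicator (ball (0::complex) 1) y \<partial>lborel)"
    by (simp add: nn_integral_cmult)
  also have "\<dots> = (\<integral>\<^sup>+y. (\<integral>\<^sup>+z. F (sgn y * T z) * K z \<partial>lborel) * indicator (ball 0 1) y \<partial>lborel)"
    by (rule nn_integral_cong_AE) (use AE_lborel_singleton[of 0] in \<open>eventually_elim; simp add: rot\<close>)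
  also have "\<dots> = (\<integral>\<^sup>+y. (\<integral>\<^sup>+z. F (sgn y * T z) * K z * indicator (ball 0 1) y \<partial>lborel) \<partial>lborel)"
    by (simp add: nn_integral_multc)
  also have "\<dots> = (\<integral>\<^sup>+z. (\<integral>\<^sup>+y. F (sgn y * T z) * K z * indicator (ball 0 1) y \<partial>lborel) \<partial>lborel)"
    by (rule lborel_pair.Fubini') simp
  also have "\<dots> = (\<integral>\<^sup>+z. (\<integral>\<^sup>+y. F (sgn y * T z) * indicator (ball 0 1) y \<partial>lborel) * K z \<partial>lborel)"
    by (rule nn_integral_cong, subst nn_integral_multc[symmetric]) (simp_all add: mult_ac)
  finally show ?thesis
    unfolding avg[of "T _"] I_def .
qed

text \<open>Averaging turns both sides into a radial integral of the same \<open>u\<close>: the left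
  with \<open>T = chi p\<close>, the right with the identity and the weight \<open>eta q\<close>.
  The radial densities agree because \<open>q - 1 = 1/(p - 1)\<close>, that is,
  \<open>2/(p - 1) - 1 = (2q - 4) + 1\<close>. No derivative of \<open>chi p\<close> is taken, which
  for \<open>p < 2\<close> would fail at 0.\<close>

lemma nn_integral_chi:
  fixes F :: "complex \<Rightarrow> ennreal"
  assumes F [measurable]: "F \<in> borel_measurable borel" and p: "1 < p" and q: "q = p / (p - 1)"
  shows "(\<integral>\<^sup>+z. F (chi p z) * indicator (ball 0 1) z \<partial>lborel) =
    (\<integral>\<^sup>+z. F z * ennreal (eta q z) * indicator (ball 0 1) z \<partial>lborel)"
proof -
  define u where "u t = (\<integral>\<^sup>+y. F (sgn y * complex_of_real t) * indicator (ball 0 1) y \<partial>lborel)" for t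
  have [measurable]: "u \<in> borel_measurable borel"
    unfolding u_def by measurable
  have q1: "q - 1 = 1 / (p - 1)"
    using p q by (simp add: field_simps)
  then have "0 < q - 1"
    using p by simp
  note q1 = q1 this
  have "ennreal pi * (\<integral>\<^sup>+z. F (chi p z) * indicator (ball 0 1) z \<partial>lborel) =
      (\<integral>\<^sup>+z. u (cmod z powr (p - 1)) * indicator (ball 0 1) z \<partial>lborel)"
    using nn_integral_rotation_average[OF F, of "indicator (ball 0 1)" "chi p"]
    by (simp add: u_def norm_chi chi_rotate indicator_def norm_mult)
  also have "\<dots> = (\<integral>\<^sup>+t. u t * ennreal (2 * pi / (p - 1) * t powr (2 / (p - 1) - 1)) * indicator {0<..<1} t \<partial>lborel)"
    using p by (intro nn_integral_disc_powr) auto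
  also have "\<dots> = (\<integral>\<^sup>+t. (u t * ennreal ((q - 1) * t powr (2 * q - 4))) * ennreal (2 * pi * t) * indicator {0<..<1} t \<partial>lborel)"
  proof (rule nn_integral_cong)
    fix t :: real
    have "2 * pi / (p - 1) * t powr (2 / (p - 1) - 1) = (q - 1) * t powr (2 * q - 4) * (2 * pi * t)" if "0 < t"
    proof -
      have "t powr (2 / (p - 1) - 1) = t powr ((2 * q - 4) + 1)"
        using q1 by (intro arg_cong2[of _ _ _ _ "(powr)"]) (auto simp: field_simps)
      also have "\<dots> = t powr (2 * q - 4) * t"
        using that by (simp only: powr_add) simp
      finally show ?thesis
        using q1 by (simp add: mult_ac)
    qed
    then show "u t * ennreal (2 * pi / (p - 1) * t powr (2 / (p - 1) - 1)) * indicator {0<..<1} t =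
        (u t * ennreal ((q - 1) * t powr (2 * q - 4))) * ennreal (2 * pi * t) * indicator {0<..<1} t"
      using q1(2) by (simp add: indicator_def mult.assoc ennreal_mult[symmetric])
  qed
  also have "\<dots> = (\<integral>\<^sup>+z. (u (cmod z) * ennreal ((q - 1) * cmod z powr (2 * q - 4))) * indicator (ball 0 1) z \<partial>lborel)"
    by (rule nn_integral_disc_radial[symmetric]) simp
  also have "\<dots> = ennreal pi * (\<integral>\<^sup>+z. F z * (ennreal (eta q z) * indicator (ball 0 1) z) \<partial>lborel)"
    using nn_integral_rotation_average[OF F, of "\<lambda>z. ennreal (eta q z) * indicator (ball 0 1) z" "\<lambda>z. z"]
    by (simp add: u_def eta_def indicator_def norm_mult mult.assoc)
  finally show ?thesis
    by (simp add: ennreal_mult_cancel_left mult.assoc)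
qed

lemma nn_integral_Holder:
  fixes f g :: "'a \<Rightarrow> real"
  assumes [measurable]: "f \<in> borel_measurable M" "g \<in> borel_measurable M"
    and nn: "\<And>x. 0 \<le> f x" "\<And>x. 0 \<le> g x"
    and pq: "0 < p" "0 < q" "1 / p + 1 / q = 1"
    and f: "(\<integral>\<^sup>+x. ennreal (f x powr p) \<partial>M) \<le> ennreal A" and A: "0 \<le> A"
    and g: "(\<integral>\<^sup>+x. ennreal (g x powr q) \<partial>M) \<le> ennreal B" and B: "0 \<le> B"
  shows "(\<integral>\<^sup>+x. ennreal (f x * g x) \<partial>M) \<le> ennreal (A powr (1 / p) * B powr (1 / q))"
proof -
  \<comment> \<open>The proof below divides by \<open>a\<close> and \<open>b\<close> to normalise;
    if one of the bounds is 0, the corresponding function vanishes almost everywhere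
    instead.\<close>
  have zero: "(\<integral>\<^sup>+x. ennreal (f x * g x) \<partial>M) = 0"
    if [measurable]: "h \<in> borel_measurable M" and h: "\<And>x. 0 \<le> h x" "\<And>x. h x = 0 \<Longrightarrow> f x * g x = 0"
      "(\<integral>\<^sup>+x. ennreal (h x powr r) \<partial>M) = 0" for h r
  proof -
    have "AE x in M. ennreal (h x powr r) = 0"
      using h(3) by (subst nn_integral_0_iff_AE[symmetric]) auto
    then have "AE x in M. ennreal (f x * g x) = 0"
      by eventually_elim (use h(2) in \<open>force simp: ennreal_eq_0_iff\<close>)
    then show ?thesis
      by (subst nn_integral_0_iff_AE) auto
  qed
  show ?thesis
  proof (cases "A = 0 \<or> B = 0")
    case True
    then have "(\<integral>\<^sup>+x. ennreal (f x * g x) \<partial>M) = 0"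
      using zero[of f p] zero[of g q] f g nn by auto
    then show ?thesis by simp
  next
    case False
    define a b where "a = A powr (1 / p)" and "b = B powr (1 / q)"
    have ab: "0 < a" "0 < b" "a powr p = A" "b powr q = B"
      using False A B pq by (auto simp: a_def b_def powr_powr)
    have "f x * g x \<le> a * b / (p * A) * f x powr p + a * b / (q * B) * g x powr q" for x
    proof -
      have "f x / a * (g x / b) \<le> (f x / a) powr p / p + (g x / b) powr q / q"
      proof (rule Youngs_inequality)
        have "0 < 1 / p" "0 < 1 / q" using pq by auto
        then have "1 / p < 1" "1 / q < 1" using pq by linarith+
        then show "p > 1" "q > 1" using pq by auto
      qed (use pq nn ab in auto)
      also have "\<dots> = f x powr p / (p * A) + g x powr q / (q * B)"
        using ab nn by (simp add: powr_divide mult.commute)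
      finally have "a * b * (f x / a * (g x / b)) \<le> a * b * (f x powr p / (p * A) + g x powr q / (q * B))"
        using ab by (intro mult_left_mono) auto
      then show ?thesis
        using ab by (simp add: distrib_left)
    qed
    then have "(\<integral>\<^sup>+x. ennreal (f x * g x) \<partial>M) \<le>
        (\<integral>\<^sup>+x. ennreal (a * b / (p * A)) * ennreal (f x powr p) + ennreal (a * b / (q * B)) * ennreal (g x powr q) \<partial>M)"
      using ab pq A B
      by (intro nn_integral_mono) (simp add: ennreal_mult[symmetric] ennreal_plus[symmetric] del: ennreal_plus)
    also have "\<dots> = ennreal (a * b / (p * A)) * (\<integral>\<^sup>+x. ennreal (f x powr p) \<partial>M)
        + ennreal (a * b / (q * B)) * (\<integral>\<^sup>+x. ennreal (g x powr q) \<partial>M)"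
      by (simp add: nn_integral_add nn_integral_cmult)
    also have "\<dots> \<le> ennreal (a * b / (p * A)) * ennreal A + ennreal (a * b / (q * B)) * ennreal B"
      by (intro add_mono mult_left_mono f g) auto
    also have "\<dots> = ennreal (a * b / p + a * b / q)"
      using ab pq A B False by (simp add: ennreal_mult[symmetric] ennreal_plus[symmetric] del: ennreal_plus)
    also have "a * b / p + a * b / q = a * b * (1 / p + 1 / q)"
      by (simp add: distrib_left)
    finally show ?thesis
      using pq by (simp add: a_def b_def)
  qed
qed

text \<open>Absolute convergence: the integrals of the norms are dominated by the integral of
  \<open>|h|\<close> times \<open>|c n| \<rho>^n\<close>. The bound on \<open>x\<close> is asked
  only where \<open>h\<close> is nonzero, so \<open>h\<close> can act as a cut-off keeping
  \<open>x\<close> away from the circle of convergence.\<close>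

lemma sums_integral_power_series:
  fixes h x :: "'a \<Rightarrow> complex" and c :: "nat \<Rightarrow> complex"
  assumes h: "integrable M h" and [measurable]: "x \<in> borel_measurable M"
    and x: "\<And>w. w \<in> space M \<Longrightarrow> h w \<noteq> 0 \<Longrightarrow> cmod (x w) \<le> \<rho>" and "0 \<le> \<rho>"
    and c: "summable (\<lambda>n. cmod (c n) * \<rho> ^ n)"
  shows "(\<lambda>n. c n * (\<integral>w. h w * x w ^ n \<partial>M)) sums (\<integral>w. h w * (\<Sum>n. c n * x w ^ n) \<partial>M)"
    and "integrable M (\<lambda>w. h w * (\<Sum>n. c n * x w ^ n))"
proof -
  have [measurable]: "h \<in> borel_measurable M" using h by simp
  have bound: "cmod (h w * (c n * x w ^ n)) \<le> cmod (h w) * (cmod (c n) * \<rho> ^ n)" if "w \<in> space M" for w n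
    using x[OF that] by (cases "h w = 0") (auto simp: norm_mult norm_power intro!: mult_left_mono power_mono)
  have int: "integrable M (\<lambda>w. h w * (c n * x w ^ n))" for n
    by (rule Bochner_Integration.integrable_bound[of _ "\<lambda>w. cmod (h w) * (cmod (c n) * \<rho> ^ n)"])
      (use h bound \<open>0 \<le> \<rho>\<close> in \<open>auto intro!: AE_I2\<close>)
  have sm: "summable (\<lambda>n. cmod (h w * (c n * x w ^ n)))" if "w \<in> space M" for w
    by (rule summable_comparison_test[OF _ summable_mult[OF c, of "cmod (h w)"]]) (use bound[OF that] in auto)
  have sm2: "summable (\<lambda>n. \<integral>w. cmod (h w * (c n * x w ^ n)) \<partial>M)"
  proof (rule summable_comparison_test[OF _ summable_mult[OF c, of "\<integral>w. cmod (h w) \<partial>M"]])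
    have "(\<integral>w. cmod (h w * (c n * x w ^ n)) \<partial>M) \<le> (\<integral>w. cmod (h w) * (cmod (c n) * \<rho> ^ n) \<partial>M)" for n
      using h int bound by (intro integral_mono) auto
    then show "\<exists>N. \<forall>n\<ge>N. norm (\<integral>w. cmod (h w * (c n * x w ^ n)) \<partial>M) \<le> (\<integral>w. cmod (h w) \<partial>M) * (cmod (c n) * \<rho> ^ n)"
      by (auto simp: abs_of_nonneg integral_nonneg_AE)
  qed
  have eq: "(\<Sum>n. h w * (c n * x w ^ n)) = h w * (\<Sum>n. c n * x w ^ n)" if "w \<in> space M" for w
  proof (cases "h w = 0")
    case False
    have "summable (\<lambda>n. h w * (c n * x w ^ n))"
      by (rule summable_norm_cancel[OF sm[OF that]])
    then have "summable (\<lambda>n. c n * x w ^ n)"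
      using summable_cmult_iff[of "h w" "\<lambda>n. c n * x w ^ n"] False by blast
    then show ?thesis
      by (rule suminf_mult)
  qed simp
  have eqs: "integrable M (\<lambda>w. \<Sum>n. h w * (c n * x w ^ n)) = integrable M (\<lambda>w. h w * (\<Sum>n. c n * x w ^ n))"
    "(\<integral>w. (\<Sum>n. h w * (c n * x w ^ n)) \<partial>M) = (\<integral>w. h w * (\<Sum>n. c n * x w ^ n) \<partial>M)"
    by (rule Bochner_Integration.integrable_cong Bochner_Integration.integral_cong; simp add: eq)+
  have "(\<lambda>n. \<integral>w. h w * (c n * x w ^ n) \<partial>M) sums (\<integral>w. (\<Sum>n. h w * (c n * x w ^ n)) \<partial>M)"
    using int sm sm2 by (intro sums_integral) auto
  moreover have "(\<integral>w. h w * (c n * x w ^ n) \<partial>M) = c n * (\<integral>w. h w * x w ^ n \<partial>M)" for n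
    by (simp add: mult.left_commute)
  ultimately show "(\<lambda>n. c n * (\<integral>w. h w * x w ^ n \<partial>M)) sums (\<integral>w. h w * (\<Sum>n. c n * x w ^ n) \<partial>M)"
    by (simp add: eqs)
  have "integrable M (\<lambda>w. \<Sum>n. h w * (c n * x w ^ n))"
    using int sm sm2 by (intro integrable_suminf) auto
  then show "integrable M (\<lambda>w. h w * (\<Sum>n. c n * x w ^ n))"
    by (simp add: eqs)
qed

section \<open>Forelli-Rudin estimates and the Schur test\<close>

lemma borel_measurable_cnj [measurable (raw)]:
  "f \<in> borel_measurable M \<Longrightarrow> (\<lambda>x. cnj (f x)) \<in> borel_measurable M"
  by (rule borel_measurable_continuous_on[of cnj]) (auto intro: continuous_intros)

lemma lborel_integral_equivariant_power:
  fixes v :: "complex \<Rightarrow> real" and x :: "complex \<Rightarrow> complex"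
  assumes [measurable]: "v \<in> borel_measurable borel" "x \<in> borel_measurable borel"
    and v: "\<And>w z. cmod w = 1 \<Longrightarrow> v (w * z) = v z"
    and x: "\<And>w z. cmod w = 1 \<Longrightarrow> x (w * z) = w * x z"
    and n: "0 < n"
  shows "(\<integral>z. complex_of_real (v z) * x z ^ n \<partial>lborel) = 0"
proof (rule lborel_integral_equivariant_eq_0[where w = "cis (pi / n)" and c = "-1"])
  have "cis (pi / n) ^ n = -1"
    using n Complex.DeMoivre[of "pi / n" n] by simp
  then show "complex_of_real (v (cis (pi / n) * z)) * x (cis (pi / n) * z) ^ n = - 1 * (complex_of_real (v z) * x z ^ n)" for z
    by (simp add: v x power_mult_distrib)
qed auto

text \<open>Expresses \<open>1/|1 - z|^2\<close>, up to the radial factor \<open>1 - |z|^2\<close>,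
  through the real part of a geometric series that can be integrated term by term.\<close>

lemma Poisson_kernel_eq: "z \<noteq> 1 \<Longrightarrow> (1 - (cmod z)\<^sup>2) / (cmod (1 - z))\<^sup>2 = 2 * Re (1 / (1 - z)) - 1"
proof -
  assume "z \<noteq> 1"
  then have nz: "(cmod (1 - z))\<^sup>2 \<noteq> 0" by simp
  have 1: "Re (1 / (1 - z)) = (1 - Re z) / (cmod (1 - z))\<^sup>2"
    by (simp add: Re_divide cmod_power2)
  have 2: "1 - (cmod z)\<^sup>2 = 2 * (1 - Re z) - (cmod (1 - z))\<^sup>2"
    unfolding cmod_power2 by (simp add: power2_eq_square algebra_simps)
  have "(1 - (cmod z)\<^sup>2) / (cmod (1 - z))\<^sup>2 = 2 * ((1 - Re z) / (cmod (1 - z))\<^sup>2) - (cmod (1 - z))\<^sup>2 / (cmod (1 - z))\<^sup>2"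
    by (simp only: 2 diff_divide_distrib[of "2 * (1 - Re z)"] times_divide_eq_right)
  then show ?thesis
    by (simp only: 1 divide_self[OF nz])
qed

text \<open>The positive powers of \<open>x\<close> in the expansion of the Poisson kernel integrate to zero by rotation invariance.\<close>

lemma nn_integral_inverse_square_radial:
  fixes K :: "complex \<Rightarrow> real" and x :: "complex \<Rightarrow> complex"
  assumes K: "integrable lborel K" and [measurable]: "x \<in> borel_measurable borel"
    and K0: "\<And>z. 0 \<le> K z"
    and rad: "\<And>w z. cmod w = 1 \<Longrightarrow> K (w * z) = K z"
    and x: "\<And>w z. cmod w = 1 \<Longrightarrow> x (w * z) = w * x z"
    and \<rho>: "\<And>z. K z \<noteq> 0 \<Longrightarrow> cmod (x z) \<le> \<rho>" "\<rho> < 1" "0 \<le> \<rho>"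
  shows "(\<integral>\<^sup>+z. ennreal (K z / (cmod (1 - x z))\<^sup>2) \<partial>lborel) = (\<integral>\<^sup>+z. ennreal (K z / (1 - (cmod (x z))\<^sup>2)) \<partial>lborel)"
proof -
  \<comment> \<open>The factor \<open>1 - (cmod (x z))^2\<close> is rotation invariant and can be
    moved into the weight; \<open>v\<close> times the Poisson kernel at \<open>x z\<close> is then
    the integrand on the left.\<close>
  define v where "v z = K z / (1 - (cmod (x z))\<^sup>2)" for z
  have [measurable]: "K \<in> borel_measurable borel" using K by simp
  have [measurable]: "v \<in> borel_measurable borel" unfolding v_def by measurable
  have x1: "(cmod (x z))\<^sup>2 \<le> \<rho>\<^sup>2" "cmod (x z) < 1" if "K z \<noteq> 0" for z
    using \<rho>(1)[OF that] \<rho>(2) by (auto intro: power_mono)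
  have r2: "\<rho>\<^sup>2 < 1" using \<rho> by (simp add: power_less_one_iff abs_square_less_1)
  have v0: "0 \<le> v z" and vK: "v z \<le> K z / (1 - \<rho>\<^sup>2)" for z
    using K0[of z] x1[of z] r2 by (cases "K z = 0"; auto simp: v_def intro!: divide_left_mono mult_pos_pos)+
  have v_int: "integrable lborel v"
    by (rule Bochner_Integration.integrable_bound[of _ "\<lambda>z. K z / (1 - \<rho>\<^sup>2)"])
      (use K v0 vK r2 K0 in \<open>auto intro!: AE_I2\<close>)
  have vrad: "v (w * z) = v z" if "cmod w = 1" for w z
    using that by (simp add: v_def rad x norm_mult)
  have vx: "cmod (x z) \<le> \<rho>" if "complex_of_real (v z) \<noteq> 0" for z
    using that \<rho>(1) by (auto simp: v_def)
  have sm: "summable (\<lambda>n. cmod 1 * \<rho> ^ n)"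
    using \<rho> by simp
  note swap = sums_integral_power_series[of lborel "\<lambda>z. complex_of_real (v z)" x \<rho> "\<lambda>_. 1"]
  have i1: "integrable lborel (\<lambda>z. complex_of_real (v z) * (\<Sum>n. 1 * x z ^ n))"
    using v_int vx \<rho> sm by (intro swap) auto
  have s1: "(\<lambda>n. 1 * (\<integral>z. complex_of_real (v z) * x z ^ n \<partial>lborel)) sums (\<integral>z. complex_of_real (v z) * (\<Sum>n. 1 * x z ^ n) \<partial>lborel)"
    using v_int vx \<rho> sm by (intro swap) auto
  have z: "(\<integral>z. complex_of_real (v z) * x z ^ n \<partial>lborel) = (if n = 0 then complex_of_real (\<integral>z. v z \<partial>lborel) else 0)" for n
    using v_int lborel_integral_equivariant_power[of v x n] by (simp add: vrad x)
  have "(\<integral>z. complex_of_real (v z) * (\<Sum>n. 1 * x z ^ n) \<partial>lborel) = complex_of_real (\<integral>z. v z \<partial>lborel)"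
    using s1 sums_single[of 0 "\<lambda>_. complex_of_real (\<integral>z. v z \<partial>lborel)"] unfolding z
    by (simp add: sums_unique2)
  then have I1: "(\<integral>z. Re (complex_of_real (v z) * (\<Sum>n. 1 * x z ^ n)) \<partial>lborel) = (\<integral>z. v z \<partial>lborel)"
    by (simp only: integral_Re[OF i1] Re_complex_of_real)
  note i1' = integrable_mult_right[OF integrable_Re[OF i1], of 2]
  have I2: "(\<integral>z. 2 * Re (complex_of_real (v z) * (\<Sum>n. 1 * x z ^ n)) - v z \<partial>lborel) = (\<integral>z. v z \<partial>lborel)"
    by (simp only: Bochner_Integration.integral_diff[OF i1' v_int] Bochner_Integration.integral_mult_right_zero I1)
  note i2 = Bochner_Integration.integrable_diff[OF i1' v_int]
  have eq: "2 * Re (complex_of_real (v z) * (\<Sum>n. 1 * x z ^ n)) - v z = K z / (cmod (1 - x z))\<^sup>2" for z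
  proof (cases "K z = 0")
    case False
    with x1 have c: "cmod (x z) < 1" by blast
    then have n1: "x z \<noteq> 1" by auto
    have s: "(\<Sum>n. 1 * x z ^ n) = 1 / (1 - x z)"
      using c by (simp add: suminf_geometric)
    have "Re (complex_of_real r * y) = r * Re y" for r y
      by simp
    then have "2 * Re (complex_of_real (v z) * (\<Sum>n. 1 * x z ^ n)) - v z = v z * (2 * Re (1 / (1 - x z)) - 1)"
      unfolding s by (simp only: right_diff_distrib mult_1_right mult.left_commute)
    also have "\<dots> = v z * ((1 - (cmod (x z))\<^sup>2) / (cmod (1 - x z))\<^sup>2)"
      by (simp only: Poisson_kernel_eq[OF n1])
    also have "\<dots> = K z / (cmod (1 - x z))\<^sup>2"
      using x1[OF False] r2 by (simp add: v_def)
    finally show ?thesis .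
  qed (simp add: v_def)
  have "(\<integral>\<^sup>+z. ennreal (K z / (cmod (1 - x z))\<^sup>2) \<partial>lborel) = ennreal (\<integral>z. K z / (cmod (1 - x z))\<^sup>2 \<partial>lborel)"
    using i2[unfolded eq] K0 by (intro nn_integral_eq_integral) auto
  also have "\<dots> = ennreal (\<integral>z. v z \<partial>lborel)"
    by (simp only: I2[unfolded eq])
  also have "\<dots> = (\<integral>\<^sup>+z. ennreal (v z) \<partial>lborel)"
    using v_int v0 by (intro nn_integral_eq_integral[symmetric]) auto
  finally show ?thesis
    by (simp add: v_def)
qed

lemma has_real_derivative_one_minus_powr:
  "t < 1 \<Longrightarrow> ((\<lambda>t. (1 - t) powr b) has_real_derivative - b * (1 - t) powr (b - 1)) (at t within S)"
  by (rule has_field_derivative_at_within)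
    (use DERIV_fun_powr[of "\<lambda>t. 1 - t" "-1" t b] in \<open>auto intro!: derivative_eq_intros\<close>)

text \<open>In the radial variable the maximum is \<open>d\<close> on \<open>[1 - d, 1]\<close> and
  \<open>1 - t\<close> on \<open>[0, 1 - d]\<close>. The two pieces give the terms
  \<open>1/(1 - a)\<close> and \<open>1/a\<close> of the constant; \<open>a < 1\<close> is needed at
  the circle, \<open>a > 0\<close> away from it.\<close>

lemma nn_integral_disc_max_bound:
  assumes a: "0 < a" "a < 1" and d: "0 < d" "d \<le> 1"
  shows "(\<integral>\<^sup>+z. ennreal ((1 - cmod z) powr (-a) / max d (1 - cmod z)) * indicator (ball 0 1) z \<partial>lborel)
    \<le> ennreal (2 * pi * (1 / (1 - a) + 1 / a) * d powr (-a))"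
proof -
  let ?f = "\<lambda>t::real. (1 - t) powr (-a) / max d (1 - t)"
  let ?f1 = "\<lambda>t::real. 2 * pi * ((1 - t) powr (-a) / d)"
  let ?f2 = "\<lambda>t::real. 2 * pi * (1 - t) powr (-a - 1)"
  have "(\<integral>\<^sup>+z. ennreal (?f (cmod z)) * indicator (ball 0 1) z \<partial>lborel) =
      (\<integral>\<^sup>+t. ennreal (?f t) * ennreal (2 * pi * t) * indicator {0<..<1} t \<partial>lborel)"
    by (rule nn_integral_disc_radial) simp
  also have "\<dots> \<le> (\<integral>\<^sup>+t. ennreal (?f1 t) * indicator {1 - d..1} t + ennreal (?f2 t) * indicator {0..1 - d} t \<partial>lborel)"
  proof (rule nn_integral_mono)
    fix t :: real
    show "ennreal (?f t) * ennreal (2 * pi * t) * indicator {0<..<1} t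
        \<le> ennreal (?f1 t) * indicator {1 - d..1} t + ennreal (?f2 t) * indicator {0..1 - d} t"
    proof (cases "0 < t \<and> t < 1")
      case True
      have "?f t * (2 * pi * t) \<le> ?f t * (2 * pi * 1)"
        using True d by (intro mult_left_mono) (auto intro!: divide_nonneg_pos)
      then have le: "ennreal (?f t) * ennreal (2 * pi * t) \<le> ennreal (2 * pi * ?f t)"
        using True d by (subst ennreal_mult[symmetric]) (auto simp: mult_ac intro!: divide_nonneg_pos ennreal_leI)
      show ?thesis
      proof (cases "1 - d \<le> t")
        case True': True
        then have "max d (1 - t) = d"
          by simp
        then have "ennreal (2 * pi * ?f t) = ennreal (?f1 t)"
          by simp
        then show ?thesis
          using le True True' by (auto simp: indicator_def intro: order_trans add_increasing2)
      next
        case False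
        then have "?f t = (1 - t) powr (-a) / (1 - t) powr 1"
          using True by (simp add: max_def)
        also have "\<dots> = (1 - t) powr (-a - 1)"
          by (simp only: powr_diff)
        finally show ?thesis
          using le True False by (auto simp: indicator_def)
      qed
    qed (auto simp: indicator_def)
  qed
  also have "\<dots> = (\<integral>\<^sup>+t. ennreal (?f1 t) * indicator {1 - d..1} t \<partial>lborel) + (\<integral>\<^sup>+t. ennreal (?f2 t) * indicator {0..1 - d} t \<partial>lborel)"
    by (rule nn_integral_add) auto
  also have "(\<integral>\<^sup>+t. ennreal (?f1 t) * indicator {1 - d..1} t \<partial>lborel) = ennreal (2 * pi * (1 / (1 - a)) * d powr (-a))"
  proof (rule nn_integral_has_integral_lebesgue')
    let ?F = "\<lambda>t::real. - (2 * pi / (d * (1 - a))) * (1 - t) powr (1 - a)"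
    have "(?f1 has_integral ?F 1 - ?F (1 - d)) {1 - d..1}"
    proof (rule fundamental_theorem_of_calculus_interior)
      show "continuous_on {1 - d..1} ?F"
        using a by (intro continuous_intros continuous_on_powr') auto
      fix t assume "t \<in> {1 - d<..<1}"
      then show "(?F has_vector_derivative ?f1 t) (at t)"
        unfolding has_real_derivative_iff_has_vector_derivative[symmetric] using a d
        by (auto intro!: derivative_eq_intros has_real_derivative_one_minus_powr)
    qed (use d in auto)
    also have "?F 1 - ?F (1 - d) = 2 * pi * (1 / (1 - a)) * d powr (-a)"
      using d a by (simp add: powr_diff powr_minus field_simps)
    finally show "(?f1 has_integral 2 * pi * (1 / (1 - a)) * d powr (-a)) {1 - d..1}" .
  qed (use d in auto)
  also have "(\<integral>\<^sup>+t. ennreal (?f2 t) * indicator {0..1 - d} t \<partial>lborel) = ennreal (2 * pi * (1 / a) * (d powr (-a) - 1))"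
  proof (rule nn_integral_has_integral_lebesgue')
    let ?F = "\<lambda>t::real. 2 * pi / a * (1 - t) powr (-a)"
    have "(?f2 has_integral ?F (1 - d) - ?F 0) {0..1 - d}"
    proof (rule fundamental_theorem_of_calculus)
      fix t assume "t \<in> {0..1 - d}"
      then show "(?F has_vector_derivative ?f2 t) (at t within {0..1 - d})"
        unfolding has_real_derivative_iff_has_vector_derivative[symmetric] using a d
        by (auto intro!: derivative_eq_intros has_real_derivative_one_minus_powr)
    qed (use d in auto)
    also have "?F (1 - d) - ?F 0 = 2 * pi * (1 / a) * (d powr (-a) - 1)"
      by (simp add: right_diff_distrib diff_divide_distrib)
    finally show "(?f2 has_integral 2 * pi * (1 / a) * (d powr (-a) - 1)) {0..1 - d}" .
  qed auto
  also have "ennreal (2 * pi * (1 / (1 - a)) * d powr (-a)) + ennreal (2 * pi * (1 / a) * (d powr (-a) - 1))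
      \<le> ennreal (2 * pi * (1 / (1 - a)) * d powr (-a)) + ennreal (2 * pi * (1 / a) * d powr (-a))"
    using a by (intro add_left_mono ennreal_leI mult_left_mono) auto
  also have "\<dots> = ennreal (2 * pi * (1 / (1 - a) + 1 / a) * d powr (-a))"
    using a by (subst ennreal_plus[symmetric]) (auto simp: algebra_simps)
  finally show ?thesis .
qed

lemma integrable_disc_one_minus_norm_powr:
  assumes a: "0 < a" "a < 1"
  shows "integrable lborel (\<lambda>z::complex. (1 - cmod z) powr (-a) * indicator (ball 0 1) z)"
proof (rule integrableI_nonneg)
  have "(\<integral>\<^sup>+z. ennreal ((1 - cmod z) powr (-a) * indicator (ball 0 1) z) \<partial>lborel) =
      (\<integral>\<^sup>+z. ennreal ((1 - cmod z) powr (-a) / max 1 (1 - cmod z)) * indicator (ball 0 1) z \<partial>lborel)"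
    by (rule nn_integral_cong) (auto simp: indicator_def max_def)
  also have "\<dots> < \<infinity>"
    using nn_integral_disc_max_bound[OF a, of 1] by (auto simp: order_le_less_trans)
  finally show "(\<integral>\<^sup>+z. ennreal ((1 - cmod z) powr (-a) * indicator (ball (0::complex) 1) z) \<partial>lborel) < \<infinity>" .
qed auto

text \<open>With \<open>m = p - 1\<close> this bounds \<open>1 - |z| |chi p w|\<close> from below,
  symmetrically in \<open>z\<close> and \<open>w\<close>. The factor \<open>min 1 m\<close> is lost
  for \<open>m < 1\<close>, where the weighted inequality of arithmetic and geometric means gives
  \<open>s^m \<le> m s + (1 - m)\<close>.\<close>

lemma one_minus_mult_powr_ge:
  fixes r s m :: real
  assumes r: "0 \<le> r" "r \<le> 1" and s: "0 \<le> s" "s \<le> 1" and m: "0 < m"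
  shows "min 1 m * max (1 - r) (1 - s) \<le> 1 - r * s powr m"
proof -
  have sm: "0 \<le> s powr m" "s powr m \<le> 1"
    using s m by (auto simp: powr_le1)
  have "min 1 m * (1 - s) \<le> 1 - s powr m"
  proof (cases "1 \<le> m")
    case True
    then have "s powr m \<le> s powr 1"
      using s by (intro powr_mono')
    then show ?thesis
      using True s by simp
  next
    case False
    have "s powr m \<le> m * s + (1 - m)"
      using Youngs_inequality_0[of m "1 - m" s 1] False m s by (cases "s = 0") auto
    then show ?thesis
      using False by (simp add: algebra_simps)
  qed
  moreover have "1 - s powr m \<le> 1 - r * s powr m"
    using r sm by (simp add: mult_left_le_one_le)
  moreover have "min 1 m * (1 - r) \<le> 1 * (1 - r)"
    using r by (intro mult_right_mono) auto
  moreover have "1 - r \<le> 1 - r * s powr m"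
    using r sm by (simp add: mult_left_le)
  ultimately show ?thesis
    unfolding max_def by (auto split: if_splits)
qed

text \<open>The constant of \<open>nn_integral_disc_max_bound\<close> divided by the loss
  \<open>min 1 (p - 1)\<close> of \<open>one_minus_mult_powr_ge\<close>.\<close>

definition FR :: "real \<Rightarrow> real \<Rightarrow> real" where
  "FR p a = 2 * pi * (1 / (1 - a) + 1 / a) / min 1 (p - 1)"

lemma FR_nonneg: "1 < p \<Longrightarrow> 0 < a \<Longrightarrow> a < 1 \<Longrightarrow> 0 \<le> FR p a"
  by (simp add: FR_def)

text \<open>Covers both variables of the kernel through one equivariant \<open>x\<close>. The square
  \<open>|1 - x|^2\<close> is replaced exactly by \<open>1 - |x|^2\<close>, which is at least
  \<open>1 - |x|\<close> and hence at least a multiple of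
  \<open>max (1 - r) (1 - |z|)\<close>.\<close>

lemma Forelli_Rudin_aux:
  assumes p: "1 < p" and a: "0 < a" "a < 1" and r: "0 \<le> r" "r < 1"
    and [measurable]: "x \<in> borel_measurable borel"
    and eqv: "\<And>w z. cmod w = 1 \<Longrightarrow> x (w * z) = w * x z"
    and \<rho>: "\<And>z. cmod z < 1 \<Longrightarrow> cmod (x z) \<le> \<rho>" "\<rho> < 1"
    and x: "\<And>z. cmod z < 1 \<Longrightarrow> min 1 (p - 1) * max (1 - r) (1 - cmod z) \<le> 1 - cmod (x z)"
  shows "(\<integral>\<^sup>+z. ennreal ((1 - cmod z) powr (-a) / (cmod (1 - x z))\<^sup>2) * indicator (ball 0 1) z \<partial>lborel)
    \<le> ennreal (FR p a * (1 - r) powr (-a))"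
proof -
  define K where "K z = (1 - cmod z) powr (-a) * indicator (ball 0 1) z" for z :: complex
  define \<kappa> where "\<kappa> = min 1 (p - 1)"
  have \<kappa>: "0 < \<kappa>" using p by (simp add: \<kappa>_def)
  have \<rho>0: "0 \<le> \<rho>" using \<rho>(1)[of 0] norm_ge_zero[of "x 0"] by (simp del: norm_ge_zero)
  have "(\<integral>\<^sup>+z. ennreal ((1 - cmod z) powr (-a) / (cmod (1 - x z))\<^sup>2) * indicator (ball 0 1) z \<partial>lborel)
      = (\<integral>\<^sup>+z. ennreal (K z / (cmod (1 - x z))\<^sup>2) \<partial>lborel)"
    by (rule nn_integral_cong) (auto simp: K_def indicator_def)
  also have "\<dots> = (\<integral>\<^sup>+z. ennreal (K z / (1 - (cmod (x z))\<^sup>2)) \<partial>lborel)"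
    using integrable_disc_one_minus_norm_powr[OF a] eqv \<rho> \<rho>0
    by (intro nn_integral_inverse_square_radial[of _ _ \<rho>])
      (auto simp: K_def norm_mult indicator_def split: if_splits)
  also have "\<dots> \<le> (\<integral>\<^sup>+z. ennreal (1 / \<kappa>) * (ennreal ((1 - cmod z) powr (-a) / max (1 - r) (1 - cmod z)) * indicator (ball 0 1) z) \<partial>lborel)"
  proof (rule nn_integral_mono)
    fix z :: complex
    show "ennreal (K z / (1 - (cmod (x z))\<^sup>2)) \<le> ennreal (1 / \<kappa>) * (ennreal ((1 - cmod z) powr (-a) / max (1 - r) (1 - cmod z)) * indicator (ball 0 1) z)"
    proof (cases "cmod z < 1")
      case True
      have x1: "cmod (x z) < 1" using \<rho> True by force
      have m: "0 < max (1 - r) (1 - cmod z)" using r by simp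
      have "(cmod (x z))\<^sup>2 \<le> cmod (x z)"
        using x1 by (simp add: power2_eq_square mult_left_le)
      then have "\<kappa> * max (1 - r) (1 - cmod z) \<le> 1 - (cmod (x z))\<^sup>2"
        using x[OF True] by (simp add: \<kappa>_def)
      then have "(1 - cmod z) powr (-a) / (1 - (cmod (x z))\<^sup>2) \<le> (1 - cmod z) powr (-a) / (\<kappa> * max (1 - r) (1 - cmod z))"
        using mult_pos_pos[OF \<kappa> m] by (intro divide_left_mono mult_pos_pos[of "1 - (cmod (x z))\<^sup>2"]) auto
      then show ?thesis
        using True \<kappa> m by (simp add: K_def ennreal_mult[symmetric] ennreal_leI)
    qed (simp add: K_def)
  qed
  also have "\<dots> = ennreal (1 / \<kappa>) * (\<integral>\<^sup>+z. ennreal ((1 - cmod z) powr (-a) / max (1 - r) (1 - cmod z)) * indicator (ball 0 1) z \<partial>lborel)"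
    by (rule nn_integral_cmult) simp
  also have "\<dots> \<le> ennreal (1 / \<kappa>) * ennreal (2 * pi * (1 / (1 - a) + 1 / a) * (1 - r) powr (-a))"
    using r by (intro mult_left_mono nn_integral_disc_max_bound a) auto
  also have "\<dots> = ennreal (FR p a * (1 - r) powr (-a))"
    using \<kappa> a by (simp add: FR_def \<kappa>_def ennreal_mult[symmetric] mult_ac)
  finally show ?thesis .
qed

lemma Forelli_Rudin_snd:
  assumes p: "1 < p" and a: "0 < a" "a < 1" and z: "cmod z < 1"
  shows "(\<integral>\<^sup>+w. ennreal ((1 - cmod w) powr (-a) / (cmod (1 - z * cnj (chi p w)))\<^sup>2) * indicator (ball 0 1) w \<partial>lborel)
    \<le> ennreal (FR p a * (1 - cmod z) powr (-a))"
proof -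
  \<comment> \<open>As a function of \<open>w\<close>, \<open>z * cnj (chi p w)\<close> turns in the
    wrong direction under rotations; conjugation makes it equivariant without changing the
    modulus.\<close>
  have "cmod (1 - z * cnj (chi p w)) = cmod (1 - cnj z * chi p w)" for w
    by (metis complex_cnj_cnj complex_cnj_diff complex_cnj_mult complex_cnj_one complex_mod_cnj)
  moreover have "(\<integral>\<^sup>+w. ennreal ((1 - cmod w) powr (-a) / (cmod (1 - cnj z * chi p w))\<^sup>2) * indicator (ball 0 1) w \<partial>lborel)
    \<le> ennreal (FR p a * (1 - cmod z) powr (-a))"
  proof (rule Forelli_Rudin_aux[OF p a, where \<rho> = "cmod z"])
    show "cmod (cnj z * chi p w) \<le> cmod z" if "cmod w < 1" for w
      using p that by (simp add: norm_mult norm_chi powr_le1 mult_left_le)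
    show "min 1 (p - 1) * max (1 - cmod z) (1 - cmod w) \<le> 1 - cmod (cnj z * chi p w)" if "cmod w < 1" for w
      using that z p one_minus_mult_powr_ge[of "cmod z" "cmod w" "p - 1"] by (simp add: norm_mult norm_chi)
  qed (use z in \<open>auto simp: chi_rotate\<close>)
  ultimately show ?thesis by simp
qed

lemma Forelli_Rudin_fst:
  assumes p: "1 < p" and a: "0 < a" "a < 1" and w: "cmod w < 1"
  shows "(\<integral>\<^sup>+z. ennreal ((1 - cmod z) powr (-a) / (cmod (1 - z * cnj (chi p w)))\<^sup>2) * indicator (ball 0 1) z \<partial>lborel)
    \<le> ennreal (FR p a * (1 - cmod w) powr (-a))"
proof (rule Forelli_Rudin_aux[OF p a, where \<rho> = "cmod w powr (p - 1)"])
  show "cmod w powr (p - 1) < 1"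
    using p w powr_less_mono2[of "p - 1" "cmod w" 1] by simp
  show "cmod (z * cnj (chi p w)) \<le> cmod w powr (p - 1)" if "cmod z < 1" for z
    using that by (simp add: norm_mult norm_chi mult_left_le_one_le)
  show "min 1 (p - 1) * max (1 - cmod w) (1 - cmod z) \<le> 1 - cmod (z * cnj (chi p w))" if "cmod z < 1" for z
    using that w p one_minus_mult_powr_ge[of "cmod z" "cmod w" "p - 1"] by (simp add: norm_mult norm_chi max.commute)
qed (use w in auto)

text \<open>The Hoelder step of the Schur test contributes the first factor, the integration over
  \<open>z\<close> after Tonelli the second. It bounds \<open>p\<close>-th powers, so the operator
  norm is its \<open>p\<close>-th root.\<close>

definition Schur_const :: "real \<Rightarrow> real \<Rightarrow> real" where
  "Schur_const p q = FR p (1 / p) powr (p / q) * FR p (1 / q)"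

text \<open>Schur test with test function \<open>(1 - |w|)^(-1/(pq))\<close>. Hoelder's inequality
  in \<open>w\<close> costs \<open>(1 - |z|)^(-1/q)\<close> after raising to the power
  \<open>p\<close>; integrating this against the kernel in \<open>z\<close> returns
  \<open>(1 - |w|)^(-1/q)\<close>, which cancels the weight put on \<open>h^p\<close>.\<close>

lemma Schur_estimate:
  fixes h H :: "complex \<Rightarrow> real"
  assumes pq: "1 < p" "1 < q" "1 / p + 1 / q = 1"
    and [measurable]: "h \<in> borel_measurable borel" and h0: "\<And>w. 0 \<le> h w" and hB: "\<And>w. h w \<le> B"
    and R: "R < 1" "\<And>w. R < cmod w \<Longrightarrow> h w = 0"
    and H0: "\<And>z. 0 \<le> H z"
    and H: "\<And>z. cmod z < 1 \<Longrightarrow> ennreal (H z) \<le> (\<integral>\<^sup>+w. ennreal (h w / (cmod (1 - z * cnj (chi p w)))\<^sup>2) \<partial>lborel)"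
  shows "(\<integral>\<^sup>+z. ennreal (H z powr p) * indicator (ball 0 1) z \<partial>lborel)
    \<le> ennreal (Schur_const p q) * (\<integral>\<^sup>+w. ennreal (h w powr p) \<partial>lborel)"
proof -
  define T where "T z w = 1 / (cmod (1 - z * cnj (chi p w)))\<^sup>2" for z w
  define D where "D = ball (0::complex) 1"
  have T0: "0 \<le> T z w" for z w by (simp add: T_def)
  have [measurable]: "T z \<in> borel_measurable borel" "case_prod T \<in> borel_measurable (borel \<Otimes>\<^sub>M borel)" for z
    unfolding T_def by measurable
  have [measurable]: "D \<in> sets borel" by (simp add: D_def)
  have hD: "h w = 0" if "w \<notin> D" for w
    using that R by (auto simp: D_def)
  have pq': "0 < 1 / p" "1 / p < 1" "0 < 1 / q" "1 / q < 1"
    using pq by auto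
  let ?C1 = "FR p (1 / p)" and ?C2 = "FR p (1 / q)"
  have C0: "0 \<le> ?C1" "0 \<le> ?C2"
    using FR_nonneg pq pq' by auto
  define A where "A z = (\<integral>\<^sup>+w. ennreal (T z w * h w powr p * (1 - cmod w) powr (1 / q)) * indicator D w \<partial>lborel)" for z
  have pt: "ennreal (H z powr p) \<le> ennreal (?C1 powr (p / q)) * (ennreal ((1 - cmod z) powr (- (1 / q))) * A z)"
    if z: "cmod z < 1" for z
  proof -
    define B1 where "B1 = ?C1 * (1 - cmod z) powr (- (1 / p))"
    have B1: "0 \<le> B1" using C0 by (simp add: B1_def)
    \<comment> \<open>On the support of \<open>h\<close> the kernel is bounded. This crude bound
      serves only to make \<open>A z\<close> finite, so that the real-valued form of Hoelder's
      inequality applies.\<close>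
    define \<rho> where "\<rho> = (max 0 R) powr (p - 1)"
    have \<rho>: "0 \<le> \<rho>" "\<rho> < 1"
      using R pq powr_less_mono2[of "p - 1" "max 0 R" 1] by (auto simp: \<rho>_def)
    have Tb: "T z w \<le> 1 / (1 - \<rho>)\<^sup>2" if "h w \<noteq> 0" for w
    proof -
      have "cmod w \<le> max 0 R" using R(2)[of w] that by force
      then have "cmod w powr (p - 1) \<le> \<rho>"
        unfolding \<rho>_def using pq by (intro powr_mono2) auto
      then have "cmod (z * cnj (chi p w)) \<le> 1 * \<rho>"
        unfolding norm_mult using z by (intro mult_mono) (auto simp: norm_chi)
      then have "1 - \<rho> \<le> cmod (1 - z * cnj (chi p w))"
        using norm_triangle_ineq2[of 1 "z * cnj (chi p w)"] by simp
      then show ?thesis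
        unfolding T_def using \<rho> by (intro divide_left_mono power_mono mult_pos_pos zero_less_power) auto
    qed
    have "A z \<le> (\<integral>\<^sup>+w. ennreal (1 / (1 - \<rho>)\<^sup>2 * B powr p * 1) * indicator D w \<partial>lborel)"
      unfolding A_def
    proof (rule nn_integral_mono)
      fix w
      show "ennreal (T z w * h w powr p * (1 - cmod w) powr (1 / q)) * indicator D w
        \<le> ennreal (1 / (1 - \<rho>)\<^sup>2 * B powr p * 1) * indicator D w"
      proof (cases "h w = 0 \<or> w \<notin> D")
        case False
        then have "T z w * h w powr p * (1 - cmod w) powr (1 / q) \<le> 1 / (1 - \<rho>)\<^sup>2 * B powr p * 1"
          using Tb[of w] h0[of w] hB[of w] T0[of z w] pq \<rho> by (intro mult_mono powr_mono2) (auto simp: D_def powr_le1)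
        then show ?thesis by (intro mult_right_mono ennreal_leI) auto
      qed (use pq in auto)
    qed
    also have "\<dots> < \<infinity>"
      by (simp add: nn_integral_cmult D_def emeasure_disc ennreal_mult_less_top)
    finally have fin: "A z < \<infinity>" .
    then have Az: "A z = ennreal (enn2real (A z))" by simp
    \<comment> \<open>The kernel is split as \<open>T^(1/p) T^(1/q)\<close> and the weight
      \<open>(1 - |w|)^(1/(pq))\<close> is inserted with its inverse: \<open>?g^q\<close> is then
      the integrand of \<open>Forelli_Rudin_snd\<close> with \<open>a = 1/p\<close>, and
      \<open>?f^p\<close> that of \<open>A z\<close>.\<close>
    let ?f = "\<lambda>w. (T z w powr (1 / p) * h w * (1 - cmod w) powr (1 / (p * q))) * indicator D w"
    let ?g = "\<lambda>w. (T z w powr (1 / q) * (1 - cmod w) powr (- (1 / (p * q)))) * indicator D w"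
    have "ennreal (H z) \<le> (\<integral>\<^sup>+w. ennreal (?f w * ?g w) \<partial>lborel)"
    proof (rule order_trans[OF H[OF z]], rule nn_integral_mono)
      fix w
      have "?f w * ?g w = h w * T z w" if "w \<in> D"
      proof -
        have T: "T z w powr (1 / p) * T z w powr (1 / q) = T z w"
          using pq T0[of z w] by (simp add: powr_add[symmetric])
        have u: "(1 - cmod w) powr (1 / (p * q)) * (1 - cmod w) powr (- (1 / (p * q))) = 1"
          using that by (simp add: powr_minus D_def)
        have "?f w * ?g w = h w * (T z w powr (1 / p) * T z w powr (1 / q)) *
            ((1 - cmod w) powr (1 / (p * q)) * (1 - cmod w) powr (- (1 / (p * q))))"
          using that by (simp only: indicator_simps mult_1_right mult_ac)
        then show ?thesis
          by (simp only: T u mult_1_right)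
      qed
      then show "ennreal (h w / (cmod (1 - z * cnj (chi p w)))\<^sup>2) \<le> ennreal (?f w * ?g w)"
        using hD[of w] by (cases "w \<in> D") (auto simp: T_def)
    qed
    also have "\<dots> \<le> ennreal (enn2real (A z) powr (1 / p) * B1 powr (1 / q))"
    proof (rule nn_integral_Holder)
      have "?f w powr p = (T z w * h w powr p * (1 - cmod w) powr (1 / q)) * indicator D w" for w
        using pq T0[of z w] h0[of w] by (auto simp: indicator_def D_def powr_mult powr_powr)
      then show "(\<integral>\<^sup>+w. ennreal (?f w powr p) \<partial>lborel) \<le> ennreal (enn2real (A z))"
        unfolding Az[symmetric] unfolding A_def by (intro nn_integral_mono) (simp add: indicator_def)
      have "?g w powr q = ((1 - cmod w) powr (- (1 / p)) / (cmod (1 - z * cnj (chi p w)))\<^sup>2) * indicator D w" for w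
        using pq T0[of z w] by (auto simp: indicator_def D_def powr_mult powr_powr) (simp add: T_def)
      then have "(\<integral>\<^sup>+w. ennreal (?g w powr q) \<partial>lborel) =
          (\<integral>\<^sup>+w. ennreal ((1 - cmod w) powr (- (1 / p)) / (cmod (1 - z * cnj (chi p w)))\<^sup>2) * indicator D w \<partial>lborel)"
        by (intro nn_integral_cong) (simp add: indicator_def)
      then show "(\<integral>\<^sup>+w. ennreal (?g w powr q) \<partial>lborel) \<le> ennreal B1"
        using Forelli_Rudin_snd[OF pq(1) pq'(1,2) z] by (simp add: B1_def D_def)
    qed (use pq h0 B1 in auto)
    finally have "H z \<le> enn2real (A z) powr (1 / p) * B1 powr (1 / q)"
      by (simp add: ennreal_le_iff)
    then have "H z powr p \<le> (enn2real (A z) powr (1 / p) * B1 powr (1 / q)) powr p"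
      using H0 pq by (intro powr_mono2) auto
    also have "\<dots> = enn2real (A z) * B1 powr (p / q)"
      using pq B1 by (simp add: powr_mult powr_powr)
    also have "B1 powr (p / q) = ?C1 powr (p / q) * (1 - cmod z) powr (- (1 / q))"
      using C0 z pq by (simp add: B1_def powr_mult powr_powr)
    finally have "ennreal (H z powr p) \<le> ennreal (?C1 powr (p / q) * ((1 - cmod z) powr (- (1 / q)) * enn2real (A z)))"
      by (intro ennreal_leI) (simp add: mult_ac)
    also have "\<dots> = ennreal (?C1 powr (p / q)) * (ennreal ((1 - cmod z) powr (- (1 / q))) * A z)"
      using Az by (simp add: ennreal_mult)
    finally show ?thesis .
  qed
  have [measurable]: "A \<in> borel_measurable borel"
    unfolding A_def by measurable
  have "(\<integral>\<^sup>+z. ennreal (H z powr p) * indicator (ball 0 1) z \<partial>lborel) \<le>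
      (\<integral>\<^sup>+z. ennreal (?C1 powr (p / q)) * (ennreal ((1 - cmod z) powr (- (1 / q))) * indicator D z * A z) \<partial>lborel)"
    by (rule nn_integral_mono) (use pt in \<open>auto simp: D_def indicator_def\<close>)
  also have "\<dots> = ennreal (?C1 powr (p / q)) * (\<integral>\<^sup>+z. ennreal ((1 - cmod z) powr (- (1 / q))) * indicator D z * A z \<partial>lborel)"
    by (rule nn_integral_cmult) simp
  also have "(\<integral>\<^sup>+z. ennreal ((1 - cmod z) powr (- (1 / q))) * indicator D z * A z \<partial>lborel) =
      (\<integral>\<^sup>+z. (\<integral>\<^sup>+w. ennreal ((1 - cmod z) powr (- (1 / q))) * indicator D z * (ennreal (T z w * h w powr p * (1 - cmod w) powr (1 / q)) * indicator D w) \<partial>lborel) \<partial>lborel)"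
    unfolding A_def by (simp add: nn_integral_cmult)
  also have "\<dots> = (\<integral>\<^sup>+w. (\<integral>\<^sup>+z. ennreal ((1 - cmod z) powr (- (1 / q))) * indicator D z * (ennreal (T z w * h w powr p * (1 - cmod w) powr (1 / q)) * indicator D w) \<partial>lborel) \<partial>lborel)"
    by (rule lborel_pair.Fubini') measurable
  \<comment> \<open>With \<open>w\<close> fixed, \<open>Forelli_Rudin_fst\<close> with
    \<open>a = 1/q\<close> yields exactly the inverse of the remaining factor
    \<open>(1 - cmod w) powr (1 / q)\<close>.\<close>
  also have "\<dots> \<le> (\<integral>\<^sup>+w. ennreal ?C2 * ennreal (h w powr p) \<partial>lborel)"
  proof (rule nn_integral_mono)
    fix w
    show "(\<integral>\<^sup>+z. ennreal ((1 - cmod z) powr (- (1 / q))) * indicator D z * (ennreal (T z w * h w powr p * (1 - cmod w) powr (1 / q)) * indicator D w) \<partial>lborel)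
      \<le> ennreal ?C2 * ennreal (h w powr p)"
    proof (cases "w \<in> D")
      case True
      then have w: "cmod w < 1" by (simp add: D_def)
      have "(\<integral>\<^sup>+z. ennreal ((1 - cmod z) powr (- (1 / q))) * indicator D z * (ennreal (T z w * h w powr p * (1 - cmod w) powr (1 / q)) * indicator D w) \<partial>lborel)
        = (\<integral>\<^sup>+z. ennreal (h w powr p * (1 - cmod w) powr (1 / q)) * (ennreal ((1 - cmod z) powr (- (1 / q)) / (cmod (1 - z * cnj (chi p w)))\<^sup>2) * indicator D z) \<partial>lborel)"
        using True T0 by (intro nn_integral_cong) (auto simp: indicator_def ennreal_mult[symmetric] T_def mult_ac)
      also have "\<dots> = ennreal (h w powr p * (1 - cmod w) powr (1 / q)) * (\<integral>\<^sup>+z. ennreal ((1 - cmod z) powr (- (1 / q)) / (cmod (1 - z * cnj (chi p w)))\<^sup>2) * indicator D z \<partial>lborel)"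
        by (rule nn_integral_cmult) simp
      also have "\<dots> \<le> ennreal (h w powr p * (1 - cmod w) powr (1 / q)) * ennreal (?C2 * (1 - cmod w) powr (- (1 / q)))"
        unfolding D_def by (intro mult_left_mono Forelli_Rudin_fst pq pq' w) auto
      also have "\<dots> = ennreal (?C2 * h w powr p)"
        using w C0 by (simp add: ennreal_mult[symmetric] powr_minus)
      finally show ?thesis
        using C0 by (simp add: ennreal_mult)
    qed simp
  qed
  also have "\<dots> = ennreal ?C2 * (\<integral>\<^sup>+w. ennreal (h w powr p) \<partial>lborel)"
    by (rule nn_integral_cmult) simp
  finally have "(\<integral>\<^sup>+z. ennreal (H z powr p) * indicator (ball 0 1) z \<partial>lborel)
      \<le> ennreal (?C1 powr (p / q)) * (ennreal ?C2 * (\<integral>\<^sup>+w. ennreal (h w powr p) \<partial>lborel))"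
    by (simp add: mult_left_mono)
  then show ?thesis
    using C0 by (simp add: Schur_const_def ennreal_mult mult.assoc)
qed

section \<open>Weighted Bergman spaces and the pairing\<close>

text \<open>A pointwise stand-in for Minkowski's inequality; constants are irrelevant for membership
  and for norm equivalence.\<close>

lemma powr_add_le:
  fixes x y r :: real
  assumes "0 \<le> x" "0 \<le> y" "0 \<le> r"
  shows "(x + y) powr r \<le> 2 powr r * (x powr r + y powr r)"
proof -
  have "(x + y) powr r \<le> (2 * max x y) powr r"
    using assms by (intro powr_mono2) auto
  also have "\<dots> = 2 powr r * max x y powr r"
    using assms by (simp add: powr_mult)
  also have "max x y powr r \<le> x powr r + y powr r"
    by (auto simp: max_def)
  finally show ?thesis
    by (simp add: mult_left_mono)
qed

text \<open>The \<open>r\<close>-th power of the norm, kept in \<open>ennreal\<close> so that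
  membership is finiteness and estimates can precede integrability.\<close>

definition Aint :: "real \<Rightarrow> complex set \<Rightarrow> (complex \<Rightarrow> real) \<Rightarrow> (complex \<Rightarrow> complex) \<Rightarrow> ennreal" where
  "Aint r U lam f = (\<integral>\<^sup>+z. ennreal (cmod (f z) powr r * lam z) * indicator U z \<partial>lborel)"

lemma Aspace_iff: "f \<in> Aspace r U lam \<longleftrightarrow> f holomorphic_on U \<and> Aint r U lam f < \<infinity>"
  by (simp add: Aspace_def Aint_def)

text \<open>Elements of the spaces are total functions with arbitrary values off \<open>U\<close>,
  so only their cut-off to \<open>U\<close> is known to be Borel.\<close>

lemma borel_measurable_holomorphic_indicator:
  assumes "f holomorphic_on U" "open U"
  shows "(\<lambda>z. indicator U z *\<^sub>R f z) \<in> borel_measurable borel"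
  using assms by (intro borel_measurable_continuous_on_indicator holomorphic_on_imp_continuous_on) auto

lemma borel_measurable_Aint_integrand:
  assumes "f holomorphic_on U" "open U" and [measurable]: "lam \<in> borel_measurable borel"
  shows "(\<lambda>z. cmod (f z) powr r * lam z * indicator U z) \<in> borel_measurable borel"
    and "(\<lambda>z. ennreal (cmod (f z) powr r * lam z) * indicator U z) \<in> borel_measurable borel"
proof -
  note [measurable] = borel_measurable_holomorphic_indicator[OF assms(1,2)] borel_open[OF assms(2)]
  have eq: "cmod (f z) powr r * lam z * indicator U z = cmod (indicator U z *\<^sub>R f z) powr r * lam z * indicator U z" for z
    by (simp add: indicator_def)
  show 1: "(\<lambda>z. cmod (f z) powr r * lam z * indicator U z) \<in> borel_measurable borel"
    unfolding eq by measurable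
  have "(\<lambda>z. ennreal (cmod (f z) powr r * lam z) * indicator U z) = (\<lambda>z. ennreal (cmod (f z) powr r * lam z * indicator U z))"
    by (auto simp: indicator_def)
  then show "(\<lambda>z. ennreal (cmod (f z) powr r * lam z) * indicator U z) \<in> borel_measurable borel"
    using 1 by simp
qed

lemma Aint_cong: "(\<And>z. z \<in> U \<Longrightarrow> f z = g z) \<Longrightarrow> Aint r U lam f = Aint r U lam g"
  unfolding Aint_def by (intro nn_integral_cong) (auto simp: indicator_def)

lemma Anorm_cong: "U \<in> sets borel \<Longrightarrow> (\<And>z. z \<in> U \<Longrightarrow> f z = g z) \<Longrightarrow> Anorm r U lam f = Anorm r U lam g"
  unfolding Anorm_def by (subst set_lebesgue_integral_cong[where g = "\<lambda>z. cmod (g z) powr r * lam z"]) auto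

lemma Aspace_cong: "(\<And>z. z \<in> U \<Longrightarrow> f z = g z) \<Longrightarrow> f \<in> Aspace r U lam \<longleftrightarrow> g \<in> Aspace r U lam"
  unfolding Aspace_iff using Aint_cong[of U f g] holomorphic_cong[of U U f g] by auto

lemma Anorm_nonneg [simp]: "0 \<le> Anorm r U lam f"
  by (simp add: Anorm_def)

lemma Aint_eq_Anorm:
  assumes f: "f \<in> Aspace r U lam" and U: "open U" and r: "0 < r"
    and lam: "lam \<in> borel_measurable borel" "\<And>z. 0 \<le> lam z"
  shows "Aint r U lam f = ennreal (Anorm r U lam f powr r)"
proof -
  have hol: "f holomorphic_on U" and fin: "Aint r U lam f < \<infinity>"
    using f by (auto simp: Aspace_iff)
  note m = borel_measurable_Aint_integrand(1)[OF hol U lam(1), of r]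
  have "(LINT z:U|lborel. cmod (f z) powr r * lam z) = (\<integral>z. cmod (f z) powr r * lam z * indicator U z \<partial>lborel)"
    unfolding set_lebesgue_integral_def by (simp add: mult.commute)
  also have "\<dots> = enn2real (\<integral>\<^sup>+z. ennreal (cmod (f z) powr r * lam z * indicator U z) \<partial>lborel)"
    using m lam(2) by (intro integral_eq_nn_integral) auto
  also have "(\<integral>\<^sup>+z. ennreal (cmod (f z) powr r * lam z * indicator U z) \<partial>lborel) = Aint r U lam f"
    unfolding Aint_def by (intro nn_integral_cong) (auto simp: indicator_def)
  finally have "Anorm r U lam f powr r = enn2real (Aint r U lam f)"
    using r by (simp add: Anorm_def powr_powr)
  then show ?thesis
    using fin by simp
qed

lemma Anorm_le:
  assumes f: "f holomorphic_on U" and U: "open U" and r: "0 < r"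
    and lam: "lam \<in> borel_measurable borel" "\<And>z. 0 \<le> lam z"
    and le: "Aint r U lam f \<le> ennreal (B powr r)" and B: "0 \<le> B"
  shows "f \<in> Aspace r U lam" "Anorm r U lam f \<le> B"
proof -
  show A: "f \<in> Aspace r U lam"
    using f le by (auto simp: Aspace_iff intro: order_le_less_trans)
  have "Anorm r U lam f powr r \<le> B powr r"
    using le by (simp add: Aint_eq_Anorm[OF A U r lam])
  then show "Anorm r U lam f \<le> B"
    using powr_less_mono2[OF r B, of "Anorm r U lam f"] by linarith
qed

lemma Aint_lincomb_le:
  assumes f: "f holomorphic_on U" and g: "g holomorphic_on U" and U: "open U" and r: "0 < r"
    and lam: "lam \<in> borel_measurable borel" "\<And>z. 0 \<le> lam z"
  shows "Aint r U lam (\<lambda>z. a * f z + b * g z)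
    \<le> ennreal (2 powr r * cmod a powr r) * Aint r U lam f + ennreal (2 powr r * cmod b powr r) * Aint r U lam g"
proof -
  note m = borel_measurable_Aint_integrand(2)[OF f U lam(1), of r] borel_measurable_Aint_integrand(2)[OF g U lam(1), of r]
  have "Aint r U lam (\<lambda>z. a * f z + b * g z) \<le> (\<integral>\<^sup>+z. ennreal (2 powr r * cmod a powr r) * (ennreal (cmod (f z) powr r * lam z) * indicator U z)
      + ennreal (2 powr r * cmod b powr r) * (ennreal (cmod (g z) powr r * lam z) * indicator U z) \<partial>lborel)"
    unfolding Aint_def
  proof (rule nn_integral_mono)
    fix z
    have "cmod (a * f z + b * g z) powr r \<le> (cmod (a * f z) + cmod (b * g z)) powr r"
      using r by (intro powr_mono2 norm_triangle_ineq) auto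
    also have "\<dots> \<le> 2 powr r * (cmod (a * f z) powr r + cmod (b * g z) powr r)"
      using r by (intro powr_add_le) auto
    finally have "cmod (a * f z + b * g z) powr r * lam z \<le> 2 powr r * (cmod (a * f z) powr r + cmod (b * g z) powr r) * lam z"
      using lam(2) by (intro mult_right_mono)
    also have "\<dots> = 2 powr r * cmod a powr r * (cmod (f z) powr r * lam z) + 2 powr r * cmod b powr r * (cmod (g z) powr r * lam z)"
      by (simp add: norm_mult powr_mult algebra_simps)
    finally have "ennreal (cmod (a * f z + b * g z) powr r * lam z) \<le> ennreal (2 powr r * cmod a powr r) * ennreal (cmod (f z) powr r * lam z)
        + ennreal (2 powr r * cmod b powr r) * ennreal (cmod (g z) powr r * lam z)"
      using lam(2)[of z] by (simp add: ennreal_mult[symmetric] ennreal_plus[symmetric] ennreal_leI del: ennreal_plus)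
    then show "ennreal (cmod (a * f z + b * g z) powr r * lam z) * indicator U z
        \<le> ennreal (2 powr r * cmod a powr r) * (ennreal (cmod (f z) powr r * lam z) * indicator U z)
      + ennreal (2 powr r * cmod b powr r) * (ennreal (cmod (g z) powr r * lam z) * indicator U z)"
      by (auto simp: indicator_def)
  qed
  also have "\<dots> = ennreal (2 powr r * cmod a powr r) * Aint r U lam f + ennreal (2 powr r * cmod b powr r) * Aint r U lam g"
    unfolding Aint_def using m by (simp add: nn_integral_add nn_integral_cmult)
  finally show ?thesis .
qed

lemma Aspace_lincomb:
  assumes f: "f \<in> Aspace r U lam" and g: "g \<in> Aspace r U lam" and U: "open U" and r: "0 < r"
    and lam: "lam \<in> borel_measurable borel" "\<And>z. 0 \<le> lam z"
  shows "(\<lambda>z. a * f z + b * g z) \<in> Aspace r U lam"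
proof -
  have "Aint r U lam (\<lambda>z. a * f z + b * g z) < \<infinity>"
  proof (rule order_le_less_trans[OF Aint_lincomb_le])
    show "ennreal (2 powr r * cmod a powr r) * Aint r U lam f + ennreal (2 powr r * cmod b powr r) * Aint r U lam g < \<infinity>"
      using f g by (simp add: Aspace_iff ennreal_mult_less_top)
  qed (use assms in \<open>auto simp: Aspace_iff\<close>)
  then show ?thesis
    using f g by (auto simp: Aspace_iff intro!: holomorphic_intros)
qed

lemma Aspace_one_lincomb:
  assumes "f \<in> Aspace r U (\<lambda>_. 1)" "g \<in> Aspace r U (\<lambda>_. 1)" "open U" "0 < r"
  shows "(\<lambda>z. a * f z + b * g z) \<in> Aspace r U (\<lambda>_. 1)"
  using assms by (intro Aspace_lincomb) auto

text \<open>The bound \<open>M\<close> is a parameter so that the norm of the representing function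
  can be estimated linearly in it.\<close>

definition bounded_functional :: "real \<Rightarrow> complex set \<Rightarrow> ((complex \<Rightarrow> complex) \<Rightarrow> complex) \<Rightarrow> real \<Rightarrow> bool" where
  "bounded_functional p U L M \<longleftrightarrow>
    (\<forall>f1\<in>Aspace p U (\<lambda>_. 1). \<forall>f2\<in>Aspace p U (\<lambda>_. 1). \<forall>a b. L (\<lambda>z. a * f1 z + b * f2 z) = a * L f1 + b * L f2) \<and>
    (\<forall>f\<in>Aspace p U (\<lambda>_. 1). cmod (L f) \<le> M * Anorm p U (\<lambda>_. 1) f)"

lemma bounded_functionalD:
  assumes "bounded_functional p U L M"
  shows "f1 \<in> Aspace p U (\<lambda>_. 1) \<Longrightarrow> f2 \<in> Aspace p U (\<lambda>_. 1) \<Longrightarrow> L (\<lambda>z. a * f1 z + b * f2 z) = a * L f1 + b * L f2"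
    and "f1 \<in> Aspace p U (\<lambda>_. 1) \<Longrightarrow> cmod (L f1) \<le> M * Anorm p U (\<lambda>_. 1) f1"
  using assms by (auto simp: bounded_functional_def)

lemma bounded_functional_diff:
  assumes L: "bounded_functional p U L M" and fg: "f \<in> Aspace p U (\<lambda>_. 1)" "g \<in> Aspace p U (\<lambda>_. 1)"
    and U: "open U" "0 < p"
  shows "L f - L g = L (\<lambda>z. f z - g z)" "cmod (L f - L g) \<le> M * Anorm p U (\<lambda>_. 1) (\<lambda>z. f z - g z)"
proof -
  show eq: "L f - L g = L (\<lambda>z. f z - g z)"
    using bounded_functionalD(1)[OF L fg, of 1 "-1"] by simp
  have "(\<lambda>z. f z - g z) \<in> Aspace p U (\<lambda>_. 1)"
    using Aspace_one_lincomb[OF fg U, of 1 "-1"] by simp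
  then show "cmod (L f - L g) \<le> M * Anorm p U (\<lambda>_. 1) (\<lambda>z. f z - g z)"
    unfolding eq by (rule bounded_functionalD(2)[OF L])
qed

text \<open>\<open>L\<close> acts on total functions; boundedness makes it blind to values off
  \<open>U\<close>, because the difference then has norm 0.\<close>

lemma bounded_functional_cong:
  assumes L: "bounded_functional p U L M" and f: "f \<in> Aspace p U (\<lambda>_. 1)" "\<And>z. z \<in> U \<Longrightarrow> f z = g z"
    and U: "open U" "0 < p"
  shows "L f = L g"
proof -
  have g: "g \<in> Aspace p U (\<lambda>_. 1)"
    using f Aspace_cong[of U f g] by blast
  have "Anorm p U (\<lambda>_. 1) (\<lambda>z. f z - g z) = Anorm p U (\<lambda>_. 1) (\<lambda>z. 0)"
    using f(2) U by (intro Anorm_cong) auto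
  also have "\<dots> = 0"
    using U by (simp add: Anorm_def)
  finally show ?thesis
    using bounded_functional_diff(2)[OF L f(1) g U] by simp
qed

text \<open>Radii increasing to 1. As \<open>rad 0 = 0\<close>, positive radii are written
  \<open>rad (Suc k)\<close>.\<close>

definition rad :: "nat \<Rightarrow> real" where
  "rad k = 1 - inverse (real (Suc k))"

lemma rad_bounds: "0 \<le> rad k" "rad k < 1"
  by (auto simp: rad_def field_simps)

lemma rad_tendsto: "rad \<longlonglongrightarrow> 1"
  using LIMSEQ_inverse_real_of_nat_add_minus[of 1] by (simp add: rad_def[abs_def])

lemma rad_mono: "k \<le> l \<Longrightarrow> rad k \<le> rad l"
  by (simp add: rad_def)

section \<open>The pairing on the disc and on the punctured disc\<close>

locale conjugate_exponents =
  fixes p q :: real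
  assumes p: "1 < p" and q: "q = p / (p - 1)"
begin

lemma q_gt_1: "1 < q"
  using p unfolding q by simp

lemma conj_sum: "1 / p + 1 / q = 1"
  using p unfolding q by (simp add: field_simps)

lemma conj_mult: "(q - 1) * p = q"
  using p q by (simp add: field_simps)

lemma eta_nonneg: "0 \<le> eta q z"
  using q_gt_1 by (simp add: eta_def)

lemma norm_chi_less_1: "cmod (chi p z) < 1 \<longleftrightarrow> cmod z < 1"
proof (cases "cmod z < 1")
  case True
  then show ?thesis
    using p powr_less_mono2[of "p - 1" "cmod z" 1] by (simp add: norm_chi)
next
  case False
  then show ?thesis
    using p powr_mono2[of "p - 1" 1 "cmod z"] by (simp add: norm_chi)
qed

lemma chi_eq_0: "chi p z = 0 \<longleftrightarrow> z = 0"
  by (simp add: chi_def)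

context
  fixes U :: "complex set"
  assumes U: "U = ball 0 1 \<or> U = ball 0 1 - {0}"
begin

lemma open_U: "open U"
  using U by (auto intro: open_delete)

lemma U_subset: "U \<subseteq> ball 0 1"
  using U by auto

lemma chi_mem_iff: "chi p z \<in> U \<longleftrightarrow> z \<in> U"
  using U norm_chi_less_1 chi_eq_0 by auto

lemma borel_measurable_chi_compose:
  assumes "g holomorphic_on U"
  shows "(\<lambda>z. indicator U z *\<^sub>R g (chi p z)) \<in> borel_measurable borel"
proof -
  note [measurable] = borel_measurable_holomorphic_indicator[OF assms open_U]
  have "(\<lambda>z. indicator U z *\<^sub>R g (chi p z)) = (\<lambda>z. (\<lambda>z. indicator U z *\<^sub>R g z) (chi p z))"
    by (auto simp: indicator_def chi_mem_iff)
  also have "\<dots> \<in> borel_measurable borel"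
    by measurable
  finally show ?thesis .
qed

lemma nn_integral_chi_Aint:
  assumes "g holomorphic_on U"
  shows "(\<integral>\<^sup>+z. ennreal (cmod (indicator U z *\<^sub>R g (chi p z)) powr q) \<partial>lborel) = Aint q U (eta q) g"
proof -
  note [measurable] = borel_measurable_holomorphic_indicator[OF assms open_U]
  let ?F = "\<lambda>z. ennreal (cmod (indicator U z *\<^sub>R g z) powr q)"
  have "(\<integral>\<^sup>+z. ennreal (cmod (indicator U z *\<^sub>R g (chi p z)) powr q) \<partial>lborel) = (\<integral>\<^sup>+z. ?F (chi p z) * indicator (ball 0 1) z \<partial>lborel)"
    using U_subset q_gt_1 by (intro nn_integral_cong) (auto simp: indicator_def chi_mem_iff)
  also have "\<dots> = (\<integral>\<^sup>+z. ?F z * ennreal (eta q z) * indicator (ball 0 1) z \<partial>lborel)"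
    by (rule nn_integral_chi[OF _ p q]) measurable
  also have "\<dots> = Aint q U (eta q) g"
    unfolding Aint_def using U_subset q_gt_1 eta_nonneg
    by (intro nn_integral_cong) (auto simp: indicator_def ennreal_mult)
  finally show ?thesis .
qed

lemma pairing_bound:
  assumes f: "f \<in> Aspace p U (\<lambda>_. 1)" and g: "g \<in> Aspace q U (eta q)"
  shows "set_integrable lborel U (\<lambda>z. f z * cnj (g (chi p z)))"
    and "cmod (pairing p U f g) \<le> Anorm p U (\<lambda>_. 1) f * Anorm q U (eta q) g"
proof -
  have hol: "f holomorphic_on U" "g holomorphic_on U"
    using f g by (auto simp: Aspace_iff)
  let ?f = "\<lambda>z. indicator U z *\<^sub>R f z" and ?g = "\<lambda>z. indicator U z *\<^sub>R g (chi p z)"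
  note [measurable] = borel_measurable_holomorphic_indicator[OF hol(1) open_U] borel_measurable_chi_compose[OF hol(2)]
  have eq: "indicator U z *\<^sub>R (f z * cnj (g (chi p z))) = ?f z * cnj (?g z)" for z
    by (simp add: indicator_def)
  have p0: "0 < p" using p by simp
  have m: "(\<lambda>z. cmod (?f z)) \<in> borel_measurable lborel" "(\<lambda>z. cmod (?g z)) \<in> borel_measurable lborel"
    by measurable
  have "(\<integral>\<^sup>+z. ennreal (cmod (?f z) * cmod (?g z)) \<partial>lborel)
      \<le> ennreal ((Anorm p U (\<lambda>_. 1) f powr p) powr (1 / p) * (Anorm q U (eta q) g powr q) powr (1 / q))"
  proof (rule nn_integral_Holder[OF m])
    have "(\<integral>\<^sup>+z. ennreal (cmod (?f z) powr p) \<partial>lborel) = Aint p U (\<lambda>_. 1) f"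
      unfolding Aint_def using p by (intro nn_integral_cong) (auto simp: indicator_def)
    then show "(\<integral>\<^sup>+z. ennreal (cmod (?f z) powr p) \<partial>lborel) \<le> ennreal (Anorm p U (\<lambda>_. 1) f powr p)"
      using Aint_eq_Anorm[OF f open_U p0] by simp
    show "(\<integral>\<^sup>+z. ennreal (cmod (?g z) powr q) \<partial>lborel) \<le> ennreal (Anorm q U (eta q) g powr q)"
      unfolding nn_integral_chi_Aint[OF hol(2)]
      using Aint_eq_Anorm[OF g open_U] q_gt_1 eta_nonneg by simp
  qed (use p q_gt_1 conj_sum in auto)
  then have le: "(\<integral>\<^sup>+z. ennreal (cmod (?f z * cnj (?g z))) \<partial>lborel) \<le> ennreal (Anorm p U (\<lambda>_. 1) f * Anorm q U (eta q) g)"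
    using p q_gt_1 by (simp add: powr_powr norm_mult mult_ac)
  have int: "integrable lborel (\<lambda>z. ?f z * cnj (?g z))"
  proof (rule integrableI_bounded)
    show "(\<lambda>z. ?f z * cnj (?g z)) \<in> borel_measurable lborel"
      by measurable
    show "(\<integral>\<^sup>+z. ennreal (cmod (?f z * cnj (?g z))) \<partial>lborel) < \<infinity>"
      using le by (rule order_le_less_trans) simp
  qed
  then show "set_integrable lborel U (\<lambda>z. f z * cnj (g (chi p z)))"
    unfolding set_integrable_def eq .
  have "ennreal (cmod (pairing p U f g)) \<le> (\<integral>\<^sup>+z. ennreal (cmod (?f z * cnj (?g z))) \<partial>lborel)"
    unfolding pairing_def set_lebesgue_integral_def eq by (rule integral_norm_bound_ennreal[OF int])
  from order_trans[OF this le]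
  have "ennreal (cmod (pairing p U f g)) \<le> ennreal (Anorm p U (\<lambda>_. 1) f * Anorm q U (eta q) g)" .
  then show "cmod (pairing p U f g) \<le> Anorm p U (\<lambda>_. 1) f * Anorm q U (eta q) g"
    by (simp add: ennreal_le_iff)
qed

lemma pairing_linear_left:
  assumes "f1 \<in> Aspace p U (\<lambda>_. 1)" "f2 \<in> Aspace p U (\<lambda>_. 1)" "g \<in> Aspace q U (eta q)"
  shows "pairing p U (\<lambda>z. a * f1 z + b * f2 z) g = a * pairing p U f1 g + b * pairing p U f2 g"
proof -
  note i = pairing_bound(1)[OF assms(1,3)] pairing_bound(1)[OF assms(2,3)]
  have "pairing p U (\<lambda>z. a * f1 z + b * f2 z) g =
      (LINT z:U|lborel. a * (f1 z * cnj (g (chi p z))) + b * (f2 z * cnj (g (chi p z))))"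
    unfolding pairing_def by (simp add: algebra_simps)
  also have "\<dots> = a * pairing p U f1 g + b * pairing p U f2 g"
    unfolding pairing_def using i by (subst set_integral_add) auto
  finally show ?thesis .
qed

lemma pairing_linear_right:
  assumes "f \<in> Aspace p U (\<lambda>_. 1)" "g1 \<in> Aspace q U (eta q)" "g2 \<in> Aspace q U (eta q)"
  shows "pairing p U f (\<lambda>z. a * g1 z + b * g2 z) = cnj a * pairing p U f g1 + cnj b * pairing p U f g2"
proof -
  note i = pairing_bound(1)[OF assms(1,2)] pairing_bound(1)[OF assms(1,3)]
  have "pairing p U f (\<lambda>z. a * g1 z + b * g2 z) =
      (LINT z:U|lborel. cnj a * (f z * cnj (g1 (chi p z))) + cnj b * (f z * cnj (g2 (chi p z))))"
    unfolding pairing_def by (simp add: algebra_simps)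
  also have "\<dots> = cnj a * pairing p U f g1 + cnj b * pairing p U f g2"
    unfolding pairing_def using i by (subst set_integral_add) auto
  finally show ?thesis .
qed

lemma pairing_cong:
  assumes "\<And>z. z \<in> U \<Longrightarrow> f z = f' z" "\<And>z. z \<in> U \<Longrightarrow> g z = g' z"
  shows "pairing p U f g = pairing p U f' g'"
  unfolding pairing_def using assms open_U chi_mem_iff by (intro set_lebesgue_integral_cong) auto

lemma bounded_functional_pairing:
  assumes "g \<in> Aspace q U (eta q)"
  shows "bounded_functional p U (\<lambda>f. pairing p U f g) (Anorm q U (eta q) g)"
  unfolding bounded_functional_def
  using pairing_linear_left[OF _ _ assms] pairing_bound(2)[OF _ assms] by (simp add: mult.commute)

text \<open>Pulled back along \<open>chi p\<close>, the integral of the weight, which is singular at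
  0 for \<open>q < 2\<close>, becomes the area of \<open>U\<close>.\<close>

lemma Aint_one_less_top: "Aint q U (eta q) (\<lambda>_. 1) < \<infinity>"
proof -
  have "Aint q U (eta q) (\<lambda>_. 1) = (\<integral>\<^sup>+z. ennreal (cmod (indicator U z *\<^sub>R 1) powr q) \<partial>lborel)"
    by (rule nn_integral_chi_Aint[symmetric]) simp
  also have "\<dots> \<le> (\<integral>\<^sup>+z. indicator (ball (0::complex) 1) z \<partial>lborel)"
    using U_subset q_gt_1 by (intro nn_integral_mono) (auto simp: indicator_def)
  also have "\<dots> < \<infinity>"
    by (simp add: emeasure_disc)
  finally show ?thesis .
qed

text \<open>Pair \<open>f\<close> with the constant 1.\<close>

lemma set_integrable_Aspace:
  assumes "f \<in> Aspace p U (\<lambda>_. 1)"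
  shows "set_integrable lborel U f"
proof -
  have "(\<lambda>_. 1) \<in> Aspace q U (eta q)"
    using Aint_one_less_top by (simp add: Aspace_iff)
  from pairing_bound(1)[OF assms this] show ?thesis by simp
qed

lemma rotate_mem_iff: "cmod w = 1 \<Longrightarrow> w * z \<in> U \<longleftrightarrow> z \<in> U"
  using U by (auto simp: norm_mult)

text \<open>Expand \<open>g\<close> on a smaller disc and integrate term by term: rotations kill all but one power.\<close>

lemma pairing_monomial:
  fixes n :: int
  assumes f: "(\<lambda>z. z powi n) \<in> Aspace p U (\<lambda>_. 1)" and g: "g \<in> Aspace q U (eta q)"
    and b: "\<And>w. w \<in> U \<Longrightarrow> (\<lambda>m. b m * w ^ m) sums g w"
  shows "pairing p U (\<lambda>z. z powi n) g =
    (if n < 0 then 0 else cnj (b (nat n)) * of_real (\<integral>z. indicator U z * (cmod z powr p) ^ nat n \<partial>lborel))"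
proof -
  \<comment> \<open>The series of \<open>g\<close> converges uniformly only on smaller discs, so the
    pairing is cut off at radius \<open>rad k\<close> first.\<close>
  define v where "v k z = (indicator (ball 0 (rad k) \<inter> U) z :: real)" for k and z :: complex
  define h where "h k z = complex_of_real (v k z) * z powi n" for k z
  \<comment> \<open>The exponent is an integer so that \<open>n = -1\<close> covers
    \<open>1/z\<close>; a negative \<open>n\<close> matches no power \<open>m\<close> of the series,
    whence the value 0.\<close>
  define c where "c = (if n < 0 then 0 else cnj (b (nat n)))"
  have [measurable]: "U \<in> sets borel" using open_U by simp
  have [measurable]: "(\<lambda>z. z powi n) \<in> borel_measurable (borel :: complex measure)"
    unfolding power_int_def by measurable
  have [measurable]: "v k \<in> borel_measurable borel" for k
    unfolding v_def by measurable
  have [measurable]: "h k \<in> borel_measurable borel" for k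
    unfolding h_def by measurable
  have hm: "(\<lambda>z. h k z * cnj (chi p z) ^ m) \<in> borel_measurable borel" for k m
    by (intro borel_measurable_times borel_measurable_power borel_measurable_cnj borel_measurable_chi) simp
  have hol: "g holomorphic_on U" using g by (simp add: Aspace_iff)
  have v_lim: "(\<lambda>k. v k z) \<longlonglongrightarrow> indicator U z" for z
  proof (cases "z \<in> U")
    case True
    then have "cmod z < 1" using U_subset by auto
    then have "eventually (\<lambda>k. cmod z < rad k) sequentially"
      by (rule order_tendstoD(1)[OF rad_tendsto])
    then have "eventually (\<lambda>k. v k z = indicator U z) sequentially"
      by eventually_elim (use True in \<open>auto simp: v_def\<close>)
    then show ?thesis
      by (rule tendsto_eventually)
  qed (simp add: v_def)
  have hi: "integrable lborel (h k)" for k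
    by (rule Bochner_Integration.integrable_bound[OF set_integrable_Aspace[OF f, unfolded set_integrable_def]])
      (auto simp: h_def v_def indicator_def norm_mult intro!: AE_I2)
  have zchi: "z * cnj (chi p z) = complex_of_real (cmod z powr p)" for z
  proof (cases "z = 0")
    case False
    have "z * cnj (chi p z) = (z * cnj z) * complex_of_real (cmod z powr (p - 2))"
      by (simp add: chi_def mult_ac)
    also have "\<dots> = complex_of_real ((cmod z)\<^sup>2 * cmod z powr (p - 2))"
      by (simp add: complex_norm_square[symmetric])
    also have "(cmod z)\<^sup>2 * cmod z powr (p - 2) = cmod z powr (2 + (p - 2))"
      using False by (subst powr_add) simp
    finally show ?thesis by simp
  qed (simp add: chi_def)
  have terms: "cnj (b m) * (\<integral>z. h k z * cnj (chi p z) ^ m \<partial>lborel) =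
      (if int m = n then c * of_real (\<integral>z. v k z * (cmod z powr p) ^ nat n \<partial>lborel) else 0)" for k m
  proof (cases "int m = n")
    case True
    have "h k z * cnj (chi p z) ^ m = complex_of_real (v k z) * (z * cnj (chi p z)) ^ m" for z
      unfolding h_def True[symmetric] power_int_of_nat power_mult_distrib by (simp only: mult.assoc)
    then have "h k z * cnj (chi p z) ^ m = complex_of_real (v k z * (cmod z powr p) ^ nat n)" for z
      unfolding zchi True[symmetric] by simp
    then have "(\<integral>z. h k z * cnj (chi p z) ^ m \<partial>lborel) = complex_of_real (\<integral>z. v k z * (cmod z powr p) ^ nat n \<partial>lborel)"
      by (simp only: integral_complex_of_real)
    then show ?thesis
      using True by (auto simp: c_def)
  next
    case False
    \<comment> \<open>The integrand has rotation degree \<open>n - m\<close>, so rotating by this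
      angle changes its sign.\<close>
    define a where "a = pi / of_int (n - int m)"
    have "(\<integral>z. h k z * cnj (chi p z) ^ m \<partial>lborel) = 0"
    proof (rule lborel_integral_equivariant_eq_0[where w = "cis a" and c = "-1"])
      fix z
      have "real_of_int (n - int m) \<noteq> 0"
        using False by simp
      then have "real_of_int (n - int m) * a = pi"
        unfolding a_def by simp
      then have "of_int n * a + of_nat m * (- a) = pi"
        by (simp add: left_diff_distrib)
      then have w: "cis a powi n * cnj (cis a) ^ m = -1"
        unfolding cis_cnj cis_power_int Complex.DeMoivre cis_mult by simp
      have v: "v k (cis a * z) = v k z"
        using rotate_mem_iff[OF norm_cis, of a z] by (simp add: v_def indicator_def norm_mult)
      have "h k (cis a * z) * cnj (chi p (cis a * z)) ^ m =
          (cis a powi n * cnj (cis a) ^ m) * (complex_of_real (v k (cis a * z)) * z powi n * cnj (chi p z) ^ m)"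
        unfolding h_def chi_rotate[OF norm_cis] complex_cnj_mult power_int_mult_distrib power_mult_distrib
        by (simp only: mult_ac)
      then show "h k (cis a * z) * cnj (chi p (cis a * z)) ^ m = -1 * (h k z * cnj (chi p z) ^ m)"
        unfolding w v h_def[of k z] .
    qed (rule hm, simp_all)
    then show ?thesis
      using False by simp
  qed
  have eq: "(\<integral>z. v k z *\<^sub>R (z powi n * cnj (g (chi p z))) \<partial>lborel) = c * of_real (\<integral>z. v k z * (cmod z powr p) ^ nat n \<partial>lborel)" for k
  proof -
    define \<rho> where "\<rho> = rad k powr (p - 1)"
    have \<rho>: "0 \<le> \<rho>" "\<rho> < 1"
      using rad_bounds[of k] p powr_less_mono2[of "p - 1" "rad k" 1] by (auto simp: \<rho>_def)
    \<comment> \<open>A nonzero point of modulus strictly between \<open>\<rho>\<close> and 1: it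
      lies in \<open>U\<close> for both domains, and convergence there gives absolute convergence at
      \<open>\<rho>\<close>.\<close>
    define w where "w = complex_of_real ((\<rho> + 1) / 2)"
    have w: "cmod w = (\<rho> + 1) / 2" "w \<noteq> 0"
      using \<rho> unfolding w_def by (auto simp del: of_real_add of_real_divide)
    have "w \<in> U"
      using U w \<rho> by auto
    have "summable (\<lambda>m. norm (b m * complex_of_real \<rho> ^ m))"
      by (rule powser_insidea[OF sums_summable[OF b[OF \<open>w \<in> U\<close>]]]) (use w \<rho> in simp)
    then have sm: "summable (\<lambda>m. cmod (cnj (b m)) * \<rho> ^ m)"
      using \<rho> by (simp add: norm_mult norm_power)
    have "(\<lambda>m. cnj (b m) * (\<integral>z. h k z * cnj (chi p z) ^ m \<partial>lborel)) sums (\<integral>z. h k z * (\<Sum>m. cnj (b m) * cnj (chi p z) ^ m) \<partial>lborel)"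
    proof (rule sums_integral_power_series(1)[OF hi _ _ \<rho>(1) sm])
      fix z assume "h k z \<noteq> 0"
      then have "cmod z < rad k" by (auto simp: h_def v_def indicator_def split: if_splits)
      then show "cmod (cnj (chi p z)) \<le> \<rho>"
        using p by (auto simp: norm_chi \<rho>_def intro: powr_mono2)
    qed measurable
    moreover have "(\<lambda>m. cnj (b m) * (\<integral>z. h k z * cnj (chi p z) ^ m \<partial>lborel)) sums (c * of_real (\<integral>z. v k z * (cmod z powr p) ^ nat n \<partial>lborel))"
    proof (cases "n < 0")
      case True
      then show ?thesis
        unfolding terms by (auto simp: c_def)
    next
      case False
      then have "int m = n \<longleftrightarrow> m = nat n" for m by auto
      then show ?thesis
        unfolding terms using sums_single[of "nat n" "\<lambda>_. c * of_real (\<integral>z. v k z * (cmod z powr p) ^ nat n \<partial>lborel)"]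
        by simp
    qed
    ultimately have "(\<integral>z. h k z * (\<Sum>m. cnj (b m) * cnj (chi p z) ^ m) \<partial>lborel) = c * of_real (\<integral>z. v k z * (cmod z powr p) ^ nat n \<partial>lborel)"
      by (rule sums_unique2)
    moreover have "h k z * (\<Sum>m. cnj (b m) * cnj (chi p z) ^ m) = v k z *\<^sub>R (z powi n * cnj (g (chi p z)))" for z
    proof (cases "z \<in> U")
      case True
      then have "(\<lambda>m. cnj (b m * chi p z ^ m)) sums cnj (g (chi p z))"
        using b chi_mem_iff by (simp only: sums_cnj)
      then show ?thesis
        by (simp add: h_def sums_unique[symmetric] scaleR_conv_of_real)
    qed (simp add: h_def v_def)
    ultimately show ?thesis by simp
  qed
  \<comment> \<open>Dominated convergence now removes the cut-off on both sides of
    \<open>eq\<close>.\<close>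
  have "(\<lambda>k. \<integral>z. v k z *\<^sub>R (z powi n * cnj (g (chi p z))) \<partial>lborel) \<longlonglongrightarrow> pairing p U (\<lambda>z. z powi n) g"
    unfolding pairing_def set_lebesgue_integral_def
  proof (rule integral_dominated_convergence)
    have i: "integrable lborel (\<lambda>z. indicator U z *\<^sub>R (z powi n * cnj (g (chi p z))))"
      using pairing_bound(1)[OF f g] by (simp add: set_integrable_def)
    then show "integrable lborel (\<lambda>z. cmod (indicator U z *\<^sub>R (z powi n * cnj (g (chi p z)))))"
      by (rule integrable_norm)
    show "(\<lambda>z. indicator U z *\<^sub>R (z powi n * cnj (g (chi p z)))) \<in> borel_measurable lborel"
      using i by (rule borel_measurable_integrable)
    have "(\<lambda>z. v k z *\<^sub>R (z powi n * cnj (g (chi p z)))) = (\<lambda>z. v k z *\<^sub>R (indicator U z *\<^sub>R (z powi n * cnj (g (chi p z)))))" for k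
      by (auto simp: v_def indicator_def)
    moreover have "(\<lambda>z. v k z *\<^sub>R (indicator U z *\<^sub>R (z powi n * cnj (g (chi p z))))) \<in> borel_measurable lborel" for k
      by (intro borel_measurable_scaleR borel_measurable_integrable[OF i]) simp
    ultimately show "(\<lambda>z. v k z *\<^sub>R (z powi n * cnj (g (chi p z)))) \<in> borel_measurable lborel" for k
      by (simp only:)
    show "AE z in lborel. (\<lambda>k. v k z *\<^sub>R (z powi n * cnj (g (chi p z)))) \<longlonglongrightarrow> indicator U z *\<^sub>R (z powi n * cnj (g (chi p z)))"
      by (intro AE_I2 tendsto_scaleR v_lim tendsto_const)
    show "AE z in lborel. cmod (v k z *\<^sub>R (z powi n * cnj (g (chi p z)))) \<le> cmod (indicator U z *\<^sub>R (z powi n * cnj (g (chi p z))))" for k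
      by (intro AE_I2) (auto simp: v_def indicator_def)
  qed
  moreover have "(\<lambda>k. \<integral>z. v k z * (cmod z powr p) ^ nat n \<partial>lborel) \<longlonglongrightarrow> (\<integral>z. indicator U z * (cmod z powr p) ^ nat n \<partial>lborel)"
  proof (rule integral_dominated_convergence)
    show "integrable lborel (indicator (ball (0::complex) 1) :: complex \<Rightarrow> real)"
      by (simp add: integrable_indicator_iff emeasure_disc)
    show "AE z in lborel. (\<lambda>k. v k z * (cmod z powr p) ^ nat n) \<longlonglongrightarrow> indicator U z * (cmod z powr p) ^ nat n"
      by (intro AE_I2 tendsto_mult v_lim tendsto_const)
    show "AE z in lborel. norm (v k z * (cmod z powr p) ^ nat n) \<le> indicator (ball 0 1) z" for k
      using U_subset p by (intro AE_I2) (auto simp: v_def indicator_def intro!: power_le_one powr_le1)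
  qed measurable
  then have "(\<lambda>k. \<integral>z. v k z *\<^sub>R (z powi n * cnj (g (chi p z))) \<partial>lborel) \<longlonglongrightarrow> c * of_real (\<integral>z. indicator U z * (cmod z powr p) ^ nat n \<partial>lborel)"
    unfolding eq by (intro tendsto_intros)
  ultimately have "pairing p U (\<lambda>z. z powi n) g = c * of_real (\<integral>z. indicator U z * (cmod z powr p) ^ nat n \<partial>lborel)"
    by (rule LIMSEQ_unique)
  then show ?thesis
    by (simp add: c_def)
qed

end

end

section \<open>Functionals, power series and density of dilates\<close>

lemma nn_integral_complex_scale:
  fixes G :: "complex \<Rightarrow> ennreal"
  assumes [measurable]: "G \<in> borel_measurable borel" and r: "0 < r"
  shows "(\<integral>\<^sup>+z. G (complex_of_real r * z) \<partial>lborel) = ennreal (1 / r\<^sup>2) * (\<integral>\<^sup>+z. G z \<partial>lborel)"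
proof -
  have "(\<integral>\<^sup>+z. G z \<partial>lborel) = (\<integral>\<^sup>+z. G z \<partial>density (distr lborel borel (\<lambda>x. 0 + r *\<^sub>R x)) (\<lambda>_. ennreal (\<bar>r\<bar> ^ DIM(complex))))"
    using lborel_affine[of r "0::complex"] r by simp
  also have "\<dots> = ennreal (r\<^sup>2) * (\<integral>\<^sup>+z. G (complex_of_real r * z) \<partial>lborel)"
    using r by (simp add: nn_integral_density nn_integral_distr nn_integral_cmult scaleR_conv_of_real)
  finally show ?thesis
    using r by (simp add: mult.assoc[symmetric] ennreal_mult[symmetric])
qed

text \<open>Writes \<open>np + 2\<close> as \<open>p (n + 1) + (2 - p)\<close>.\<close>

lemma arith_geometric_sums:
  fixes t :: "'a :: {real_normed_field, banach}"
  assumes "norm t < 1"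
  shows "(\<lambda>n. of_real (real n * p + 2) * t ^ n) sums (of_real p / (1 - t)\<^sup>2 + of_real (2 - p) / (1 - t))"
proof -
  have "(\<lambda>n. of_real p * (of_nat (Suc n) * t ^ n) + of_real (2 - p) * t ^ n)
      sums (of_real p * (1 / (1 - t)\<^sup>2) + of_real (2 - p) * (1 / (1 - t)))"
    using assms by (intro sums_add sums_mult geometric_deriv_sums geometric_sums)
  moreover have "of_real p * (of_nat (Suc n) * t ^ n) + of_real (2 - p) * t ^ n = of_real (real n * p + 2) * t ^ n" for n
    by (simp add: algebra_simps)
  ultimately show ?thesis by simp
qed

text \<open>The reciprocal of the integral of \<open>|z|^(np)\<close> over the disc, which is the
  pairing of \<open>z^n\<close> with itself.\<close>

definition ker_coeff :: "real \<Rightarrow> nat \<Rightarrow> real" where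
  "ker_coeff p n = (real n * p + 2) / (2 * pi)"

text \<open>Arises from \<open>|p + (2 - p)(1 - t)| \<le> p + 2 |2 - p|\<close> for
  \<open>|t| < 1\<close>.\<close>

definition ker_const :: "real \<Rightarrow> real" where
  "ker_const p = (p + 2 * \<bar>2 - p\<bar>) / (2 * pi)"

lemma ker_coeff_pos: "0 \<le> p \<Longrightarrow> 0 < ker_coeff p n"
  by (simp add: ker_coeff_def add_nonneg_pos)

lemma ker_const_pos: "0 < p \<Longrightarrow> 0 < ker_const p"
  by (simp add: ker_const_def add_pos_nonneg)

lemma ker_coeff_sums:
  fixes t :: "'a :: {real_normed_field, banach}"
  assumes "norm t < 1"
  shows "(\<lambda>n. of_real (ker_coeff p n) * t ^ n) sums ((of_real p / (1 - t)\<^sup>2 + of_real (2 - p) / (1 - t)) / of_real (2 * pi))"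
  using sums_divide[OF arith_geometric_sums[OF assms, of p], of "of_real (2 * pi)"] by (simp add: ker_coeff_def)

lemma norm_ker_le:
  fixes t :: complex
  assumes t: "cmod t < 1" and p: "0 < p"
  shows "cmod (\<Sum>n. of_real (ker_coeff p n) * t ^ n) \<le> ker_const p / (cmod (1 - t))\<^sup>2"
proof -
  have t1: "t \<noteq> 1" using t by auto
  have "(\<Sum>n. of_real (ker_coeff p n) * t ^ n) = (of_real p / (1 - t)\<^sup>2 + of_real (2 - p) / (1 - t)) / of_real (2 * pi)"
    using ker_coeff_sums[OF t] by (rule sums_unique[symmetric])
  also have "\<dots> = (of_real p + of_real (2 - p) * (1 - t)) / (1 - t)\<^sup>2 / of_real (2 * pi)"
    using t1 by (simp add: power2_eq_square add_divide_distrib)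
  finally have "cmod (\<Sum>n. of_real (ker_coeff p n) * t ^ n) = cmod (of_real p + of_real (2 - p) * (1 - t)) / (cmod (1 - t))\<^sup>2 / (2 * pi)"
    by (simp add: norm_divide norm_power norm_mult del: of_real_diff)
  also have "\<dots> \<le> (p + 2 * \<bar>2 - p\<bar>) / (cmod (1 - t))\<^sup>2 / (2 * pi)"
  proof (intro divide_right_mono)
    have "cmod (1 - t) \<le> 2"
      using norm_triangle_ineq4[of 1 t] t by simp
    then have "\<bar>2 - p\<bar> * cmod (1 - t) \<le> \<bar>2 - p\<bar> * 2"
      by (intro mult_left_mono) auto
    then show "cmod (of_real p + of_real (2 - p) * (1 - t)) \<le> p + 2 * \<bar>2 - p\<bar>"
      using norm_triangle_ineq[of "of_real p" "of_real (2 - p) * (1 - t)"] p by (simp add: norm_mult del: of_real_diff)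
  qed auto
  finally show ?thesis
    by (simp add: ker_const_def mult.commute)
qed

lemma summable_ker_coeff:
  fixes a :: "nat \<Rightarrow> complex"
  assumes \<rho>: "0 \<le> \<rho>" "\<rho> < 1" and a: "\<And>n. cmod (a n) \<le> B * ker_coeff p n"
  shows "summable (\<lambda>n. cmod (a n) * \<rho> ^ n)"
proof (rule summable_comparison_test)
  show "summable (\<lambda>n. B * (ker_coeff p n * \<rho> ^ n))"
    using ker_coeff_sums[of \<rho> p] \<rho> by (intro summable_mult) (auto simp: sums_iff)
  have "cmod (a n) * \<rho> ^ n \<le> B * (ker_coeff p n * \<rho> ^ n)" for n
    using mult_right_mono[OF a[of n], of "\<rho> ^ n"] \<rho> by (simp add: mult.assoc)
  then show "\<exists>N. \<forall>n\<ge>N. norm (cmod (a n) * \<rho> ^ n) \<le> B * (ker_coeff p n * \<rho> ^ n)"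
    using \<rho> by auto
qed

lemma rad_Suc_pos: "0 < rad (Suc k)"
  by (simp add: rad_def inverse_less_1_iff)

section \<open>Evaluating functionals on power series and dilates\<close>

context conjugate_exponents
begin

abbreviation (input) disc :: "complex set" where "disc \<equiv> ball 0 1"

abbreviation Ap :: "(complex \<Rightarrow> complex) set" where "Ap \<equiv> Aspace p disc (\<lambda>_. 1)"
abbreviation Aq :: "(complex \<Rightarrow> complex) set" where "Aq \<equiv> Aspace q disc (eta q)"
abbreviation Np :: "(complex \<Rightarrow> complex) \<Rightarrow> real" where "Np \<equiv> Anorm p disc (\<lambda>_. 1)"
abbreviation Nq :: "(complex \<Rightarrow> complex) \<Rightarrow> real" where "Nq \<equiv> Anorm q disc (eta q)"

lemma disc_disj: "disc = ball 0 1 \<or> disc = ball 0 1 - {0}"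
  by simp

lemma bounded_mem_Ap:
  assumes F: "F holomorphic_on disc" "\<And>z. cmod z < 1 \<Longrightarrow> cmod (F z) \<le> B" and B: "0 \<le> B"
  shows "F \<in> Ap" "Np F \<le> pi powr (1 / p) * B"
proof -
  have "Aint p disc (\<lambda>_. 1) F \<le> (\<integral>\<^sup>+z. ennreal (B powr p) * indicator disc z \<partial>lborel)"
    unfolding Aint_def using F(2) p
    by (intro nn_integral_mono) (auto simp: indicator_def intro!: ennreal_leI powr_mono2)
  also have "\<dots> = ennreal (B powr p) * ennreal pi"
    by (simp add: nn_integral_cmult emeasure_disc)
  also have "\<dots> = ennreal ((pi powr (1 / p) * B) powr p)"
    using p B by (simp add: powr_mult powr_powr ennreal_mult[symmetric] mult.commute)
  finally have le: "Aint p disc (\<lambda>_. 1) F \<le> ennreal ((pi powr (1 / p) * B) powr p)" .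
  show "F \<in> Ap" "Np F \<le> pi powr (1 / p) * B"
    using p B by (intro Anorm_le[OF F(1) _ _ _ _ le]; simp)+
qed

lemma power_mem_Ap: "(\<lambda>z. z ^ n) \<in> Ap" "Np (\<lambda>z. z ^ n) \<le> pi powr (1 / p)"
proof -
  have "(\<lambda>z. z ^ n) holomorphic_on disc"
    by (intro holomorphic_intros)
  then show "(\<lambda>z. z ^ n) \<in> Ap" "Np (\<lambda>z. z ^ n) \<le> pi powr (1 / p)"
    using bounded_mem_Ap[of "\<lambda>z. z ^ n" 1] by (auto simp: norm_power power_le_one)
qed

text \<open>Summable coefficients make the partial sums converge uniformly on the whole disc, hence
  in norm as the area is finite; \<open>L\<close> can then be applied term by term.\<close>

lemma functional_power_series:
  assumes L: "bounded_functional p disc L M" and M: "0 \<le> M" and c: "summable (\<lambda>n. cmod (c n))"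
  shows "(\<lambda>z. \<Sum>n. c n * z ^ n) \<in> Ap"
    and "(\<lambda>n. c n * L (\<lambda>z. z ^ n)) sums L (\<lambda>z. \<Sum>n. c n * z ^ n)"
proof -
  define F where "F z = (\<Sum>n. c n * z ^ n)" for z
  define S where "S N z = (\<Sum>n<N. c n * z ^ n)" for N z
  have bd: "cmod (c n * z ^ n) \<le> cmod (c n)" if "cmod z < 1" for n z
    using that by (simp add: norm_mult norm_power mult_left_le power_le_one)
  have sm: "summable (\<lambda>n. cmod (c n * z ^ n))" if "cmod z < 1" for z
    by (rule summable_comparison_test[OF _ c]) (use bd[OF that] in auto)
  have sums: "(\<lambda>n. c n * z ^ n) sums F z" if "cmod z < 1" for z
    unfolding F_def using summable_norm_cancel[OF sm[OF that]] by (rule summable_sums)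
  have hol: "F holomorphic_on disc"
    by (rule power_series_holomorphic[of 0 1 c]) (use sums in auto)
  have Fb: "cmod (F z) \<le> (\<Sum>n. cmod (c n))" if "cmod z < 1" for z
    unfolding F_def using summable_norm[OF sm[OF that]] suminf_le[OF bd[OF that] sm[OF that] c] by simp
  have F_Ap: "F \<in> Ap"
    using hol Fb suminf_nonneg[OF c] by (intro bounded_mem_Ap(1)) auto
  then show "(\<lambda>z. \<Sum>n. c n * z ^ n) \<in> Ap"
    by (simp add: F_def[abs_def])
  have S_Ap: "S N \<in> Ap" for N
  proof -
    have "cmod (S N z) \<le> (\<Sum>n<N. cmod (c n))" if "cmod z < 1" for z
      unfolding S_def by (rule order_trans[OF norm_sum sum_mono]) (rule bd[OF that])
    moreover have "S N holomorphic_on disc"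
      unfolding S_def by (intro holomorphic_intros)
    ultimately show ?thesis
      by (intro bounded_mem_Ap(1)) (auto intro: sum_nonneg)
  qed
  have LS: "L (S N) = (\<Sum>n<N. c n * L (\<lambda>z. z ^ n))" for N
  proof (induction N)
    case 0
    have "L (S 0) = L (\<lambda>z. 0 * S 0 z + 0 * S 0 z)"
      by (simp add: S_def[abs_def])
    also have "\<dots> = 0"
      by (subst bounded_functionalD(1)[OF L S_Ap S_Ap]) simp
    finally show ?case by simp
  next
    case (Suc N)
    have "S (Suc N) = (\<lambda>z. 1 * S N z + c N * z ^ N)"
      by (auto simp: S_def)
    then have "L (S (Suc N)) = 1 * L (S N) + c N * L (\<lambda>z. z ^ N)"
      by (simp only: bounded_functionalD(1)[OF L S_Ap power_mem_Ap(1)])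
    then show ?case
      using Suc by simp
  qed
  have "(\<lambda>N. L (S N) - L F) \<longlonglongrightarrow> 0"
  proof (rule Lim_null_comparison)
    have tail: "cmod (S N z - F z) \<le> (\<Sum>n. cmod (c (n + N)))" if "cmod z < 1" for N z
    proof -
      have "F z - S N z = (\<Sum>n. c (n + N) * z ^ (n + N))"
        unfolding F_def S_def using suminf_minus_initial_segment[OF sums_summable[OF sums[OF that]], of N] by simp
      also have "cmod \<dots> \<le> (\<Sum>n. cmod (c (n + N) * z ^ (n + N)))"
        by (rule summable_norm[OF summable_ignore_initial_segment[OF sm[OF that], of N]])
      also have "\<dots> \<le> (\<Sum>n. cmod (c (n + N)))"
        by (rule suminf_le[OF bd[OF that] summable_ignore_initial_segment[OF sm[OF that]] summable_ignore_initial_segment[OF c]])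
      finally show ?thesis by (simp add: norm_minus_commute)
    qed
    have "cmod (L (S N) - L F) \<le> M * (pi powr (1 / p) * (\<Sum>n. cmod (c (n + N))))" for N
    proof -
      have "cmod (L (S N) - L F) \<le> M * Np (\<lambda>z. S N z - F z)"
        using p by (intro bounded_functional_diff(2)[OF L S_Ap F_Ap]) auto
      also have "\<dots> \<le> M * (pi powr (1 / p) * (\<Sum>n. cmod (c (n + N))))"
      proof (intro mult_left_mono M bounded_mem_Ap(2) tail)
        show "(\<lambda>z. S N z - F z) holomorphic_on disc"
          unfolding S_def by (intro holomorphic_intros hol)
        show "0 \<le> (\<Sum>n. cmod (c (n + N)))"
          by (rule suminf_nonneg[OF summable_ignore_initial_segment[OF c]]) simp
      qed
      finally show ?thesis .
    qed
    then show "\<forall>\<^sub>F N in sequentially. norm (L (S N) - L F) \<le> M * (pi powr (1 / p) * (\<Sum>n. cmod (c (n + N))))"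
      by simp
    have "(\<lambda>N. \<Sum>n. cmod (c (n + N))) \<longlonglongrightarrow> 0"
      using suminf_exist_split2[OF c] .
    then show "(\<lambda>N. M * (pi powr (1 / p) * (\<Sum>n. cmod (c (n + N))))) \<longlonglongrightarrow> 0"
      by (intro tendsto_mult_right_zero)
  qed
  then have "(\<lambda>N. L (S N)) \<longlonglongrightarrow> L F"
    by (simp add: LIM_zero_iff)
  then show "(\<lambda>n. c n * L (\<lambda>z. z ^ n)) sums L (\<lambda>z. \<Sum>n. c n * z ^ n)"
    unfolding sums_def LS by (simp add: F_def[abs_def])
qed

text \<open>Fatou's lemma applied to \<open>2\<^sup>p (|f|\<^sup>p + |f\<^sub>r|\<^sup>p) - |f - f\<^sub>r|\<^sup>p\<close>, where \<open>f\<^sub>r(z) = f(rz)\<close>.\<close>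

lemma dilation_approx:
  assumes f: "f \<in> Ap" and e: "0 < e"
  shows "\<exists>k. Aint p disc (\<lambda>_. 1) (\<lambda>z. f z - f (complex_of_real (rad (Suc k)) * z)) < ennreal e"
proof (rule ccontr)
  define r where "r k = rad (Suc k)" for k
  have r: "0 < r k" "r k < 1" for k
    using rad_bounds[of "Suc k"] rad_Suc_pos[of k] by (auto simp: r_def)
  have r_lim: "r \<longlonglongrightarrow> 1"
    unfolding r_def using LIMSEQ_Suc[OF rad_tendsto] .
  \<comment> \<open>If every dilate stays at distance at least \<open>e\<close> (in
    \<open>p\<close>-th powers), the integrals of \<open>u k\<close> stay \<open>e\<close> below the
    limit that Fatou's lemma forces.\<close>
  assume neg: "\<not> ?thesis"
  have hol: "f holomorphic_on disc" and fin: "Aint p disc (\<lambda>_. 1) f < \<infinity>"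
    using f by (auto simp: Aspace_iff)
  define F where "F z = indicator disc z *\<^sub>R f z" for z
  define G where "G k z = indicator disc z *\<^sub>R f (complex_of_real (r k) * z)" for k z
  have [measurable]: "F \<in> borel_measurable borel"
    unfolding F_def by (rule borel_measurable_holomorphic_indicator[OF hol]) simp
  have rz: "complex_of_real (r k) * z \<in> disc" if "z \<in> disc" for k z
  proof -
    have "r k * cmod z \<le> 1 * cmod z"
      using r[of k] by (intro mult_right_mono) auto
    then show ?thesis using that r[of k] by (simp add: norm_mult)
  qed
  have G_eq: "G k z = indicator disc z *\<^sub>R F (complex_of_real (r k) * z)" for k z
    using rz[of z k] by (auto simp: G_def F_def indicator_def)
  have [measurable]: "G k \<in> borel_measurable borel" for k
    unfolding G_eq by measurable
  have G_lim: "(\<lambda>k. G k z) \<longlonglongrightarrow> F z" for z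
  proof (cases "z \<in> disc")
    case True
    have "isCont f z"
      using holomorphic_on_imp_continuous_on[OF hol] True by (simp add: continuous_on_eq_continuous_at)
    moreover have "(\<lambda>k. complex_of_real (r k) * z) \<longlonglongrightarrow> complex_of_real 1 * z"
      by (intro tendsto_intros r_lim)
    ultimately have "(\<lambda>k. f (complex_of_real (r k) * z)) \<longlonglongrightarrow> f z"
      by (intro isCont_tendsto_compose[of z f]) auto
    then show ?thesis
      using True by (simp add: G_def F_def)
  qed (simp add: G_def F_def)
  define u where "u k z = 2 powr p * (cmod (F z) powr p + cmod (G k z) powr p) - cmod (F z - G k z) powr p" for k z
  have u0: "0 \<le> u k z" for k z
  proof -
    have "cmod (F z - G k z) powr p \<le> (cmod (F z) + cmod (G k z)) powr p"
      using p norm_triangle_ineq4[of "F z" "G k z"] by (intro powr_mono2) auto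
    also have "\<dots> \<le> 2 powr p * (cmod (F z) powr p + cmod (G k z) powr p)"
      using p by (intro powr_add_le) auto
    finally show ?thesis by (simp add: u_def)
  qed
  have [measurable]: "u k \<in> borel_measurable borel" for k
    unfolding u_def by measurable
  define i where "i = enn2real (\<integral>\<^sup>+z. ennreal (cmod (F z) powr p) \<partial>lborel)"
  have FA: "(\<integral>\<^sup>+z. ennreal (cmod (F z) powr p) \<partial>lborel) = Aint p disc (\<lambda>_. 1) f"
    unfolding Aint_def using p by (intro nn_integral_cong) (auto simp: F_def indicator_def)
  then have I: "(\<integral>\<^sup>+z. ennreal (cmod (F z) powr p) \<partial>lborel) = ennreal i" and i0: "0 \<le> i"
    using fin by (auto simp: i_def)
  have IG: "(\<integral>\<^sup>+z. ennreal (cmod (G k z) powr p) \<partial>lborel) \<le> ennreal (1 / (r k)\<^sup>2 * i)" for k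
  proof -
    have "(\<integral>\<^sup>+z. ennreal (cmod (G k z) powr p) \<partial>lborel) \<le> (\<integral>\<^sup>+z. ennreal (cmod (F (complex_of_real (r k) * z)) powr p) \<partial>lborel)"
      using p by (intro nn_integral_mono) (auto simp: G_eq indicator_def)
    also have "\<dots> = ennreal (1 / (r k)\<^sup>2) * ennreal i"
      using nn_integral_complex_scale[of "\<lambda>z. ennreal (cmod (F z) powr p)" "r k"] r[of k] by (simp add: I)
    finally show ?thesis
      using i0 by (simp add: ennreal_mult[symmetric])
  qed
  \<comment> \<open>Bounds the integral of \<open>2^p (|F|^p + |G k|^p)\<close>; the factor
    \<open>1/r^2\<close> comes from rescaling the plane.\<close>
  define y where "y k = 2 powr p * (i + 1 / (r k)\<^sup>2 * i)" for k
  \<comment> \<open>The second fact is kept because \<open>ennreal\<close> sends negative reals to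
    0, which would spoil the final comparison.\<close>
  have ub: "(\<integral>\<^sup>+z. ennreal (u k z) \<partial>lborel) \<le> ennreal (y k - e)" "e \<le> y k" for k
  proof -
    have "ennreal e \<le> Aint p disc (\<lambda>_. 1) (\<lambda>z. f z - f (complex_of_real (r k) * z))"
      using neg by (auto simp: r_def not_less)
    also have "\<dots> = (\<integral>\<^sup>+z. ennreal (cmod (F z - G k z) powr p) \<partial>lborel)"
      unfolding Aint_def using p by (intro nn_integral_cong) (auto simp: F_def G_def indicator_def)
    finally have "(\<integral>\<^sup>+z. ennreal (u k z) \<partial>lborel) + ennreal e
        \<le> (\<integral>\<^sup>+z. ennreal (u k z) \<partial>lborel) + (\<integral>\<^sup>+z. ennreal (cmod (F z - G k z) powr p) \<partial>lborel)"
      by (intro add_left_mono)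
    also have "\<dots> = (\<integral>\<^sup>+z. ennreal (u k z) + ennreal (cmod (F z - G k z) powr p) \<partial>lborel)"
      by (rule nn_integral_add[symmetric]) measurable
    also have "\<dots> = (\<integral>\<^sup>+z. ennreal (2 powr p) * (ennreal (cmod (F z) powr p) + ennreal (cmod (G k z) powr p)) \<partial>lborel)"
    proof (intro nn_integral_cong)
      fix z
      have "ennreal (u k z) + ennreal (cmod (F z - G k z) powr p) = ennreal (u k z + cmod (F z - G k z) powr p)"
        using u0 by simp
      also have "u k z + cmod (F z - G k z) powr p = 2 powr p * (cmod (F z) powr p + cmod (G k z) powr p)"
        by (simp add: u_def)
      finally show "ennreal (u k z) + ennreal (cmod (F z - G k z) powr p) = ennreal (2 powr p) * (ennreal (cmod (F z) powr p) + ennreal (cmod (G k z) powr p))"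
        by (simp add: ennreal_mult)
    qed
    also have "\<dots> = ennreal (2 powr p) * (ennreal i + (\<integral>\<^sup>+z. ennreal (cmod (G k z) powr p) \<partial>lborel))"
      by (simp add: nn_integral_cmult nn_integral_add I)
    also have "\<dots> \<le> ennreal (2 powr p) * (ennreal i + ennreal (1 / (r k)\<^sup>2 * i))"
      by (intro mult_left_mono add_left_mono IG) auto
    also have "\<dots> = ennreal (y k)"
      using i0 by (simp add: y_def ennreal_mult[symmetric] ennreal_plus[symmetric] del: ennreal_plus)
    finally have le: "(\<integral>\<^sup>+z. ennreal (u k z) \<partial>lborel) + ennreal e \<le> ennreal (y k)" .
    then have "(\<integral>\<^sup>+z. ennreal (u k z) \<partial>lborel) < \<infinity>"
      by (auto simp: order_le_less_trans[OF le] top.not_eq_extremum[symmetric] top_unique)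
    then obtain x where x: "0 \<le> x" "(\<integral>\<^sup>+z. ennreal (u k z) \<partial>lborel) = ennreal x"
      by (cases "\<integral>\<^sup>+z. ennreal (u k z) \<partial>lborel") auto
    have y0: "0 \<le> y k"
      using i0 by (simp add: y_def)
    have "ennreal (x + e) \<le> ennreal (y k)"
      using le x e by simp
    then have "x + e \<le> y k"
      using y0 by (simp add: ennreal_le_iff)
    then show "(\<integral>\<^sup>+z. ennreal (u k z) \<partial>lborel) \<le> ennreal (y k - e)" "e \<le> y k"
      using x by (auto intro: ennreal_leI)
  qed
  have y_lim: "y \<longlonglongrightarrow> 2 powr p * (i + 1 / 1\<^sup>2 * i)"
    unfolding y_def by (intro tendsto_intros r_lim) auto
  have "ennreal (2 powr p * (i + i)) = (\<integral>\<^sup>+z. ennreal (2 powr p * 2) * ennreal (cmod (F z) powr p) \<partial>lborel)"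
    by (subst nn_integral_cmult) (use i0 in \<open>simp_all add: I ennreal_mult[symmetric]\<close>)
  also have "\<dots> = (\<integral>\<^sup>+z. liminf (\<lambda>k. ennreal (u k z)) \<partial>lborel)"
  proof (intro nn_integral_cong)
    fix z
    have "(\<lambda>k. u k z) \<longlonglongrightarrow> 2 powr p * (cmod (F z) powr p + cmod (F z) powr p) - cmod (F z - F z) powr p"
      unfolding u_def using p by (intro tendsto_intros G_lim) auto
    then have "(\<lambda>k. ennreal (u k z)) \<longlonglongrightarrow> ennreal (2 powr p * 2 * cmod (F z) powr p)"
      using p by (intro tendsto_ennrealI) (simp add: mult.assoc)
    then have "liminf (\<lambda>k. ennreal (u k z)) = ennreal (2 powr p * 2 * cmod (F z) powr p)"
      by (intro lim_imp_Liminf) auto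
    then show "ennreal (2 powr p * 2) * ennreal (cmod (F z) powr p) = liminf (\<lambda>k. ennreal (u k z))"
      by (simp add: ennreal_mult)
  qed
  also have "\<dots> \<le> liminf (\<lambda>k. \<integral>\<^sup>+z. ennreal (u k z) \<partial>lborel)"
    by (rule nn_integral_liminf) measurable
  also have "\<dots> \<le> liminf (\<lambda>k. ennreal (y k - e))"
    by (intro Liminf_mono always_eventually allI ub(1))
  also have "\<dots> = ennreal (2 powr p * (i + 1 / 1\<^sup>2 * i) - e)"
    by (intro lim_imp_Liminf tendsto_ennrealI tendsto_intros y_lim) auto
  finally have "ennreal (2 powr p * (i + i)) \<le> ennreal (2 powr p * (i + i) - e)"
    by simp
  moreover have "e \<le> 2 powr p * (i + i)"
    using LIMSEQ_le_const[OF y_lim, of e] ub(2) by auto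
  ultimately show False
    using e by (simp add: ennreal_le_iff)
qed

text \<open>The Taylor coefficients of a dilate of \<open>f\<close> are absolutely summable, so the
  two functionals agree on dilates; these approximate \<open>f\<close> in norm.\<close>

lemma bounded_functional_eqI:
  assumes L1: "bounded_functional p disc L1 M1" "0 \<le> M1" and L2: "bounded_functional p disc L2 M2" "0 \<le> M2"
    and eq: "\<And>n. L1 (\<lambda>z. z ^ n) = L2 (\<lambda>z. z ^ n)" and f: "f \<in> Ap"
  shows "L1 f = L2 f"
proof -
  have hol: "f holomorphic_on disc" using f by (simp add: Aspace_iff)
  define a where "a n = (deriv ^^ n) f 0 / fact n" for n
  have a: "(\<lambda>n. a n * z ^ n) sums f z" if "cmod z < 1" for z
    using holomorphic_power_series[OF hol, of z] that by (simp add: a_def)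
  have small: "cmod (L1 f - L2 f) \<le> (M1 + M2) * e" if e: "0 < e" for e
  proof -
    obtain k where k: "Aint p disc (\<lambda>_. 1) (\<lambda>z. f z - f (complex_of_real (rad (Suc k)) * z)) < ennreal (e powr p)"
      using dilation_approx[OF f, of "e powr p"] e by auto
    define r where "r = rad (Suc k)"
    have r: "0 < r" "r < 1"
      using rad_bounds[of "Suc k"] rad_Suc_pos[of k] by (auto simp: r_def)
    define c where "c n = a n * complex_of_real r ^ n" for n
    define s where "s = complex_of_real ((r + 1) / 2)"
    have s: "cmod s = (r + 1) / 2"
      using r unfolding s_def by (simp del: of_real_add of_real_divide)
    have "summable (\<lambda>n. norm (a n * complex_of_real r ^ n))"
      by (rule powser_insidea[OF sums_summable[OF a[of s]]]) (use s r in auto)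
    then have c: "summable (\<lambda>n. cmod (c n))"
      by (simp add: c_def)
    define F where "F z = (\<Sum>n. c n * z ^ n)" for z
    have F_Ap: "F \<in> Ap"
      unfolding F_def[abs_def] by (rule functional_power_series(1)[OF L1 c])
    have "L1 F = L2 F"
      using functional_power_series(2)[OF L1 c] functional_power_series(2)[OF L2 c] sums_unique2
      unfolding eq F_def[abs_def] by blast
    have Fz: "F z = f (complex_of_real r * z)" if "cmod z < 1" for z
    proof -
      have "cmod (complex_of_real r * z) < 1"
      proof -
        have "r * cmod z \<le> 1 * cmod z" using r by (intro mult_right_mono) auto
        then show ?thesis using that r by (simp add: norm_mult)
      qed
      from a[OF this] show ?thesis
        by (simp add: F_def c_def sums_iff power_mult_distrib mult.assoc)
    qed
    have "Aint p disc (\<lambda>_. 1) (\<lambda>z. f z - F z) = Aint p disc (\<lambda>_. 1) (\<lambda>z. f z - f (complex_of_real r * z))"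
      by (intro Aint_cong) (simp add: Fz)
    with k have "Aint p disc (\<lambda>_. 1) (\<lambda>z. f z - F z) \<le> ennreal (e powr p)"
      by (simp add: r_def)
    then have N: "Np (\<lambda>z. f z - F z) \<le> e"
      using f F_Ap e p by (intro Anorm_le(2)) (auto simp: Aspace_iff intro!: holomorphic_intros)
    have "cmod (L1 f - L2 f) = cmod ((L1 f - L1 F) - (L2 f - L2 F))"
      using \<open>L1 F = L2 F\<close> by simp
    also have "\<dots> \<le> cmod (L1 f - L1 F) + cmod (L2 f - L2 F)"
      by (rule norm_triangle_ineq4)
    also have "\<dots> \<le> M1 * Np (\<lambda>z. f z - F z) + M2 * Np (\<lambda>z. f z - F z)"
      using p by (intro add_mono bounded_functional_diff(2)[OF L1(1) f F_Ap] bounded_functional_diff(2)[OF L2(1) f F_Ap]) auto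
    also have "\<dots> \<le> M1 * e + M2 * e"
      using L1 L2 N by (intro add_mono mult_left_mono) auto
    finally show ?thesis
      by (simp add: distrib_right)
  qed
  have "cmod (L1 f - L2 f) \<le> 0"
  proof (rule field_le_epsilon)
    fix e :: real assume e: "0 < e"
    \<comment> \<open>The summand 1 keeps the denominator positive when both bounds are 0.\<close>
    have "cmod (L1 f - L2 f) \<le> (M1 + M2) * (e / (M1 + M2 + 1))"
      using e L1 L2 by (intro small) auto
    also have "\<dots> \<le> e"
      using e L1 L2 by (simp add: field_simps)
    finally show "cmod (L1 f - L2 f) \<le> 0 + e" by simp
  qed
  then show ?thesis by simp
qed

end

section \<open>Representation of functionals on the disc\<close>

context conjugate_exponents
begin

text \<open>Bounds the kernel operator on \<open>L^p\<close>: \<open>ker_const p\<close> compares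
  the kernel with \<open>1/|1 - t|^2\<close>, and the Schur constant refers to \<open>p\<close>-th
  powers.\<close>

definition dual_const :: real where
  "dual_const = ker_const p * Schur_const p q powr (1 / p)"

lemma dual_const_nonneg: "0 \<le> dual_const"
  using p ker_const_pos[of p] by (simp add: dual_const_def)

lemma Schur_const_nonneg: "0 \<le> Schur_const p q"
  using p q_gt_1 FR_nonneg[of p "1 / q"] by (simp add: Schur_const_def)

context
  fixes L :: "(complex \<Rightarrow> complex) \<Rightarrow> complex" and M :: real
  assumes L: "bounded_functional p disc L M" and M: "0 \<le> M"
begin

definition rep_coeff :: "nat \<Rightarrow> complex" where
  "rep_coeff n = cnj (L (\<lambda>z. z ^ n)) * of_real (ker_coeff p n)"

definition rep :: "complex \<Rightarrow> complex" where
  "rep w = (\<Sum>n. rep_coeff n * w ^ n)"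

text \<open>Monomials have bounded norm, so the coefficients grow at most linearly in
  \<open>n\<close> and their series converges in the disc.\<close>

lemma norm_rep_coeff_le: "cmod (rep_coeff n) \<le> M * pi powr (1 / p) * ker_coeff p n"
proof -
  have "cmod (L (\<lambda>z. z ^ n)) \<le> M * Np (\<lambda>z. z ^ n)"
    by (rule bounded_functionalD(2)[OF L power_mem_Ap(1)])
  also have "\<dots> \<le> M * pi powr (1 / p)"
    by (intro mult_left_mono power_mem_Ap M)
  finally show ?thesis
    using ker_coeff_pos[of p n] p by (simp add: rep_coeff_def norm_mult)
qed

lemma rep_sums: "cmod w < 1 \<Longrightarrow> (\<lambda>n. rep_coeff n * w ^ n) sums rep w"
  and norm_rep_le: "cmod w \<le> \<rho> \<Longrightarrow> \<rho> < 1 \<Longrightarrow> cmod (rep w) \<le> (\<Sum>n. cmod (rep_coeff n) * \<rho> ^ n)"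
proof -
  have sm: "summable (\<lambda>n. cmod (rep_coeff n) * \<rho> ^ n)" if "0 \<le> \<rho>" "\<rho> < 1" for \<rho>
    by (rule summable_ker_coeff[OF that norm_rep_coeff_le])
  have sm': "summable (\<lambda>n. cmod (rep_coeff n * w ^ n))" if "cmod w < 1" for w
    using sm[of "cmod w"] that by (simp add: norm_mult norm_power)
  show "(\<lambda>n. rep_coeff n * w ^ n) sums rep w" if "cmod w < 1" for w
    unfolding rep_def by (rule summable_sums[OF summable_norm_cancel[OF sm'[OF that]]])
  show "cmod (rep w) \<le> (\<Sum>n. cmod (rep_coeff n) * \<rho> ^ n)" if w: "cmod w \<le> \<rho>" "\<rho> < 1" for w \<rho>
  proof -
    have w1: "cmod w < 1" and \<rho>0: "0 \<le> \<rho>" using w norm_ge_zero[of w] by linarith+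
    have "cmod (rep w) \<le> (\<Sum>n. cmod (rep_coeff n * w ^ n))"
      unfolding rep_def by (rule summable_norm[OF sm'[OF w1]])
    also have "\<dots> \<le> (\<Sum>n. cmod (rep_coeff n) * \<rho> ^ n)"
      by (rule suminf_le[OF _ sm'[OF w1] sm[OF \<rho>0 w(2)]])
        (auto simp: norm_mult norm_power intro!: mult_left_mono power_mono w)
    finally show ?thesis .
  qed
qed

lemma holomorphic_rep: "rep holomorphic_on disc"
  by (rule power_series_holomorphic[of 0 1 rep_coeff]) (use rep_sums in auto)

text \<open>Duality: test \<open>L\<close> on the image under the kernel operator of the extremal function
  \<open>h = G |G|\<^sup>q\<^sup>-\<^sup>2\<close> for \<open>G = rep \<circ> chi p\<close>, cut off at radius \<open>rad k\<close>.\<close>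

lemma rep_truncated_bound:
  "(\<integral>\<^sup>+z. ennreal (indicator (ball 0 (rad k)) z * cmod (rep (chi p z)) powr q) \<partial>lborel) \<le> ennreal ((M * dual_const) powr q)"
proof -
  define \<rho> where "\<rho> = rad k powr (p - 1)"
  have \<rho>: "0 \<le> \<rho>" "\<rho> < 1"
    using rad_bounds[of k] p powr_less_mono2[of "p - 1" "rad k" 1] by (auto simp: \<rho>_def)
  define v where "v z = (indicator (ball 0 (rad k)) z :: real)" for z :: complex
  define G where "G z = rep (chi p z)" for z
  define h where "h z = v z *\<^sub>R (G z * complex_of_real (cmod (G z) powr (q - 2)))" for z
  define B where "B = (\<Sum>n. cmod (rep_coeff n) * \<rho> ^ n)"
  have chi_le: "cmod (chi p z) \<le> \<rho>" if "cmod z < rad k" for z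
    using that p by (auto simp: norm_chi \<rho>_def intro!: powr_mono2)
  have GB: "cmod (G z) \<le> B" if "cmod z < rad k" for z
    unfolding G_def B_def by (rule norm_rep_le[OF chi_le[OF that] \<rho>(2)])
  have v_disc: "v z = v z * indicator disc z" for z
    using rad_bounds[of k] by (auto simp: v_def indicator_def)
  have [measurable]: "v \<in> borel_measurable borel"
    unfolding v_def by measurable
  have [measurable]: "(\<lambda>z. indicator disc z *\<^sub>R G z) \<in> borel_measurable borel"
    unfolding G_def by (rule borel_measurable_chi_compose[OF disc_disj holomorphic_rep])
  have h_eq: "h z = v z *\<^sub>R ((indicator disc z *\<^sub>R G z) * complex_of_real (cmod (indicator disc z *\<^sub>R G z) powr (q - 2)))" for z
    using rad_bounds[of k] by (auto simp: h_def v_def indicator_def)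
  have hm [measurable]: "h \<in> borel_measurable borel"
    unfolding h_eq by measurable
  have norm_h: "cmod (h z) = v z * cmod (G z) powr (q - 1)" for z
  proof -
    have "cmod (G z) * cmod (G z) powr (q - 2) = cmod (G z) powr (q - 1)"
      using powr_add[of "cmod (G z)" 1 "q - 2"] by (cases "G z = 0") auto
    then show ?thesis
      by (simp add: h_def norm_mult v_def)
  qed
  have v0: "0 \<le> v z" for z
    by (simp add: v_def)
  have vint: "integrable lborel v"
    unfolding v_def using rad_bounds[of k] by (simp add: integrable_indicator_iff emeasure_disc)
  have hB: "cmod (h z) \<le> v z * B powr (q - 1)" for z
    using GB[of z] q_gt_1 by (auto simp: norm_h v_def indicator_def intro!: powr_mono2)
  have h_int: "integrable lborel h"
    by (rule Bochner_Integration.integrable_bound[of _ "\<lambda>z. v z * B powr (q - 1)"])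
      (use vint hB v0 in \<open>auto intro!: AE_I2\<close>)
  have h_supp: "cmod z < rad k" if "h z \<noteq> 0" for z
    using that by (auto simp: h_def v_def indicator_def split: if_splits)
  define \<alpha> where "\<alpha> n = (\<integral>z. h z * cnj (chi p z) ^ n \<partial>lborel)" for n
  have chi_meas: "(\<lambda>z. cnj (chi p z)) \<in> borel_measurable lborel"
    by measurable
  have \<alpha>_le: "cmod (\<alpha> n) \<le> (\<integral>z. cmod (h z) \<partial>lborel) * \<rho> ^ n" for n
  proof -
    have bd: "cmod (h z * cnj (chi p z) ^ n) \<le> cmod (h z) * \<rho> ^ n" for z
      using h_supp[of z] chi_le[of z] by (cases "h z = 0") (auto simp: norm_mult norm_power intro!: mult_left_mono power_mono)
    have int: "integrable lborel (\<lambda>z. cmod (h z) * \<rho> ^ n)"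
      using h_int by auto
    have int': "integrable lborel (\<lambda>z. h z * cnj (chi p z) ^ n)"
    proof (rule Bochner_Integration.integrable_bound[OF int])
      show "(\<lambda>z. h z * cnj (chi p z) ^ n) \<in> borel_measurable lborel"
        by measurable
      show "AE z in lborel. cmod (h z * cnj (chi p z) ^ n) \<le> norm (cmod (h z) * \<rho> ^ n)"
        using bd \<rho> by (intro AE_I2) auto
    qed
    have "cmod (\<alpha> n) \<le> (\<integral>z. cmod (h z * cnj (chi p z) ^ n) \<partial>lborel)"
      unfolding \<alpha>_def by (rule integral_norm_bound)
    also have "\<dots> \<le> (\<integral>z. cmod (h z) * \<rho> ^ n \<partial>lborel)"
      using int int' bd by (intro integral_mono integrable_norm) auto
    finally show ?thesis by simp
  qed
  \<comment> \<open>The Taylor coefficients of the kernel operator applied to \<open>h\<close>;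
    summable since the support of \<open>h\<close> makes \<open>\<alpha> n\<close> decay like
    \<open>\<rho>^n\<close>.\<close>
  define c where "c n = of_real (ker_coeff p n) * \<alpha> n" for n
  have kc: "0 < ker_coeff p n" for n
    using ker_coeff_pos[of p n] p by simp
  have c_sm: "summable (\<lambda>n. cmod (c n))"
  proof (rule summable_comparison_test)
    show "summable (\<lambda>n. (\<integral>z. cmod (h z) \<partial>lborel) * (ker_coeff p n * \<rho> ^ n))"
      using ker_coeff_sums[of \<rho> p] \<rho> by (intro summable_mult) (auto simp: sums_iff)
    have "cmod (c n) \<le> (\<integral>z. cmod (h z) \<partial>lborel) * (ker_coeff p n * \<rho> ^ n)" for n
      using mult_left_mono[OF \<alpha>_le[of n], of "ker_coeff p n"] kc[of n] by (simp add: c_def norm_mult mult_ac)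
    then show "\<exists>N. \<forall>n\<ge>N. norm (cmod (c n)) \<le> (\<integral>z. cmod (h z) \<partial>lborel) * (ker_coeff p n * \<rho> ^ n)"
      by auto
  qed
  define F where "F z = (\<Sum>n. c n * z ^ n)" for z
  have F_Ap: "F \<in> Ap" and F_sums: "(\<lambda>n. c n * L (\<lambda>z. z ^ n)) sums L F"
    using functional_power_series[OF L M c_sm] by (auto simp: F_def[abs_def])
  define A where "A = (\<integral>z. v z * cmod (G z) powr q \<partial>lborel)"
  \<comment> \<open>\<open>L\<close> meets only the power series \<open>F\<close>. Regrouping
    \<open>c n * L(z^n)\<close> as \<open>cnj (rep_coeff n) * \<alpha> n\<close> and summing under
    the integral gives the integral of \<open>h * cnj G\<close>.\<close>
  have LF: "L F = of_real A"
  proof -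
    have "(\<lambda>n. cnj (rep_coeff n) * \<alpha> n) sums (\<integral>z. h z * (\<Sum>n. cnj (rep_coeff n) * cnj (chi p z) ^ n) \<partial>lborel)"
      unfolding \<alpha>_def
      using h_supp chi_le \<rho> summable_ker_coeff[OF \<rho> norm_rep_coeff_le]
      by (intro sums_integral_power_series(1)[OF h_int chi_meas _ \<rho>(1)]) auto
    moreover have "cnj (rep_coeff n) * \<alpha> n = c n * L (\<lambda>z. z ^ n)" for n
      by (simp add: c_def rep_coeff_def mult_ac)
    ultimately have "L F = (\<integral>z. h z * (\<Sum>n. cnj (rep_coeff n) * cnj (chi p z) ^ n) \<partial>lborel)"
      using F_sums sums_unique2 by auto
    also have "\<dots> = (\<integral>z. complex_of_real (v z * cmod (G z) powr q) \<partial>lborel)"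
    proof (rule Bochner_Integration.integral_cong)
      fix z
      show "h z * (\<Sum>n. cnj (rep_coeff n) * cnj (chi p z) ^ n) = complex_of_real (v z * cmod (G z) powr q)"
      proof (cases "cmod z < rad k")
        case True
        then have "cmod (chi p z) < 1" using chi_le \<rho> by force
        then have "(\<lambda>n. cnj (rep_coeff n * chi p z ^ n)) sums cnj (G z)"
          unfolding sums_cnj G_def by (rule rep_sums)
        then have "(\<Sum>n. cnj (rep_coeff n) * cnj (chi p z) ^ n) = cnj (G z)"
          by (simp add: sums_iff)
        then have "h z * (\<Sum>n. cnj (rep_coeff n) * cnj (chi p z) ^ n) = v z *\<^sub>R ((G z * cnj (G z)) * complex_of_real (cmod (G z) powr (q - 2)))"
          by (simp add: h_def mult_ac)
        also have "G z * cnj (G z) = complex_of_real ((cmod (G z))\<^sup>2)"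
          by (simp add: complex_norm_square[symmetric])
        also have "v z *\<^sub>R (complex_of_real ((cmod (G z))\<^sup>2) * complex_of_real (cmod (G z) powr (q - 2))) = complex_of_real (v z * ((cmod (G z))\<^sup>2 * cmod (G z) powr (q - 2)))"
          by (simp add: scaleR_conv_of_real)
        also have "(cmod (G z))\<^sup>2 * cmod (G z) powr (q - 2) = cmod (G z) powr q"
          using powr_add[of "cmod (G z)" 2 "q - 2"] by (cases "G z = 0") auto
        finally show ?thesis .
      qed (simp add: h_def v_def)
    qed simp
    also have "\<dots> = of_real A"
      unfolding A_def by (rule integral_complex_of_real)
    finally show ?thesis .
  qed
  \<comment> \<open>By \<open>(q - 1) p = q\<close> the number \<open>A\<close> is both the value
    \<open>L F\<close> and the integral of \<open>|h|^p\<close>.\<close>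
  have Gq: "cmod (h z) powr p = v z * cmod (G z) powr q" for z
    using p conj_mult by (auto simp: norm_h v_def indicator_def powr_powr)
  have A0: "0 \<le> A"
    unfolding A_def by (intro integral_nonneg_AE AE_I2) (simp add: v_def)
  have Aeq: "(\<integral>\<^sup>+z. ennreal (cmod (h z) powr p) \<partial>lborel) = ennreal A"
    unfolding A_def Gq[symmetric]
  proof (rule nn_integral_eq_integral)
    have hb: "cmod (h z) powr p \<le> v z * (B powr (q - 1)) powr p" for z
      using GB[of z] p q_gt_1 by (auto simp: v_def indicator_def norm_h intro!: powr_mono2)
    show "integrable lborel (\<lambda>z. cmod (h z) powr p)"
    proof (rule Bochner_Integration.integrable_bound)
      show "integrable lborel (\<lambda>z. v z * (B powr (q - 1)) powr p)"
        using vint by simp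
      show "AE z in lborel. norm (cmod (h z) powr p) \<le> norm (v z * (B powr (q - 1)) powr p)"
      proof (rule AE_I2)
        fix z
        show "norm (cmod (h z) powr p) \<le> norm (v z * (B powr (q - 1)) powr p)"
          using hb[of z] v0[of z] by simp
      qed
    qed measurable
  qed auto
  have Fz: "ennreal (cmod (F z) / ker_const p) \<le> (\<integral>\<^sup>+w. ennreal (cmod (h w) / (cmod (1 - z * cnj (chi p w)))\<^sup>2) \<partial>lborel)"
    if z: "cmod z < 1" for z
  proof -
    let ?K = "\<lambda>w. \<Sum>n. of_real (ker_coeff p n) * (z * cnj (chi p w)) ^ n"
    have x_le: "cmod (z * cnj (chi p w)) \<le> \<rho>" if "h w \<noteq> 0" for w
    proof -
      have "cmod (z * cnj (chi p w)) \<le> 1 * \<rho>"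
        unfolding norm_mult using z chi_le[OF h_supp[OF that]] by (intro mult_mono) auto
      then show ?thesis by simp
    qed
    have x_meas: "(\<lambda>w. z * cnj (chi p w)) \<in> borel_measurable lborel"
      by measurable
    have ksm: "summable (\<lambda>n. cmod (complex_of_real (ker_coeff p n)) * \<rho> ^ n)"
      by (rule summable_ker_coeff[OF \<rho>, of _ 1 p]) (use kc in \<open>auto simp: abs_of_pos\<close>)
    note swap = sums_integral_power_series[OF h_int x_meas x_le \<rho>(1) ksm]
    have "(\<integral>w. h w * (z * cnj (chi p w)) ^ n \<partial>lborel) = z ^ n * \<alpha> n" for n
    proof -
      have "h w * (z * cnj (chi p w)) ^ n = z ^ n * (h w * cnj (chi p w) ^ n)" for w
        by (simp add: power_mult_distrib mult_ac)
      then show ?thesis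
        unfolding \<alpha>_def by (simp only: integral_mult_right_zero)
    qed
    then have "(\<lambda>n. c n * z ^ n) sums (\<integral>w. h w * ?K w \<partial>lborel)"
      using swap(1) by (simp add: c_def mult_ac)
    then have "F z = (\<integral>w. h w * ?K w \<partial>lborel)"
      by (simp add: F_def sums_iff)
    then have "ennreal (cmod (F z)) \<le> (\<integral>\<^sup>+w. ennreal (cmod (h w * ?K w)) \<partial>lborel)"
      using integral_norm_bound_ennreal[OF swap(2)] by simp
    also have "\<dots> \<le> (\<integral>\<^sup>+w. ennreal (ker_const p) * ennreal (cmod (h w) / (cmod (1 - z * cnj (chi p w)))\<^sup>2) \<partial>lborel)"
    proof (rule nn_integral_mono)
      fix w
      have "cmod (h w * ?K w) \<le> ker_const p * (cmod (h w) / (cmod (1 - z * cnj (chi p w)))\<^sup>2)"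
      proof (cases "h w = 0")
        case False
        then have "cmod (?K w) \<le> ker_const p / (cmod (1 - z * cnj (chi p w)))\<^sup>2"
          using x_le[OF False] \<rho> p by (intro norm_ker_le) auto
        from mult_left_mono[OF this, of "cmod (h w)"] show ?thesis
          by (simp add: norm_mult mult_ac)
      qed simp
      then show "ennreal (cmod (h w * ?K w)) \<le> ennreal (ker_const p) * ennreal (cmod (h w) / (cmod (1 - z * cnj (chi p w)))\<^sup>2)"
        using ker_const_pos[of p] p by (subst ennreal_mult[symmetric]) (auto intro: ennreal_leI)
    qed
    also have "\<dots> = ennreal (ker_const p) * (\<integral>\<^sup>+w. ennreal (cmod (h w) / (cmod (1 - z * cnj (chi p w)))\<^sup>2) \<partial>lborel)"
      by (rule nn_integral_cmult) measurable
    finally have "ennreal (1 / ker_const p) * ennreal (cmod (F z))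
        \<le> ennreal (1 / ker_const p) * (ennreal (ker_const p) * (\<integral>\<^sup>+w. ennreal (cmod (h w) / (cmod (1 - z * cnj (chi p w)))\<^sup>2) \<partial>lborel))"
      by (rule mult_left_mono) simp
    then show ?thesis
      using ker_const_pos[of p] p by (simp add: mult.assoc[symmetric] ennreal_mult[symmetric])
  qed
  have "(\<integral>\<^sup>+z. ennreal ((cmod (F z) / ker_const p) powr p) * indicator (ball 0 1) z \<partial>lborel) \<le> ennreal (Schur_const p q) * (\<integral>\<^sup>+w. ennreal (cmod (h w) powr p) \<partial>lborel)"
  proof (rule Schur_estimate[OF p q_gt_1 conj_sum])
    show "(\<lambda>z. cmod (h z)) \<in> borel_measurable borel" by measurable
    show "cmod (h w) \<le> B powr (q - 1)" for w
      using hB[of w] by (rule order_trans) (auto simp: v_def indicator_def)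
    show "cmod (h w) = 0" if "rad k < cmod w" for w
      using that by (auto simp: h_def v_def)
  qed (use rad_bounds[of k] Fz p ker_const_pos[of p] in auto)
  then have Schur: "(\<integral>\<^sup>+z. ennreal ((cmod (F z) / ker_const p) powr p) * indicator (ball 0 1) z \<partial>lborel) \<le> ennreal (Schur_const p q * A)"
    using A0 Schur_const_nonneg by (simp add: Aeq ennreal_mult)
  have "Aint p disc (\<lambda>_. 1) F = (\<integral>\<^sup>+z. ennreal (ker_const p powr p) * (ennreal ((cmod (F z) / ker_const p) powr p) * indicator (ball 0 1) z) \<partial>lborel)"
    unfolding Aint_def
  proof (intro nn_integral_cong)
    fix z
    show "ennreal (cmod (F z) powr p * 1) * indicator disc z = ennreal (ker_const p powr p) * (ennreal ((cmod (F z) / ker_const p) powr p) * indicator (ball 0 1) z)"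
      using ker_const_pos[of p] p by (simp add: indicator_def ennreal_mult[symmetric] powr_divide)
  qed
  also have "\<dots> = ennreal (ker_const p powr p) * (\<integral>\<^sup>+z. ennreal ((cmod (F z) / ker_const p) powr p) * indicator (ball 0 1) z \<partial>lborel)"
  proof (rule nn_integral_cmult)
    have "F holomorphic_on disc" using F_Ap by (simp add: Aspace_iff)
    note [measurable] = borel_measurable_holomorphic_indicator[OF this open_ball]
    have "(\<lambda>z. ennreal ((cmod (F z) / ker_const p) powr p) * indicator (ball 0 1) z) = (\<lambda>z. ennreal ((cmod (indicator disc z *\<^sub>R F z) / ker_const p) powr p) * indicator (ball 0 1) z)"
      by (auto simp: indicator_def)
    also have "\<dots> \<in> borel_measurable lborel"
      by measurable
    finally show "(\<lambda>z. ennreal ((cmod (F z) / ker_const p) powr p) * indicator (ball 0 1) z) \<in> borel_measurable lborel" .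
  qed
  also have "\<dots> \<le> ennreal (ker_const p powr p) * ennreal (Schur_const p q * A)"
    by (intro mult_left_mono Schur) simp
  also have "\<dots> = ennreal ((dual_const * A powr (1 / p)) powr p)"
    using ker_const_pos[of p] p A0 Schur_const_nonneg
    by (simp add: dual_const_def powr_mult powr_powr ennreal_mult[symmetric] mult.assoc)
  finally have NF: "Np F \<le> dual_const * A powr (1 / p)"
    using F_Ap p dual_const_nonneg by (intro Anorm_le(2)) (auto simp: Aspace_iff)
  have "A = cmod (L F)"
    using A0 by (simp add: LF)
  also have "\<dots> \<le> M * (dual_const * A powr (1 / p))"
    using bounded_functionalD(2)[OF L F_Ap] mult_left_mono[OF NF M] by linarith
  finally have A_le: "A \<le> M * dual_const * A powr (1 / p)"
    by simp
  \<comment> \<open>\<open>A\<close> is finite thanks to the cut-off, so \<open>A_le\<close> can be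
    divided by \<open>A^(1/p)\<close>, leaving \<open>A^(1/q)\<close>.\<close>
  have "A \<le> (M * dual_const) powr q"
  proof (cases "A = 0")
    case False
    then have Apos: "0 < A" using A0 by simp
    have "A powr (1 / q) * A powr (1 / p) = A"
      using Apos conj_sum by (simp add: powr_add[symmetric] add.commute)
    with A_le have "A powr (1 / q) * A powr (1 / p) \<le> M * dual_const * A powr (1 / p)"
      by simp
    then have "A powr (1 / q) \<le> M * dual_const"
      using Apos by (simp add: mult_le_cancel_right)
    then have "(A powr (1 / q)) powr q \<le> (M * dual_const) powr q"
      using q_gt_1 by (intro powr_mono2) auto
    then show ?thesis
      using Apos q_gt_1 by (simp add: powr_powr)
  qed simp
  then have "(\<integral>\<^sup>+z. ennreal (cmod (h z) powr p) \<partial>lborel) \<le> ennreal ((M * dual_const) powr q)"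
    unfolding Aeq by (rule ennreal_leI)
  then show ?thesis
    unfolding Gq by (simp add: v_def G_def)
qed

text \<open>The truncated bound is uniform in \<open>k\<close>, so monotone convergence extends it
  to the whole disc.\<close>

lemma rep_mem: "rep \<in> Aq" "Nq rep \<le> M * dual_const"
proof -
  let ?f = "\<lambda>k z. ennreal (indicator (ball 0 (rad k)) z * cmod (rep (chi p z)) powr q)"
  note [measurable] = borel_measurable_chi_compose[OF disc_disj holomorphic_rep]
  have fm: "?f k \<in> borel_measurable lborel" for k
  proof -
    have "?f k = (\<lambda>z. ennreal (indicator (ball 0 (rad k)) z * cmod (indicator disc z *\<^sub>R rep (chi p z)) powr q))"
      using rad_bounds[of k] by (auto simp: indicator_def)
    also have "\<dots> \<in> borel_measurable lborel"
      by measurable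
    finally show ?thesis .
  qed
  have inc: "incseq ?f"
  proof (intro incseq_SucI le_funI ennreal_leI mult_right_mono)
    show "indicator (ball 0 (rad k)) z \<le> (indicator (ball 0 (rad (Suc k))) z :: real)" for k and z :: complex
      using rad_mono[of k "Suc k"] by (auto simp: indicator_def)
  qed auto
  have "Aint q disc (eta q) rep = (\<integral>\<^sup>+z. ennreal (cmod (indicator disc z *\<^sub>R rep (chi p z)) powr q) \<partial>lborel)"
    by (rule nn_integral_chi_Aint[OF disc_disj holomorphic_rep, symmetric])
  also have "\<dots> \<le> (\<integral>\<^sup>+z. (SUP k. ?f k z) \<partial>lborel)"
  proof (rule nn_integral_mono)
    fix z :: complex
    show "ennreal (cmod (indicator disc z *\<^sub>R rep (chi p z)) powr q) \<le> (SUP k. ?f k z)"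
    proof (cases "cmod z < 1")
      case True
      then obtain k where "cmod z < rad k"
        using order_tendstoD(1)[OF rad_tendsto True] by (auto simp: eventually_sequentially)
      with True show ?thesis
        by (intro SUP_upper2[of k]) auto
    qed (use q_gt_1 in simp)
  qed
  also have "\<dots> = (SUP k. integral\<^sup>N lborel (?f k))"
    by (rule nn_integral_monotone_convergence_SUP[OF inc fm])
  also have "\<dots> \<le> ennreal ((M * dual_const) powr q)"
    by (intro SUP_least rep_truncated_bound)
  finally have le: "Aint q disc (eta q) rep \<le> ennreal ((M * dual_const) powr q)" .
  show "rep \<in> Aq" "Nq rep \<le> M * dual_const"
    using q_gt_1 eta_nonneg M dual_const_nonneg by (intro Anorm_le[OF holomorphic_rep _ _ _ _ le]; simp)+
qed

end

section \<open>Moments of the disc, injectivity and surjectivity there\<close>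

lemma integral_disc_powr:
  "(\<integral>z. indicator disc z * (cmod z powr p) ^ n \<partial>lborel) = 1 / ker_coeff p n"
proof -
  have m: "0 < real n * p + 2" using p by (simp add: add_nonneg_pos)
  \<comment> \<open>At \<open>t = 0\<close>, \<open>n = 0\<close> the two sides are 1 and 0, because
    \<open>0 powr 0 = 0\<close>.\<close>
  have eq: "(t powr p) ^ n = t powr (real n * p)" if "0 < t" for t
    using that by (simp add: powr_power mult.commute)
  have "(\<integral>\<^sup>+z. ennreal (indicator disc z * (cmod z powr p) ^ n) \<partial>lborel) = (\<integral>\<^sup>+z. ennreal ((cmod z powr p) ^ n) * indicator disc z \<partial>lborel)"
    by (intro nn_integral_cong) (simp add: indicator_def)
  also have "\<dots> = (\<integral>\<^sup>+t. ennreal ((t powr p) ^ n) * ennreal (2 * pi * t) * indicator {0<..<1} t \<partial>lborel)"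
    by (rule nn_integral_disc_radial) measurable
  also have "\<dots> = (\<integral>\<^sup>+t. ennreal (2 * pi * t powr (real n * p + 1)) * indicator {0..1} t \<partial>lborel)"
  proof (rule nn_integral_cong_AE)
    show "AE t in lborel. ennreal ((t powr p) ^ n) * ennreal (2 * pi * t) * indicator {0<..<1} t = ennreal (2 * pi * t powr (real n * p + 1)) * indicator {0..1} t"
      using AE_lborel_singleton[of 0] AE_lborel_singleton[of 1]
    proof eventually_elim
      case (elim t)
      then show ?case
        by (cases "0 < t \<and> t < 1") (auto simp: indicator_def eq ennreal_mult[symmetric] powr_add mult_ac)
    qed
  qed
  also have "\<dots> = ennreal (2 * pi * (1 / (real n * p + 2)))"
  proof (rule nn_integral_has_integral_lebesgue')
    have "((\<lambda>t. t powr (real n * p + 1)) has_integral (1 powr (real n * p + 1 + 1) / (real n * p + 1 + 1))) {0..1::real}"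
      using m by (intro has_integral_powr_from_0) auto
    then show "((\<lambda>t. 2 * pi * t powr (real n * p + 1)) has_integral 2 * pi * (1 / (real n * p + 2))) {0..1}"
      by (intro has_integral_mult_right) (simp add: add.assoc)
  qed auto
  finally have "(\<integral>\<^sup>+z. ennreal (indicator disc z * (cmod z powr p) ^ n) \<partial>lborel) = ennreal (1 / ker_coeff p n)"
    by (simp add: ker_coeff_def)
  then show ?thesis
    using ker_coeff_pos[of p n] p by (subst integral_eq_nn_integral) auto
qed

lemma pairing_power:
  assumes g: "g \<in> Aq" and b: "\<And>w. cmod w < 1 \<Longrightarrow> (\<lambda>m. b m * w ^ m) sums g w"
  shows "pairing p disc (\<lambda>z. z ^ n) g = cnj (b n) / of_real (ker_coeff p n)"
proof -
  have "pairing p disc (\<lambda>z. z powi int n) g = cnj (b (nat (int n))) * of_real (\<integral>z. indicator disc z * (cmod z powr p) ^ nat (int n) \<partial>lborel)"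
    using pairing_monomial[OF disc_disj, of "int n" g b] power_mem_Ap(1)[of n] g b by simp
  then show ?thesis
    by (simp add: integral_disc_powr)
qed

text \<open>Pairing with \<open>z^n\<close> reads off the \<open>n\<close>-th Taylor coefficient of
  \<open>g\<close>.\<close>

lemma pairing_disc_inject:
  assumes g: "g \<in> Aq" and z: "\<And>n. pairing p disc (\<lambda>z. z ^ n) g = 0" and w: "cmod w < 1"
  shows "g w = 0"
proof -
  have hol: "g holomorphic_on disc" using g by (simp add: Aspace_iff)
  define b where "b n = (deriv ^^ n) g 0 / fact n" for n
  have b: "(\<lambda>n. b n * w ^ n) sums g w" if "cmod w < 1" for w
    using holomorphic_power_series[OF hol, of w] that by (simp add: b_def)
  have "b n = 0" for n
    using pairing_power[OF g b, of n] z[of n] ker_coeff_pos[of p n] p by simp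
  then have "(\<lambda>n. 0) sums g w"
    using b[OF w] by simp
  then show ?thesis
    using sums_unique2[OF _ sums_zero] by auto
qed

text \<open>The coefficients of \<open>rep\<close> are normalised to match \<open>L\<close> on
  monomials, which decides the equality on all of \<open>Ap\<close>.\<close>

lemma disc_representation:
  assumes L: "bounded_functional p disc L M" and M: "0 \<le> M"
  shows "\<exists>g\<in>Aq. Nq g \<le> M * dual_const \<and> (\<forall>f\<in>Ap. L f = pairing p disc f g)"
proof (intro bexI conjI ballI)
  show mem: "rep L \<in> Aq" and "Nq (rep L) \<le> M * dual_const"
    by (rule rep_mem[OF L M])+
  fix f assume f: "f \<in> Ap"
  show "L f = pairing p disc f (rep L)"
  proof (rule bounded_functional_eqI[OF L M bounded_functional_pairing[OF disc_disj mem] Anorm_nonneg _ f])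
    fix n
    have "pairing p disc (\<lambda>z. z ^ n) (rep L) = cnj (rep_coeff L n) / of_real (ker_coeff p n)"
      by (rule pairing_power[OF mem rep_sums[OF L M]])
    then show "L (\<lambda>z. z ^ n) = pairing p disc (\<lambda>z. z ^ n) (rep L)"
      using ker_coeff_pos[of p n] p by (simp add: rep_coeff_def[OF L M])
  qed
qed

end

section \<open>Isolated singularities of weighted integrable functions\<close>

text \<open>In the Taylor series about \<open>z\<close>, integrated over the disc, rotations kill
  every term but the constant one.\<close>

lemma mean_value_ball:
  assumes h: "h holomorphic_on ball z R" and r: "0 < r" "r < R"
  shows "ennreal (cmod (h z) * (pi * r\<^sup>2)) \<le> (\<integral>\<^sup>+w. ennreal (cmod (h w)) * indicator (ball z r) w \<partial>lborel)"
proof -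
  define a where "a n = (deriv ^^ n) h z / fact n" for n
  have a: "(\<lambda>n. a n * w ^ n) sums h (z + w)" if "cmod w < R" for w
    using holomorphic_power_series[OF h, of "z + w"] that by (simp add: a_def dist_norm)
  define v where "v w = (indicator (ball 0 r) w :: real)" for w :: complex
  have v_int: "integrable lborel (\<lambda>w. complex_of_real (v w))"
    unfolding v_def using r by (intro integrable_of_real) (simp add: integrable_indicator_iff emeasure_disc)
  have [measurable]: "v \<in> borel_measurable borel"
    unfolding v_def by measurable
  define s where "s = complex_of_real ((r + R) / 2)"
  have s: "cmod s = (r + R) / 2"
    using r unfolding s_def by (simp del: of_real_add of_real_divide)
  have "summable (\<lambda>n. norm (a n * complex_of_real r ^ n))"
    by (rule powser_insidea[OF sums_summable[OF a[of s]]]) (use s r in auto)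
  then have sm: "summable (\<lambda>n. cmod (a n) * r ^ n)"
    using r by (simp add: norm_mult norm_power)
  have x: "cmod w \<le> r" if "complex_of_real (v w) \<noteq> 0" for w
    using that by (auto simp: v_def indicator_def split: if_splits)
  have id: "(\<lambda>w::complex. w) \<in> borel_measurable lborel"
    by measurable
  note swap = sums_integral_power_series[OF v_int id x less_imp_le[OF r(1)] sm]
  have v0: "(\<integral>w. v w \<partial>lborel) = pi * r\<^sup>2"
    unfolding v_def using r by (simp add: measure_def emeasure_disc)
  have t: "(\<integral>w. complex_of_real (v w) * w ^ n \<partial>lborel) = (if n = 0 then complex_of_real (pi * r\<^sup>2) else 0)" for n
    using lborel_integral_equivariant_power[of v "\<lambda>w. w" n] v0
    by (auto simp: v_def indicator_def norm_mult)
  have "(\<lambda>n. a n * (\<integral>w. complex_of_real (v w) * w ^ n \<partial>lborel)) sums (a 0 * complex_of_real (pi * r\<^sup>2))"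
    unfolding t using sums_single[of 0 "\<lambda>n. a n * complex_of_real (pi * r\<^sup>2)"]
    by (rule back_subst[of "\<lambda>f. f sums _"]) auto
  then have "a 0 * complex_of_real (pi * r\<^sup>2) = (\<integral>w. complex_of_real (v w) * (\<Sum>n. a n * w ^ n) \<partial>lborel)"
    using swap(1) sums_unique2 by blast
  then have "ennreal (cmod (a 0 * complex_of_real (pi * r\<^sup>2))) \<le> (\<integral>\<^sup>+w. ennreal (cmod (complex_of_real (v w) * (\<Sum>n. a n * w ^ n))) \<partial>lborel)"
    using integral_norm_bound_ennreal[OF swap(2)] by simp
  also have "\<dots> = (\<integral>\<^sup>+w. ennreal (cmod (indicator (ball z R) (z + w) *\<^sub>R h (z + w))) * indicator (ball z r) (z + w) \<partial>lborel)"
  proof (intro nn_integral_cong)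
    fix w
    show "ennreal (cmod (complex_of_real (v w) * (\<Sum>n. a n * w ^ n))) = ennreal (cmod (indicator (ball z R) (z + w) *\<^sub>R h (z + w))) * indicator (ball z r) (z + w)"
      using a[of w] r by (auto simp: v_def indicator_def dist_norm sums_iff)
  qed
  also have "\<dots> = (\<integral>\<^sup>+w. ennreal (cmod (indicator (ball z R) w *\<^sub>R h w)) * indicator (ball z r) w \<partial>distr lborel borel ((+) z))"
  proof -
    note [measurable] = borel_measurable_holomorphic_indicator[OF h open_ball]
    have "(\<lambda>w. ennreal (cmod (indicator (ball z R) w *\<^sub>R h w)) * indicator (ball z r) w) \<in> borel_measurable borel"
      by measurable
    then show ?thesis
      using nn_integral_distr[of "(+) z" lborel borel "\<lambda>w. ennreal (cmod (indicator (ball z R) w *\<^sub>R h w)) * indicator (ball z r) w"]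
      by simp
  qed
  also have "\<dots> = (\<integral>\<^sup>+w. ennreal (cmod (indicator (ball z R) w *\<^sub>R h w)) * indicator (ball z r) w \<partial>lborel)"
    by (simp only: lborel_distr_plus)
  also have "\<dots> = (\<integral>\<^sup>+w. ennreal (cmod (h w)) * indicator (ball z r) w \<partial>lborel)"
    using r by (intro nn_integral_cong) (auto simp: indicator_def)
  finally show ?thesis
    by (simp add: a_def norm_mult norm_power)
qed

lemma powr_ratio_le:
  fixes x y b :: real
  assumes "0 < x" "0 < y" "x \<le> 2 * y" "y \<le> 2 * x"
  shows "x powr b \<le> 2 powr \<bar>b\<bar> * y powr b"
proof (cases "0 \<le> b")
  case True
  then have "x powr b \<le> (2 * y) powr b"
    using assms by (intro powr_mono2) auto
  then show ?thesis
    using True assms by (simp add: powr_mult)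
next
  case False
  then have "x powr b \<le> (y / 2) powr b"
    using assms by (intro powr_mono2') auto
  also have "\<dots> = 2 powr \<bar>b\<bar> * y powr b"
    using False assms by (simp add: powr_divide powr_minus_divide)
  finally show ?thesis .
qed

text \<open>Split \<open>|h| \<le> T + T\<^sup>1\<^sup>-\<^sup>s |h|\<^sup>s\<close> in the mean value inequality, with \<open>T\<close> a suitable power of \<open>|z|\<close>.\<close>

lemma weighted_integrable_growth:
  assumes h: "h holomorphic_on ball 0 1 - {0}" and s: "1 < s" and \<beta>: "\<beta> < 2 * (s - 1)"
    and fin: "(\<integral>\<^sup>+z. ennreal (cmod (h z) powr s * cmod z powr \<beta>) * indicator (ball 0 1 - {0}) z \<partial>lborel) < \<infinity>"
  shows "((\<lambda>z. z * (z * h z)) \<longlongrightarrow> 0) (at 0)"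
proof -
  define J where "J = enn2real (\<integral>\<^sup>+z. ennreal (cmod (h z) powr s * cmod z powr \<beta>) * indicator (ball 0 1 - {0}) z \<partial>lborel)"
  have J: "(\<integral>\<^sup>+z. ennreal (cmod (h z) powr s * cmod z powr \<beta>) * indicator (ball 0 1 - {0}) z \<partial>lborel) = ennreal J" "0 \<le> J"
    using fin by (auto simp: J_def)
  have "\<beta> / (s - 1) < 2"
    using s \<beta> by (simp add: divide_less_eq)
  \<comment> \<open>With \<open>T = |z|^(-t)\<close> this range of \<open>t\<close> makes both
    exponents of the final bound, \<open>2 - t\<close> and \<open>t (s - 1) - \<beta>\<close>,
    positive.\<close>
  then obtain t where t: "t < 2" "\<beta> / (s - 1) < t"
    using dense by blast
  then have t2: "\<beta> < t * (s - 1)"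
    using s by (simp add: divide_less_eq)
  \<comment> \<open>The factor \<open>4 / pi\<close> is \<open>|z|^2\<close> divided by the area of
    the disc of radius \<open>|z|/2\<close>; the power of 2 is the variation of the weight on that
    disc.\<close>
  define C where "C = 4 / pi * 2 powr \<bar>\<beta>\<bar> * J"
  have bound: "cmod (z * (z * h z)) \<le> cmod z powr (2 - t) + C * cmod z powr (t * (s - 1) - \<beta>)"
    if z: "z \<noteq> 0" "cmod z < 1 / 2" for z
  proof -
    \<comment> \<open>On this disc \<open>|w|\<close> and \<open>|z|\<close> agree up to a factor 2,
      so the weight is nearly constant.\<close>
    define r where "r = cmod z / 2"
    define T where "T = cmod z powr (- t)"
    have r: "0 < r" "r < cmod z" and T: "0 < T"
      using z by (auto simp: r_def T_def)
    have sub: "ball z (cmod z) \<subseteq> ball 0 1 - {0}"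
    proof
      fix w assume "w \<in> ball z (cmod z)"
      then have "cmod (z - w) < cmod z" by (simp add: dist_norm)
      moreover have "cmod w \<le> cmod (z - w) + cmod z"
        using norm_triangle_ineq4[of z "z - w"] by simp
      ultimately show "w \<in> ball 0 1 - {0}" using z by auto
    qed
    define K where "K = T powr (1 - s) * 2 powr \<bar>\<beta>\<bar> * cmod z powr (- \<beta>)"
    have "ennreal (cmod (h z) * (pi * r\<^sup>2)) \<le> (\<integral>\<^sup>+w. ennreal (cmod (h w)) * indicator (ball z r) w \<partial>lborel)"
      by (rule mean_value_ball[OF holomorphic_on_subset[OF h sub] r])
    also have "\<dots> \<le> (\<integral>\<^sup>+w. ennreal T * indicator (ball z r) w +
        ennreal K * (ennreal (cmod (h w) powr s * cmod w powr \<beta>) * indicator (ball 0 1 - {0}) w) \<partial>lborel)"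
    proof (rule nn_integral_mono)
      fix w
      show "ennreal (cmod (h w)) * indicator (ball z r) w \<le> ennreal T * indicator (ball z r) w +
        ennreal K * (ennreal (cmod (h w) powr s * cmod w powr \<beta>) * indicator (ball 0 1 - {0}) w)"
      proof (cases "w \<in> ball z r")
        case True
        then have "w \<in> ball z (cmod z)" "cmod (z - w) < r"
          using r by (auto simp: dist_norm)
        with sub have w: "w \<in> ball 0 1 - {0}" "cmod (z - w) < r"
          by blast+
        have "cmod z \<le> 2 * cmod w" "cmod w \<le> 2 * cmod z"
          using w(2) norm_triangle_ineq2[of z w] norm_triangle_ineq2[of w z] by (auto simp: r_def norm_minus_commute)
        then have "cmod z powr \<beta> \<le> 2 powr \<bar>\<beta>\<bar> * cmod w powr \<beta>"
          using z w by (intro powr_ratio_le) auto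
        then have "1 \<le> 2 powr \<bar>\<beta>\<bar> * cmod z powr (- \<beta>) * cmod w powr \<beta>"
          using z by (simp add: powr_minus field_simps)
        then have K: "T powr (1 - s) * cmod (h w) powr s * 1 \<le> T powr (1 - s) * cmod (h w) powr s * (2 powr \<bar>\<beta>\<bar> * cmod z powr (- \<beta>) * cmod w powr \<beta>)"
          by (intro mult_left_mono) auto
        have "cmod (h w) \<le> T + T powr (1 - s) * cmod (h w) powr s"
        proof (cases "cmod (h w) \<le> T")
          case True
          then show ?thesis by (simp add: add_increasing2)
        next
          case False
          then have "cmod (h w) powr (1 - s) \<le> T powr (1 - s)"
            using T s by (intro powr_mono2') auto
          then have "cmod (h w) powr (1 - s) * cmod (h w) powr s \<le> T powr (1 - s) * cmod (h w) powr s"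
            by (intro mult_right_mono) auto
          moreover have "cmod (h w) powr (1 - s) * cmod (h w) powr s = cmod (h w)"
            by (simp add: powr_add[symmetric])
          ultimately show ?thesis using T by simp
        qed
        also have "\<dots> \<le> T + K * (cmod (h w) powr s * cmod w powr \<beta>)"
          using K by (simp add: K_def mult_ac)
        finally have "ennreal (cmod (h w)) \<le> ennreal T + ennreal K * ennreal (cmod (h w) powr s * cmod w powr \<beta>)"
          using T by (simp add: K_def ennreal_mult[symmetric] ennreal_plus[symmetric] ennreal_leI del: ennreal_plus)
        then show ?thesis
          using True w by simp
      qed simp
    qed
    also have "\<dots> = (\<integral>\<^sup>+w. ennreal T * indicator (ball z r) w \<partial>lborel) + ennreal K * ennreal J"
      using borel_measurable_Aint_integrand(2)[OF h, of "\<lambda>z. cmod z powr \<beta>" s]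
      by (subst nn_integral_add) (auto simp: nn_integral_cmult J open_delete)
    also have "(\<integral>\<^sup>+w. ennreal T * indicator (ball z r) w \<partial>lborel) = ennreal T * ennreal (pi * r\<^sup>2)"
      using r by (simp add: nn_integral_cmult emeasure_ball unit_ball_vol_2)
    also have "ennreal T * ennreal (pi * r\<^sup>2) + ennreal K * ennreal J = ennreal (T * (pi * r\<^sup>2) + K * J)"
      using T J(2) by (simp add: K_def ennreal_mult[symmetric] ennreal_plus[symmetric] del: ennreal_plus)
    finally have "cmod (h z) * (pi * r\<^sup>2) \<le> T * (pi * r\<^sup>2) + K * J"
      by (rule ennreal_le_iff[THEN iffD1, rotated]) (use T J(2) in \<open>simp add: K_def\<close>)
    then have "4 / pi * (cmod (h z) * (pi * r\<^sup>2)) \<le> 4 / pi * (T * (pi * r\<^sup>2) + K * J)"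
      by (intro mult_left_mono) auto
    moreover have "4 / pi * (cmod (h z) * (pi * r\<^sup>2)) = cmod (z * (z * h z))"
      by (simp add: r_def norm_mult power2_eq_square)
    moreover have "4 / pi * (T * (pi * r\<^sup>2) + K * J) = (cmod z)\<^sup>2 * T + 4 / pi * (K * J)"
      by (simp add: r_def power2_eq_square distrib_left)
    moreover have "(cmod z)\<^sup>2 * T = cmod z powr (2 - t)"
      using z powr_add[of "cmod z" 2 "- t"] by (simp add: T_def)
    moreover have "4 / pi * (K * J) = C * cmod z powr (t * (s - 1) - \<beta>)"
    proof -
      have "T powr (1 - s) * cmod z powr (- \<beta>) = cmod z powr (t * (s - 1) - \<beta>)"
        by (simp add: T_def powr_powr powr_add[symmetric] algebra_simps)
      then show ?thesis
        by (simp add: K_def C_def mult_ac)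
    qed
    ultimately show ?thesis by simp
  qed
  show ?thesis
  proof (rule Lim_null_comparison)
    have "\<forall>\<^sub>F z in at 0. z \<noteq> 0 \<and> cmod z < 1 / 2"
      unfolding eventually_at by (intro exI[of _ "1/2"]) auto
    then show "\<forall>\<^sub>F z in at 0. norm (z * (z * h z)) \<le> cmod z powr (2 - t) + C * cmod z powr (t * (s - 1) - \<beta>)"
      by eventually_elim (use bound in auto)
    have lim: "((\<lambda>z. cmod z powr e) \<longlongrightarrow> 0) (at 0)" if "0 < e" for e
    proof -
      have "((\<lambda>z. cmod z powr e) \<longlongrightarrow> cmod 0 powr e) (at 0)"
        using that by (intro tendsto_powr' tendsto_norm tendsto_ident_at tendsto_const) (auto intro: always_eventually)
      then show ?thesis by simp
    qed
    have "((\<lambda>z. cmod z powr (2 - t) + C * cmod z powr (t * (s - 1) - \<beta>)) \<longlongrightarrow> 0 + C * 0) (at 0)"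
      using t t2 by (intro tendsto_add tendsto_mult lim tendsto_const) auto
    then show "((\<lambda>z. cmod z powr (2 - t) + C * cmod z powr (t * (s - 1) - \<beta>)) \<longlongrightarrow> 0) (at 0)"
      by simp
  qed
qed

section \<open>Splitting off a simple pole at the puncture\<close>

lemma Aint_punctured: "Aint r (ball 0 1 - {0}) lam f = Aint r (ball 0 1) lam f"
  unfolding Aint_def
  by (rule nn_integral_cong_AE) (use AE_lborel_singleton[of 0] in \<open>eventually_elim; simp add: indicator_def\<close>)

lemma Aspace_disc_subset: "Aspace r (ball 0 1) lam \<subseteq> Aspace r (ball 0 1 - {0}) lam"
  by (auto simp: Aspace_iff Aint_punctured intro: holomorphic_on_subset)

lemma Anorm_punctured:
  assumes f: "f \<in> Aspace r (ball 0 1) lam" and r: "0 < r"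
    and lam: "lam \<in> borel_measurable borel" "\<And>z. 0 \<le> lam z"
  shows "Anorm r (ball 0 1 - {0}) lam f = Anorm r (ball 0 1) lam f"
proof -
  have f': "f \<in> Aspace r (ball 0 1 - {0}) lam"
    using f Aspace_disc_subset by blast
  have "ennreal (Anorm r (ball 0 1 - {0}) lam f powr r) = ennreal (Anorm r (ball 0 1) lam f powr r)"
    using Aint_eq_Anorm[OF f _ r lam] Aint_eq_Anorm[OF f' _ r lam] Aint_punctured by (simp add: open_delete)
  then have "(Anorm r (ball 0 1 - {0}) lam f powr r) powr (1 / r) = (Anorm r (ball 0 1) lam f powr r) powr (1 / r)"
    by simp
  then show ?thesis
    using r by (simp add: powr_powr)
qed

text \<open>The growth bound makes 0 a removable singularity of \<open>z f(z)\<close>; its value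
  \<open>G 0\<close> is the residue. \<open>F\<close> is shown to be integrable without
  \<open>1/z\<close> being so: it is bounded near 0, and elsewhere \<open>1/z\<close> is
  bounded.\<close>

lemma Aspace_punctured_decompose:
  assumes f: "f \<in> Aspace s (ball 0 1 - {0}) lam" and s: "1 < s" and \<beta>: "\<beta> < 2 * (s - 1)" and \<kappa>: "0 < \<kappa>"
    and lam: "lam \<in> borel_measurable borel" "\<And>z. 0 \<le> lam z" "\<And>z. z \<noteq> 0 \<Longrightarrow> lam z = \<kappa> * cmod z powr \<beta>"
    and one: "Aint s (ball 0 1) lam (\<lambda>_. 1) < \<infinity>"
  obtains a F where "F \<in> Aspace s (ball 0 1) lam" "\<And>z. z \<in> ball 0 1 - {0} \<Longrightarrow> f z = a * inverse z + F z"
proof -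
  let ?D = "ball (0::complex) 1"
  have hol: "f holomorphic_on ?D - {0}" and fin: "Aint s (?D - {0}) lam f < \<infinity>"
    using f by (auto simp: Aspace_iff)
  have D': "open (?D - {0})" by (simp add: open_delete)
  have "(\<integral>\<^sup>+z. ennreal (cmod (f z) powr s * cmod z powr \<beta>) * indicator (?D - {0}) z \<partial>lborel) =
      (\<integral>\<^sup>+z. ennreal (1 / \<kappa>) * (ennreal (cmod (f z) powr s * lam z) * indicator (?D - {0}) z) \<partial>lborel)"
    using \<kappa> by (intro nn_integral_cong) (auto simp: indicator_def lam(3) ennreal_mult[symmetric])
  also have "\<dots> = ennreal (1 / \<kappa>) * Aint s (?D - {0}) lam f"
    unfolding Aint_def by (rule nn_integral_cmult) (use borel_measurable_Aint_integrand(2)[OF hol D' lam(1)] in simp)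
  also have "\<dots> < \<infinity>"
    using fin by (simp add: ennreal_mult_less_top)
  finally have "((\<lambda>z. z * (z * f z)) \<longlongrightarrow> 0) (at 0)"
    by (rule weighted_integrable_growth[OF hol s \<beta>])
  moreover have "(\<lambda>z. z * f z) holomorphic_on ?D - {0}"
    by (intro holomorphic_intros hol)
  ultimately have "\<exists>g. g holomorphic_on ?D \<and> (\<forall>z\<in>?D - {0}. g z = z * f z)"
    using holomorphic_on_extend_lim[of "\<lambda>z. z * f z" ?D 0] by simp
  then obtain G where G: "G holomorphic_on ?D" "\<And>z. z \<in> ?D - {0} \<Longrightarrow> G z = z * f z"
    by blast
  define F where "F z = (if z = 0 then deriv G 0 else (G z - G 0) / (z - 0))" for z
  have F: "F holomorphic_on ?D"
    unfolding F_def by (rule pole_lemma_open[OF G(1) open_ball])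
  have eq: "f z = G 0 * inverse z + F z" if "z \<in> ?D - {0}" for z
    using G(2)[OF that] that by (simp add: F_def field_simps)
  have "continuous_on (cball 0 (1/2)) F"
    using F by (intro continuous_on_subset[OF holomorphic_on_imp_continuous_on[OF F]]) auto
  then have "compact (F ` cball 0 (1/2))"
    by (rule compact_continuous_image) simp
  then obtain B where "\<forall>w\<in>F ` cball 0 (1/2). cmod w \<le> B"
    using compact_imp_bounded bounded_iff by metis
  then have B: "cmod (F z) \<le> B" if "cmod z \<le> 1 / 2" for z
    using that by simp
  \<comment> \<open>The first summand serves \<open>|z| \<le> 1/2\<close>; the second serves the
    rest, where the pole part is at most \<open>2 |G 0|\<close>.\<close>
  define K where "K = B powr s + 2 powr s * (2 * cmod (G 0)) powr s"
  have "Aint s ?D lam F = Aint s (?D - {0}) lam F"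
    by (rule Aint_punctured[symmetric])
  also have "\<dots> \<le> (\<integral>\<^sup>+z. ennreal K * (ennreal (cmod 1 powr s * lam z) * indicator ?D z) + ennreal (2 powr s) * (ennreal (cmod (f z) powr s * lam z) * indicator (?D - {0}) z) \<partial>lborel)"
    unfolding Aint_def
  proof (rule nn_integral_mono)
    fix z
    show "ennreal (cmod (F z) powr s * lam z) * indicator (?D - {0}) z \<le> ennreal K * (ennreal (cmod 1 powr s * lam z) * indicator ?D z) + ennreal (2 powr s) * (ennreal (cmod (f z) powr s * lam z) * indicator (?D - {0}) z)"
    proof (cases "z \<in> ?D - {0}")
      case True
      have "cmod (F z) powr s \<le> K + 2 powr s * cmod (f z) powr s"
      proof (cases "cmod z \<le> 1 / 2")
        case True
        then have "cmod (F z) powr s \<le> B powr s"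
          using B s by (intro powr_mono2) auto
        then show ?thesis
          unfolding K_def by (smt (verit) mult_nonneg_nonneg powr_ge_zero)
      next
        case False
        have "inverse (cmod z) \<le> 2"
          using False True by (simp add: inverse_eq_divide field_simps)
        then have "cmod (G 0) * inverse (cmod z) \<le> cmod (G 0) * 2"
          by (intro mult_left_mono) auto
        moreover have "F z = f z - G 0 * inverse z"
          using eq[OF True] by simp
        ultimately have "cmod (F z) \<le> cmod (f z) + 2 * cmod (G 0)"
          using norm_triangle_ineq4[of "f z" "G 0 * inverse z"] by (simp add: norm_mult norm_inverse)
        then have "cmod (F z) powr s \<le> (cmod (f z) + 2 * cmod (G 0)) powr s"
          using s by (intro powr_mono2) auto
        also have "\<dots> \<le> 2 powr s * (cmod (f z) powr s + (2 * cmod (G 0)) powr s)"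
          using s by (intro powr_add_le) auto
        finally show ?thesis
          using powr_ge_zero[of B s] unfolding K_def distrib_left by linarith
      qed
      then have "cmod (F z) powr s * lam z \<le> (K + 2 powr s * cmod (f z) powr s) * lam z"
        using lam(2) by (intro mult_right_mono)
      also have "\<dots> = K * lam z + 2 powr s * (cmod (f z) powr s * lam z)"
        by (simp add: algebra_simps)
      finally have "ennreal (cmod (F z) powr s * lam z) \<le> ennreal K * ennreal (lam z) + ennreal (2 powr s) * ennreal (cmod (f z) powr s * lam z)"
        using lam(2)[of z] by (simp add: K_def ennreal_mult[symmetric] ennreal_plus[symmetric] ennreal_leI del: ennreal_plus)
      then show ?thesis
        using True by simp
    qed simp
  qed
  also have "\<dots> = ennreal K * Aint s ?D lam (\<lambda>_. 1) + ennreal (2 powr s) * Aint s (?D - {0}) lam f"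
    unfolding Aint_def using borel_measurable_Aint_integrand(2)[OF hol D' lam(1), of s] lam(1)
    by (subst nn_integral_add) (auto simp: nn_integral_cmult)
  also have "\<dots> < \<infinity>"
    using one fin by (simp add: ennreal_mult_less_top)
  finally have "F \<in> Aspace s ?D lam"
    using F by (simp add: Aspace_iff)
  then show ?thesis
    using that eq by blast
qed

text \<open>A quasi-triangle inequality is enough for equivalence of norms. Of
  \<open>4 = 2 * 2\<close>, one factor comes from \<open>Aint_lincomb_le\<close>, the other from
  \<open>x^r + y^r \<le> 2^r (x + y)^r\<close>.\<close>

lemma Anorm_lincomb_le:
  assumes f: "f \<in> Aspace r U lam" and g: "g \<in> Aspace r U lam" and U: "open U" and r: "1 \<le> r"
    and lam: "lam \<in> borel_measurable borel" "\<And>z. 0 \<le> lam z"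
  shows "Anorm r U lam (\<lambda>z. a * f z + b * g z) \<le> 4 * (cmod a * Anorm r U lam f + cmod b * Anorm r U lam g)"
proof -
  have r0: "0 < r" using r by simp
  have hol: "f holomorphic_on U" "g holomorphic_on U" using f g by (auto simp: Aspace_iff)
  let ?x = "cmod a * Anorm r U lam f" and ?y = "cmod b * Anorm r U lam g"
  have "Aint r U lam (\<lambda>z. a * f z + b * g z) \<le> ennreal (2 powr r * cmod a powr r) * ennreal (Anorm r U lam f powr r) + ennreal (2 powr r * cmod b powr r) * ennreal (Anorm r U lam g powr r)"
    using Aint_lincomb_le[OF hol U r0 lam] by (simp add: Aint_eq_Anorm[OF f U r0 lam] Aint_eq_Anorm[OF g U r0 lam])
  also have "\<dots> = ennreal (2 powr r * (?x powr r + ?y powr r))"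
    by (simp add: ennreal_mult[symmetric] ennreal_plus[symmetric] powr_mult distrib_left mult.assoc del: ennreal_plus)
  also have "\<dots> \<le> ennreal ((4 * (?x + ?y)) powr r)"
  proof (rule ennreal_leI)
    have "?x powr r \<le> (?x + ?y) powr r" "?y powr r \<le> (?x + ?y) powr r"
      using r by (auto intro!: powr_mono2)
    then have "?x powr r + ?y powr r \<le> 2 powr 1 * (?x + ?y) powr r"
      by simp
    also have "\<dots> \<le> 2 powr r * (?x + ?y) powr r"
      using r by (intro mult_right_mono powr_mono) auto
    finally have "2 powr r * (?x powr r + ?y powr r) \<le> 2 powr r * (2 powr r * (?x + ?y) powr r)"
      by (intro mult_left_mono) auto
    also have "\<dots> = (4 * (?x + ?y)) powr r"
    proof -
      have "2 powr r * 2 powr r = (4::real) powr r"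
        using powr_mult[of 2 2 r] by simp
      moreover have "(4 * (?x + ?y)) powr r = 4 powr r * (?x + ?y) powr r"
        by (simp only: powr_mult)
      ultimately show ?thesis
        by (simp only: mult.assoc[symmetric])
    qed
    finally show "2 powr r * (?x powr r + ?y powr r) \<le> (4 * (?x + ?y)) powr r" .
  qed
  finally show ?thesis
    using hol by (intro Anorm_le(2)[OF _ U r0 lam]) (auto intro!: holomorphic_intros)
qed

section \<open>The punctured disc\<close>

context conjugate_exponents
begin

abbreviation (input) pdisc :: "complex set" where "pdisc \<equiv> ball 0 1 - {0}"

abbreviation Ap' :: "(complex \<Rightarrow> complex) set" where "Ap' \<equiv> Aspace p pdisc (\<lambda>_. 1)"
abbreviation Aq' :: "(complex \<Rightarrow> complex) set" where "Aq' \<equiv> Aspace q pdisc (eta q)"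
abbreviation Np' :: "(complex \<Rightarrow> complex) \<Rightarrow> real" where "Np' \<equiv> Anorm p pdisc (\<lambda>_. 1)"
abbreviation Nq' :: "(complex \<Rightarrow> complex) \<Rightarrow> real" where "Nq' \<equiv> Anorm q pdisc (eta q)"

lemma pdisc_disj: "pdisc = ball 0 1 \<or> pdisc = ball 0 1 - {0}"
  by simp

lemmas open_pdisc = open_U[OF pdisc_disj]

lemma Ap_subset: "f \<in> Ap \<Longrightarrow> f \<in> Ap'"
  using Aspace_disc_subset by blast

lemma Aq_subset: "g \<in> Aq \<Longrightarrow> g \<in> Aq'"
  using Aspace_disc_subset by blast

lemma Np_punctured: "f \<in> Ap \<Longrightarrow> Np' f = Np f"
  using p by (intro Anorm_punctured) auto

lemma Nq_punctured: "g \<in> Aq \<Longrightarrow> Nq' g = Nq g"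
  using q_gt_1 eta_nonneg by (intro Anorm_punctured) auto

lemma Ap_decompose:
  assumes "f \<in> Ap'"
  obtains a F where "F \<in> Ap" "\<And>z. z \<in> pdisc \<Longrightarrow> f z = a * inverse z + F z"
proof (rule Aspace_punctured_decompose[OF assms p, of 0 1])
  show "Aint p disc (\<lambda>_. 1) (\<lambda>_. 1) < \<infinity>"
    using bounded_mem_Ap(1)[of "\<lambda>_. 1" 1] by (simp add: Aspace_iff)
qed (use p that in auto)

text \<open>The exponent \<open>2q - 4\<close> of the weight lies below the threshold
  \<open>2(q - 1)\<close> by exactly 2, whatever \<open>q\<close> is.\<close>

lemma Aq_decompose:
  assumes "g \<in> Aq'"
  obtains b G where "G \<in> Aq" "\<And>z. z \<in> pdisc \<Longrightarrow> g z = b * inverse z + G z"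
proof (rule Aspace_punctured_decompose[OF assms q_gt_1, of "2 * q - 4" "q - 1"])
  show "Aint q disc (eta q) (\<lambda>_. 1) < \<infinity>"
    by (rule Aint_one_less_top[OF disc_disj])
qed (use q_gt_1 eta_nonneg that in \<open>auto simp: eta_def\<close>)

lemma holomorphic_inverse_pdisc: "inverse holomorphic_on pdisc"
  by (rule holomorphic_on_inverse[OF holomorphic_on_ident, simplified]) auto

text \<open>Under \<open>chi p\<close> the two integrals of \<open>1/z\<close> coincide, so no separate discussion of \<open>p < 2\<close> is needed.\<close>

lemma inverse_mem_iff: "inverse \<in> Aq' \<longleftrightarrow> inverse \<in> Ap'"
proof -
  have "Aint q pdisc (eta q) inverse = (\<integral>\<^sup>+z. ennreal (cmod (indicator pdisc z *\<^sub>R inverse (chi p z)) powr q) \<partial>lborel)"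
    by (rule nn_integral_chi_Aint[OF pdisc_disj holomorphic_inverse_pdisc, symmetric])
  also have "\<dots> = Aint p pdisc (\<lambda>_. 1) inverse"
    unfolding Aint_def
  proof (intro nn_integral_cong)
    fix z
    have "(1 - p) * q = - ((p - 1) * q)"
      by (simp add: left_diff_distrib)
    also have "(p - 1) * q = p"
      using p q by simp
    finally have "inverse (cmod z powr (p - 1)) powr q = inverse (cmod z) powr p"
      by (simp add: powr_powr inverse_powr powr_minus[symmetric])
    then show "ennreal (cmod (indicator pdisc z *\<^sub>R inverse (chi p z)) powr q) = ennreal (cmod (inverse z) powr p * 1) * indicator pdisc z"
      using q_gt_1 by (auto simp: indicator_def norm_inverse norm_chi)
  qed
  finally show ?thesis
    using holomorphic_inverse_pdisc by (simp add: Aspace_iff)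
qed

lemma pairing_punctured:
  assumes "f \<in> Ap" "g \<in> Aq"
  shows "pairing p pdisc f g = pairing p disc f g"
  unfolding pairing_def set_lebesgue_integral_def
proof (rule integral_cong_AE)
  show "(\<lambda>z. indicator pdisc z *\<^sub>R (f z * cnj (g (chi p z)))) \<in> borel_measurable lborel"
    using pairing_bound(1)[OF pdisc_disj Ap_subset[OF assms(1)] Aq_subset[OF assms(2)]]
    unfolding set_integrable_def by (rule borel_measurable_integrable)
  show "(\<lambda>z. indicator disc z *\<^sub>R (f z * cnj (g (chi p z)))) \<in> borel_measurable lborel"
    using pairing_bound(1)[OF disc_disj assms]
    unfolding set_integrable_def by (rule borel_measurable_integrable)
  show "AE z in lborel. indicator pdisc z *\<^sub>R (f z * cnj (g (chi p z))) = indicator disc z *\<^sub>R (f z * cnj (g (chi p z)))"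
    using AE_lborel_singleton[of 0] by eventually_elim (simp add: indicator_def)
qed

text \<open>The case \<open>n = -1\<close> of \<open>pairing_monomial\<close>: no power in the
  series of \<open>g\<close> matches.\<close>

lemma pairing_inverse_Aq:
  assumes e: "inverse \<in> Ap'" and g: "g \<in> Aq"
  shows "pairing p pdisc inverse g = 0"
proof -
  have hol: "g holomorphic_on disc" using g by (simp add: Aspace_iff)
  have "(\<lambda>m. (deriv ^^ m) g 0 / fact m * w ^ m) sums g w" if "w \<in> pdisc" for w
    using holomorphic_power_series[OF hol, of w] that by simp
  from pairing_monomial[OF pdisc_disj _ Aq_subset[OF g] this, of "-1"] e show ?thesis
    by (simp add: power_int_minus)
qed

lemma bounded_functional_restrict:
  assumes "bounded_functional p pdisc L M"
  shows "bounded_functional p disc L M"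
  using assms Ap_subset by (auto simp: bounded_functional_def simp flip: Np_punctured)

text \<open>Pairing with \<open>1/z\<close> restricts to a bounded functional on \<open>Ap\<close>.
  It vanishes on monomials, so it is the zero functional.\<close>

lemma pairing_Ap_inverse:
  assumes e: "inverse \<in> Aq'" and f: "f \<in> Ap"
  shows "pairing p pdisc f inverse = 0"
proof (rule bounded_functional_eqI[OF bounded_functional_restrict[OF bounded_functional_pairing[OF pdisc_disj e]] Anorm_nonneg _ order_refl _ f])
  show "bounded_functional p disc (\<lambda>_. 0) 0"
    by (simp add: bounded_functional_def)
  fix n
  \<comment> \<open>The conjugated inverse of \<open>chi p z\<close> has rotation degree 1, so the
    integrand has degree \<open>n + 1\<close>.\<close>
  define a where "a = pi / real (Suc n)"
  have w: "cis a ^ Suc n = -1"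
    unfolding Complex.DeMoivre a_def by simp
  show "pairing p pdisc (\<lambda>z. z ^ n) inverse = 0"
    unfolding pairing_def set_lebesgue_integral_def
  proof (rule lborel_integral_equivariant_eq_0[where w = "cis a" and c = "-1"])
    show "(\<lambda>z. indicator pdisc z *\<^sub>R (z ^ n * cnj (inverse (chi p z)))) \<in> borel_measurable borel"
      by measurable
    fix z
    have "cis a * z \<in> pdisc \<longleftrightarrow> z \<in> pdisc"
      by (rule rotate_mem_iff[OF pdisc_disj]) simp
    moreover have "(cis a * z) ^ n * cnj (inverse (chi p (cis a * z))) = cis a ^ Suc n * (z ^ n * cnj (inverse (chi p z)))"
    proof -
      have "cnj (inverse (cis a)) = cis a"
        by (simp add: cis_cnj)
      then show ?thesis
        unfolding chi_rotate[OF norm_cis] power_mult_distrib inverse_mult_distrib complex_cnj_mult power_Suc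
        by (simp only: mult_ac)
    qed
    ultimately show "indicator pdisc (cis a * z) *\<^sub>R ((cis a * z) ^ n * cnj (inverse (chi p (cis a * z)))) = -1 * (indicator pdisc z *\<^sub>R (z ^ n * cnj (inverse (chi p z))))"
      unfolding w by (simp add: indicator_def)
  qed auto
qed

text \<open>The integrand is \<open>|z|^(-p)\<close>, which is positive on the punctured
  disc.\<close>

lemma pairing_inverse_inverse:
  assumes e: "inverse \<in> Ap'"
  shows "pairing p pdisc inverse inverse \<noteq> 0"
proof -
  have i: "integrable lborel (\<lambda>z. indicator pdisc z *\<^sub>R (inverse z * cnj (inverse (chi p z))))"
    using pairing_bound(1)[OF pdisc_disj e, of inverse] e inverse_mem_iff unfolding set_integrable_def by blast
  have eq: "Re (inverse z * cnj (inverse (chi p z))) = inverse (cmod z) * inverse (cmod z powr (p - 1))" for z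
  proof (cases "z = 0")
    case False
    have "inverse z * cnj (inverse (chi p z)) = inverse (z * cnj z * complex_of_real (cmod z powr (p - 2)))"
      by (simp add: chi_def)
    also have "z * cnj z * complex_of_real (cmod z powr (p - 2)) = complex_of_real ((cmod z)\<^sup>2 * cmod z powr (p - 2))"
      by (simp add: complex_norm_square[symmetric])
    also have "(cmod z)\<^sup>2 * cmod z powr (p - 2) = cmod z * cmod z powr (p - 1)"
      using False powr_add[of "cmod z" 2 "p - 2"] powr_add[of "cmod z" 1 "p - 1"] by simp
    finally show ?thesis
      by (simp only: of_real_inverse[symmetric] Re_complex_of_real inverse_mult_distrib)
  qed simp
  let ?k = "\<lambda>z. Re (indicator pdisc z *\<^sub>R (inverse z * cnj (inverse (chi p z))))"
  have k: "?k z = indicator pdisc z * (inverse (cmod z) * inverse (cmod z powr (p - 1)))" for z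
    by (simp only: scaleR_complex.simps(1) eq)
  have "(\<integral>z. ?k z \<partial>lborel) \<noteq> 0"
  proof
    assume "(\<integral>z. ?k z \<partial>lborel) = 0"
    then have "AE z in lborel. ?k z = 0"
      using integrable_Re[OF i] by (subst (asm) integral_nonneg_eq_0_iff_AE) (auto simp only: k intro!: AE_I2, auto)
    then have "AE z in lborel. z \<notin> disc"
      using AE_lborel_singleton[of 0] by eventually_elim (auto simp only: k, auto simp: indicator_def)
    then have "emeasure lborel disc = 0"
      by (subst (asm) AE_iff_measurable[of disc]) auto
    then show False
      by (simp add: emeasure_disc)
  qed
  then show ?thesis
    unfolding pairing_def set_lebesgue_integral_def integral_Re[OF i] by auto
qed

text \<open>If the polar coefficient \<open>b\<close> were nonzero, \<open>1/z\<close> would be a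
  combination of \<open>g\<close> and \<open>G\<close>, hence lie in both spaces, and testing with
  it would detect \<open>b\<close>.\<close>

lemma pairing_punctured_inject:
  assumes g: "g \<in> Aq'" and z: "\<And>f. f \<in> Ap' \<Longrightarrow> pairing p pdisc f g = 0" and w: "w \<in> pdisc"
  shows "g w = 0"
proof -
  obtain b G where G: "G \<in> Aq" and gG: "\<And>z. z \<in> pdisc \<Longrightarrow> g z = b * inverse z + G z"
    using Aq_decompose[OF g] by blast
  have "b = 0"
  proof (rule ccontr)
    assume b: "b \<noteq> 0"
    have "(\<lambda>z. (1 / b) * g z + (- 1 / b) * G z) \<in> Aq'"
      using q_gt_1 eta_nonneg by (intro Aspace_lincomb g Aq_subset[OF G] open_pdisc) auto
    moreover have "(1 / b) * g z + (- 1 / b) * G z = inverse z" if "z \<in> pdisc" for z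
      using b by (simp add: gG[OF that] field_simps)
    ultimately have e: "inverse \<in> Aq'"
      using Aspace_cong[of pdisc "\<lambda>z. (1 / b) * g z + (- 1 / b) * G z" inverse] by blast
    then have e': "inverse \<in> Ap'"
      using inverse_mem_iff by blast
    have "0 = pairing p pdisc inverse (\<lambda>z. b * inverse z + 1 * G z)"
      using z[OF e'] gG pairing_cong[OF pdisc_disj, of inverse inverse g "\<lambda>z. b * inverse z + 1 * G z"] by simp
    also have "\<dots> = cnj b * pairing p pdisc inverse inverse"
      using pairing_linear_right[OF pdisc_disj e' e Aq_subset[OF G], of b 1] pairing_inverse_Aq[OF e' G] by simp
    finally show False
      using b pairing_inverse_inverse[OF e'] by simp
  qed
  have "pairing p disc (\<lambda>z. z ^ n) G = 0" for n
  proof -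
    have "pairing p disc (\<lambda>z. z ^ n) G = pairing p pdisc (\<lambda>z. z ^ n) G"
      by (rule pairing_punctured[OF power_mem_Ap(1) G, symmetric])
    also have "\<dots> = pairing p pdisc (\<lambda>z. z ^ n) g"
      using gG \<open>b = 0\<close> by (intro pairing_cong[OF pdisc_disj]) auto
    also have "\<dots> = 0"
      by (rule z[OF Ap_subset[OF power_mem_Ap(1)]])
    finally show ?thesis .
  qed
  then have "G w = 0"
    using w by (intro pairing_disc_inject[OF G]) auto
  then show ?thesis
    using gG[OF w] \<open>b = 0\<close> by simp
qed

text \<open>When \<open>1/z\<close> belongs to the spaces, its pairings with the disc spaces vanish,
  so the disc solution \<open>G\<close> and the coefficient of \<open>1/z\<close> are found
  independently. Otherwise the punctured spaces are the disc spaces restricted to the punctured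
  disc.\<close>

lemma punctured_representation:
  assumes L: "bounded_functional p pdisc L M" and M: "0 \<le> M"
  shows "\<exists>g\<in>Aq'. Nq' g \<le> 4 * (Np' inverse / cmod (pairing p pdisc inverse inverse) * Nq' inverse + dual_const) * M
    \<and> (\<forall>f\<in>Ap'. L f = pairing p pdisc f g)"
proof -
  obtain G where G: "G \<in> Aq" "Nq G \<le> M * dual_const" "\<And>f. f \<in> Ap \<Longrightarrow> L f = pairing p disc f G"
    using disc_representation[OF bounded_functional_restrict[OF L] M] by blast
  have LF: "L F = pairing p pdisc F G" if "F \<in> Ap" for F
    using G that pairing_punctured by simp
  let ?c = "pairing p pdisc inverse inverse"
  have q1: "1 \<le> q" "0 < q" and p0: "0 < p" using q_gt_1 p by auto
  show ?thesis
  proof (cases "inverse \<in> Ap'")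
    case True
    then have e: "inverse \<in> Aq'" using inverse_mem_iff by blast
    \<comment> \<open>Chosen so that \<open>cnj b * ?c = L inverse\<close>; the conjugate reflects
      conjugate-linearity in the second argument.\<close>
    define b where "b = cnj (L inverse / ?c)"
    have c: "?c \<noteq> 0" by (rule pairing_inverse_inverse[OF True])
    define g where "g z = b * inverse z + 1 * G z" for z
    have g: "g \<in> Aq'"
      unfolding g_def using q1 eta_nonneg by (intro Aspace_lincomb e Aq_subset[OF G(1)] open_pdisc) auto
    have "cmod b \<le> M * Np' inverse / cmod ?c"
      using bounded_functionalD(2)[OF L True] by (simp add: b_def norm_divide divide_right_mono)
    then have "cmod b * Nq' inverse \<le> M * Np' inverse / cmod ?c * Nq' inverse"
      by (intro mult_right_mono) auto
    moreover have "Nq' g \<le> 4 * (cmod b * Nq' inverse + cmod 1 * Nq' G)"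
      unfolding g_def using q1 eta_nonneg by (intro Anorm_lincomb_le e Aq_subset[OF G(1)] open_pdisc) auto
    moreover have "Nq' G \<le> M * dual_const"
      using G by (simp add: Nq_punctured)
    ultimately have "Nq' g \<le> 4 * (M * Np' inverse / cmod ?c * Nq' inverse + M * dual_const)"
      by simp
    also have "\<dots> = 4 * (Np' inverse / cmod ?c * Nq' inverse + dual_const) * M"
      by (simp add: algebra_simps)
    finally have le: "Nq' g \<le> 4 * (Np' inverse / cmod ?c * Nq' inverse + dual_const) * M" .
    have "L f = pairing p pdisc f g" if f: "f \<in> Ap'" for f
    proof -
      obtain a F where F: "F \<in> Ap" and fF: "\<And>z. z \<in> pdisc \<Longrightarrow> f z = a * inverse z + F z"
        using Ap_decompose[OF f] by blast
      have g_eq: "pairing p pdisc h g = cnj b * pairing p pdisc h inverse + pairing p pdisc h G" if "h \<in> Ap'" for h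
        unfolding g_def by (subst pairing_linear_right[OF pdisc_disj that e Aq_subset[OF G(1)]]) simp
      have "L f = L (\<lambda>z. a * inverse z + 1 * F z)"
        using fF p0 by (intro bounded_functional_cong[OF L f _ open_pdisc]) auto
      also have "\<dots> = a * L inverse + L F"
        by (subst bounded_functionalD(1)[OF L True Ap_subset[OF F]]) simp
      also have "\<dots> = a * pairing p pdisc inverse g + pairing p pdisc F g"
        using g_eq[OF True] g_eq[OF Ap_subset[OF F]] pairing_inverse_Aq[OF True G(1)] pairing_Ap_inverse[OF e F] LF[OF F] c
        by (simp add: b_def)
      also have "\<dots> = pairing p pdisc (\<lambda>z. a * inverse z + 1 * F z) g"
        by (subst pairing_linear_left[OF pdisc_disj True Ap_subset[OF F] g]) simp
      also have "\<dots> = pairing p pdisc f g"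
        using fF by (intro pairing_cong[OF pdisc_disj]) auto
      finally show ?thesis .
    qed
    with g le show ?thesis by blast
  next
    case False
    have "L f = pairing p pdisc f G" if f: "f \<in> Ap'" for f
    proof -
      obtain a F where F: "F \<in> Ap" and fF: "\<And>z. z \<in> pdisc \<Longrightarrow> f z = a * inverse z + F z"
        using Ap_decompose[OF f] by blast
      have "a = 0"
      proof (rule ccontr)
        assume a: "a \<noteq> 0"
        have "(\<lambda>z. (1 / a) * f z + (- 1 / a) * F z) \<in> Ap'"
          using p0 by (intro Aspace_one_lincomb f Ap_subset[OF F] open_pdisc) auto
        moreover have "(1 / a) * f z + (- 1 / a) * F z = inverse z" if "z \<in> pdisc" for z
          using a by (simp add: fF[OF that] field_simps)
        ultimately show False
          using False Aspace_cong[of pdisc "\<lambda>z. (1 / a) * f z + (- 1 / a) * F z" inverse] by blast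
      qed
      then have "L f = L F"
        using fF p0 by (intro bounded_functional_cong[OF L f _ open_pdisc]) auto
      also have "\<dots> = pairing p pdisc F G"
        by (rule LF[OF F])
      also have "\<dots> = pairing p pdisc f G"
        using fF \<open>a = 0\<close> by (intro pairing_cong[OF pdisc_disj]) auto
      finally show ?thesis .
    qed
    \<comment> \<open>Here \<open>1/z\<close> is in neither space, so the extra term of the constant
      carries no meaning; it is nonnegative whatever the default values are, so the same constant
      works.\<close>
    moreover have "Nq' G \<le> 4 * (Np' inverse / cmod ?c * Nq' inverse + dual_const) * M"
    proof -
      have "0 \<le> Np' inverse / cmod ?c * Nq' inverse"
        by (intro mult_nonneg_nonneg divide_nonneg_nonneg) auto
      then have "1 * dual_const \<le> 4 * (Np' inverse / cmod ?c * Nq' inverse + dual_const)"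
        using dual_const_nonneg by simp
      then have "1 * dual_const * M \<le> 4 * (Np' inverse / cmod ?c * Nq' inverse + dual_const) * M"
        using M by (intro mult_right_mono)
      then show ?thesis
        using G(2) by (simp add: Nq_punctured[OF G(1)] mult.commute)
    qed
    ultimately show ?thesis
      using Aq_subset[OF G(1)] by blast
  qed
qed

section \<open>Both domains treated together\<close>

context
  fixes U :: "complex set"
  assumes U: "U = ball 0 1 \<or> U = ball 0 1 - {0}"
begin

lemma pairing_inject:
  assumes "g \<in> Aspace q U (eta q)" "\<And>f. f \<in> Aspace p U (\<lambda>_. 1) \<Longrightarrow> pairing p U f g = 0" "w \<in> U"
  shows "g w = 0"
  using U
proof
  assume "U = ball 0 1"
  with assms show ?thesis
    using pairing_disc_inject[of g w] power_mem_Ap(1) by simp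
next
  assume "U = ball 0 1 - {0}"
  with assms show ?thesis
    using pairing_punctured_inject[of g w] by blast
qed

text \<open>The constant precedes \<open>L\<close> and \<open>M\<close>: this uniformity is what
  \<open>bounded_inverse\<close> uses.\<close>

lemma representation:
  "\<exists>C. \<forall>L M. bounded_functional p U L M \<and> 0 \<le> M \<longrightarrow>
    (\<exists>g\<in>Aspace q U (eta q). Anorm q U (eta q) g \<le> C * M \<and> (\<forall>f\<in>Aspace p U (\<lambda>_. 1). L f = pairing p U f g))"
  using U
proof
  assume "U = ball 0 1"
  then show ?thesis
    using disc_representation by (intro exI[of _ dual_const]) (simp add: mult.commute)
next
  assume "U = ball 0 1 - {0}"
  then show ?thesis
    using punctured_representation
    by (intro exI[of _ "4 * (Np' inverse / cmod (pairing p pdisc inverse inverse) * Nq' inverse + dual_const)"]) simp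
qed

text \<open>Represent the functional of \<open>g\<close> itself, with the given bound
  \<open>M\<close>. The function obtained has norm at most \<open>C * M\<close>, and injectivity
  makes it equal to \<open>g\<close> on \<open>U\<close>.\<close>

lemma bounded_inverse:
  "\<exists>C. \<forall>g\<in>Aspace q U (eta q). \<forall>M\<ge>0. (\<forall>f\<in>Aspace p U (\<lambda>_. 1). cmod (pairing p U f g) \<le> M * Anorm p U (\<lambda>_. 1) f)
    \<longrightarrow> Anorm q U (eta q) g \<le> C * M"
proof -
  obtain C where C: "\<And>L M. bounded_functional p U L M \<Longrightarrow> 0 \<le> M \<Longrightarrow>
    \<exists>g\<in>Aspace q U (eta q). Anorm q U (eta q) g \<le> C * M \<and> (\<forall>f\<in>Aspace p U (\<lambda>_. 1). L f = pairing p U f g)"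
    using representation by blast
  have "Anorm q U (eta q) g \<le> C * M"
    if g: "g \<in> Aspace q U (eta q)" and M: "0 \<le> M"
      and le: "\<And>f. f \<in> Aspace p U (\<lambda>_. 1) \<Longrightarrow> cmod (pairing p U f g) \<le> M * Anorm p U (\<lambda>_. 1) f" for g M
  proof -
    have "bounded_functional p U (\<lambda>f. pairing p U f g) M"
      using bounded_functional_pairing[OF U g] le by (simp add: bounded_functional_def)
    then obtain g' where g': "g' \<in> Aspace q U (eta q)" "Anorm q U (eta q) g' \<le> C * M"
      and eq: "\<And>f. f \<in> Aspace p U (\<lambda>_. 1) \<Longrightarrow> pairing p U f g = pairing p U f g'"
      using C[OF _ M] by blast
    have d: "(\<lambda>z. 1 * g z + (-1) * g' z) \<in> Aspace q U (eta q)"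
      using q_gt_1 eta_nonneg by (intro Aspace_lincomb g g'(1) open_U[OF U]) auto
    have "g w = g' w" if "w \<in> U" for w
    proof -
      have "pairing p U f (\<lambda>z. 1 * g z + (-1) * g' z) = 0" if "f \<in> Aspace p U (\<lambda>_. 1)" for f
        by (subst pairing_linear_right[OF U that g g'(1)]) (simp add: eq[OF that])
      from pairing_inject[OF d this \<open>w \<in> U\<close>] show ?thesis by simp
    qed
    then have "Anorm q U (eta q) g = Anorm q U (eta q) g'"
      using open_U[OF U] by (intro Anorm_cong) auto
    then show ?thesis using g'(2) by simp
  qed
  then show ?thesis by blast
qed

end

end

theorem theorem7p6:
  fixes U :: "complex set" and p q :: real
  assumes U: "U = ball 0 1 \<or> U = ball 0 1 - {0}"
    and p: "1 < p"
    and q: "q = p / (p - 1)"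
  defines "Ap \<equiv> Aspace p U (\<lambda>_. 1)" and "Aq \<equiv> Aspace q U (eta q)"
  shows
    \<comment> \<open>the pairing is well defined\<close>
    "(\<forall>f\<in>Ap. \<forall>g\<in>Aq. set_integrable lborel U (\<lambda>z. f z * cnj (g (chi p z))))
     \<comment> \<open>each pairing is linear in f\<close>
     \<and> (\<forall>g\<in>Aq. \<forall>f1\<in>Ap. \<forall>f2\<in>Ap. \<forall>a b::complex.
          pairing p U (\<lambda>z. a * f1 z + b * f2 z) g = a * pairing p U f1 g + b * pairing p U f2 g)
     \<comment> \<open>the map g to the pairing is conjugate-linear\<close>
     \<and> (\<forall>f\<in>Ap. \<forall>g1\<in>Aq. \<forall>g2\<in>Aq. \<forall>a b::complex.
          pairing p U f (\<lambda>z. a * g1 z + b * g2 z) = cnj a * pairing p U f g1 + cnj b * pairing p U f g2)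
     \<comment> \<open>boundedness: the map lands in the dual and is a bounded operator\<close>
     \<and> (\<exists>C. \<forall>f\<in>Ap. \<forall>g\<in>Aq. cmod (pairing p U f g) \<le> C * Anorm p U (\<lambda>_. 1) f * Anorm q U (eta q) g)
     \<comment> \<open>injectivity\<close>
     \<and> (\<forall>g\<in>Aq. (\<forall>f\<in>Ap. pairing p U f g = 0) \<longrightarrow> (\<forall>z\<in>U. g z = 0))
     \<comment> \<open>surjectivity onto the dual of A^p(U)\<close>
     \<and> (\<forall>L :: (complex \<Rightarrow> complex) \<Rightarrow> complex.
          (\<forall>f1\<in>Ap. \<forall>f2\<in>Ap. \<forall>a b::complex. L (\<lambda>z. a * f1 z + b * f2 z) = a * L f1 + b * L f2)
          \<and> (\<exists>C. \<forall>f\<in>Ap. cmod (L f) \<le> C * Anorm p U (\<lambda>_. 1) f)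
          \<longrightarrow> (\<exists>g\<in>Aq. \<forall>f\<in>Ap. L f = pairing p U f g))
     \<comment> \<open>bounded inverse (norm equivalence with the dual norm)\<close>
     \<and> (\<exists>C. \<forall>g\<in>Aq. \<forall>M\<ge>0. (\<forall>f\<in>Ap. cmod (pairing p U f g) \<le> M * Anorm p U (\<lambda>_. 1) f)
            \<longrightarrow> Anorm q U (eta q) g \<le> C * M)"
proof -
  interpret conjugate_exponents p q
    using p q by unfold_locales
  note pairing_bound = pairing_bound[OF U]
  have bound: "\<exists>C. \<forall>f\<in>Aspace p U (\<lambda>_. 1). \<forall>g\<in>Aspace q U (eta q).
      cmod (pairing p U f g) \<le> C * Anorm p U (\<lambda>_. 1) f * Anorm q U (eta q) g"
    using pairing_bound(2) by (intro exI[of _ 1]) simp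
  have surj: "\<exists>g\<in>Aspace q U (eta q). \<forall>f\<in>Aspace p U (\<lambda>_. 1). L f = pairing p U f g"
    if lin: "\<forall>f1\<in>Aspace p U (\<lambda>_. 1). \<forall>f2\<in>Aspace p U (\<lambda>_. 1). \<forall>a b::complex. L (\<lambda>z. a * f1 z + b * f2 z) = a * L f1 + b * L f2"
      and bd: "\<exists>C. \<forall>f\<in>Aspace p U (\<lambda>_. 1). cmod (L f) \<le> C * Anorm p U (\<lambda>_. 1) f"
    for L :: "(complex \<Rightarrow> complex) \<Rightarrow> complex"
  proof -
    obtain C where C: "\<And>f. f \<in> Aspace p U (\<lambda>_. 1) \<Longrightarrow> cmod (L f) \<le> C * Anorm p U (\<lambda>_. 1) f"
      using bd by blast
    \<comment> \<open>The bound supplied for \<open>L\<close> may be negative, while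
      \<open>representation\<close> asks for a nonnegative one.\<close>
    have "cmod (L f) \<le> max 0 C * Anorm p U (\<lambda>_. 1) f" if "f \<in> Aspace p U (\<lambda>_. 1)" for f
      by (rule order_trans[OF C[OF that]], intro mult_right_mono) auto
    then have "bounded_functional p U L (max 0 C)"
      unfolding bounded_functional_def using lin by blast
    moreover have "0 \<le> max 0 C" by simp
    ultimately show ?thesis
      using representation[OF U] by blast
  qed
  have inj: "\<forall>g\<in>Aspace q U (eta q). (\<forall>f\<in>Aspace p U (\<lambda>_. 1). pairing p U f g = 0) \<longrightarrow> (\<forall>z\<in>U. g z = 0)"
    using pairing_inject[OF U] by blast
  show ?thesis
    unfolding Ap_def Aq_def
    by (intro conjI inj bound bounded_inverse[OF U] ballI allI impI pairing_bound(1) pairing_linear_left[OF U]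
        pairing_linear_right[OF U] surj) auto
qed

end
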